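(* Let $\mathfrak{o}$ be the ring of integers of a non-archimedean local field with finite residue field of odd characteristic, and for $0\le t\le\ell$ let $V^t=\mathrm{Ind}_{\mathbf{U}(\mathfrak{o}_\ell)}^{\mathrm{GL}_2(\mathfrak{o}_\ell)}(\psi_t)$ and $a(t,\ell)=\sup_{\rho\in\mathrm{Irr}(\mathrm{GL}_2(\mathfrak{o}_\ell))}\dim_{\mathbb{C}}\mathrm{Hom}_{\mathrm{GL}_2(\mathfrak{o}_\ell)}(V^t,\rho)$. (1) For $\ell\ge 1$, we have $a(\ell-1,\ell)=2$. (2) Let $\ell\ge 2$. For any cuspidal representation $\rho$ of $\mathrm{GL}_2(\mathfrak{o}_\ell)$, $\dim_{\mathbb{C}}\mathrm{Hom}_{\mathrm{GL}_2(\mathfrak{o}_\ell)}(V^t,\rho)=1$ for $t=\ell$, and $=0$ for $0\le t<\ell$. (3) Let $\ell\ge 2$ and $0\le t<\ell$. For any split semisimple representation $\rho$ of $\mathrm{GL}_2(\mathfrak{o}_\ell)$, $\dim_{\mathbb{C}}\mathrm{Hom}_{\mathrm{GL}_2(\mathfrak{o}_\ell)}(V^t,\rho)=2$.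
   Context: $\mathfrak{p}=(\varpi)$ is the maximal ideal of $\mathfrak{o}$, $\mathfrak{o}_\ell=\mathfrak{o}/\mathfrak{p}^\ell$, $q$ is the cardinality of the residue field $\mathbb{F}_q$. $\mathbf{U}(\mathfrak{o}_\ell)$ is the group of upper triangular unipotent matrices in $\mathrm{GL}_2(\mathfrak{o}_\ell)$. Fix a primitive character $\psi$ of $\mathfrak{o}_\ell$, i.e. an additive character $\mathfrak{o}_\ell\to\mathbb{C}^\times$ non-trivial on $\varpi^{\ell-1}\mathfrak{o}_\ell$; put $\psi_t\begin{pmatrix}1&u\\0&1\end{pmatrix}=\psi(\varpi^{\ell-t}u)$ for $0\le t\le \ell$. $\mathrm{Irr}(G)$ denotes the set of isomorphism classes of irreducible complex representations of $G$. For $\ell\ge2$ let $\mathbf{K}^{\ell-1}=\ker(\mathrm{GL}_2(\mathfrak{o}_\ell)\to\mathrm{GL}_2(\mathfrak{o}_{\ell-1}))$. Every character of the abelian group $\mathbf{K}^{\ell-1}$ has the form $\psi_x(I+\varpi^{\ell-1}y)=\psi(\varpi^{\ell-1}\mathrm{tr}(\hat{x}y))$ for a unique $x\in\mathfrak{gl}_2(\mathbb{F}_q)$, where $\hat x\in \mathfrak{gl}_2(\mathfrak{o}_\ell)$ is any lift of $x$. A regular (i.e. non-scalar) matrix $x\in\mathfrak{gl}_2(\mathbb{F}_q)$ is called cuspidal, split semisimple, or split non-semisimple if its characteristic polynomial has, respectively, no root, two distinct roots, or a repeated root in $\mathbb{F}_q$. An irreducible representation $\rho$ of $\mathrm{GL}_2(\mathfrak{o}_\ell)$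 is called cuspidal (resp. split semisimple) if the characters $\psi_x$ occurring in $\rho|_{\mathbf{K}^{\ell-1}}$ (they form a single conjugation orbit) have $x$ cuspidal (resp. split semisimple). *)

theory Defs
  imports
    "HOL-Algebra.Algebra"
    "HOL-Library.Function_Algebras"
    "HOL-Library.Extended_Nat"
    Complex_Main
begin

section \<open>Non-archimedean local fields and the rings \<open>\<oo>\<^sub>l\<close>\<close>

text \<open>
  A valuation is a function \<open>v\<close> whose value at \<open>0\<close> is irrelevant;
  \<open>val_ge v N x\<close> says \<open>v x \<ge> N\<close> under the convention \<open>v 0 = \<infinity>\<close>.
\<close>

definition val_ge :: "('a::field \<Rightarrow> int) \<Rightarrow> int \<Rightarrow> 'a \<Rightarrow> bool" where
  "val_ge v N x \<longleftrightarrow> x = 0 \<or> N \<le> v x"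

definition val_ring :: "('a::field \<Rightarrow> int) \<Rightarrow> 'a ring" where
  "val_ring v = \<lparr>carrier = {x. val_ge v 0 x}, monoid.mult = (*), one = 1, ring.zero = 0, ring.add = (+)\<rparr>"

definition max_ideal :: "('a::field \<Rightarrow> int) \<Rightarrow> 'a set" where
  "max_ideal v = {x. val_ge v 1 x}"

definition residue_field :: "('a::field \<Rightarrow> int) \<Rightarrow> 'a set ring" where
  "residue_field v = val_ring v Quot max_ideal v"

locale nonarch_local_field =
  fixes v :: "'a::field \<Rightarrow> int"
  assumes val_mult: "x \<noteq> 0 \<Longrightarrow> y \<noteq> 0 \<Longrightarrow> v (x * y) = v x + v y"
    and val_add: "x \<noteq> 0 \<Longrightarrow> y \<noteq> 0 \<Longrightarrow> x + y \<noteq> 0 \<Longrightarrow> min (v x) (v y) \<le> v (x + y)"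
    and val_normalised: "\<exists>x. x \<noteq> 0 \<and> v x = 1"
    and complete: "\<And>s :: nat \<Rightarrow> 'a. (\<forall>N. \<exists>n0. \<forall>m\<ge>n0. \<forall>n\<ge>n0. val_ge v N (s m - s n)) \<Longrightarrow>
      \<exists>x. \<forall>N. \<exists>n0. \<forall>n\<ge>n0. val_ge v N (s n - x)"
    and finite_residue_field: "finite (carrier (residue_field v))"

text \<open>The characteristic is the additive order of the unit element.\<close>

definition residue_char :: "('a::field \<Rightarrow> int) \<Rightarrow> nat" where
  "residue_char v = group.ord (add_monoid (residue_field v)) \<one>\<^bsub>residue_field v\<^esub>"

definition max_ideal_pow :: "('a::field \<Rightarrow> int) \<Rightarrow> nat \<Rightarrow> 'a set" where
  "max_ideal_pow v l = max_ideal v [^]\<^bsub>ideals_set (val_ring v)\<^esub> l"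

definition trunc_ring :: "('a::field \<Rightarrow> int) \<Rightarrow> nat \<Rightarrow> 'a set ring" where
  "trunc_ring v l = val_ring v Quot max_ideal_pow v l"

text \<open>The canonical map \<open>\<oo> \<rightarrow> \<oo>\<^sub>l\<close>.\<close>

definition trunc :: "('a::field \<Rightarrow> int) \<Rightarrow> nat \<Rightarrow> 'a \<Rightarrow> 'a set" where
  "trunc v l x = max_ideal_pow v l +>\<^bsub>val_ring v\<^esub> x"

text \<open>
  For an ideal \<open>J\<close> containing \<open>I\<close>, the canonical map \<open>\<oo>/I \<rightarrow> \<oo>/J\<close> sends a coset \<open>A\<close>
  to the coset \<open>J + A\<close>.
\<close>

definition reduce :: "('a::field \<Rightarrow> int) \<Rightarrow> 'a set \<Rightarrow> 'a set \<Rightarrow> 'a set" where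
  "reduce v J A = J <+>\<^bsub>val_ring v\<^esub> A"


section \<open>Two by two matrices over a ring\<close>

text \<open>\<open>Mat2 a b c d\<close> has rows \<open>(a, b)\<close> and \<open>(c, d)\<close>.\<close>

datatype 'r mat2 = Mat2 'r 'r 'r 'r

definition gl2 :: "('r, 'm) ring_scheme \<Rightarrow> 'r mat2 ring" where
  "gl2 R = \<lparr>carrier = {Mat2 a b c d | a b c d.
        a \<in> carrier R \<and> b \<in> carrier R \<and> c \<in> carrier R \<and> d \<in> carrier R},
     monoid.mult = (\<lambda>x y. case x of Mat2 a b c d \<Rightarrow> case y of Mat2 a' b' c' d' \<Rightarrow>
       Mat2 (a \<otimes>\<^bsub>R\<^esub> a' \<oplus>\<^bsub>R\<^esub> b \<otimes>\<^bsub>R\<^esub> c') (a \<otimes>\<^bsub>R\<^esub> b' \<oplus>\<^bsub>R\<^esub> b \<otimes>\<^bsub>R\<^esub> d')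
            (c \<otimes>\<^bsub>R\<^esub> a' \<oplus>\<^bsub>R\<^esub> d \<otimes>\<^bsub>R\<^esub> c') (c \<otimes>\<^bsub>R\<^esub> b' \<oplus>\<^bsub>R\<^esub> d \<otimes>\<^bsub>R\<^esub> d')),
     one = Mat2 \<one>\<^bsub>R\<^esub> \<zero>\<^bsub>R\<^esub> \<zero>\<^bsub>R\<^esub> \<one>\<^bsub>R\<^esub>,
     ring.zero = Mat2 \<zero>\<^bsub>R\<^esub> \<zero>\<^bsub>R\<^esub> \<zero>\<^bsub>R\<^esub> \<zero>\<^bsub>R\<^esub>,
     ring.add = (\<lambda>x y. case x of Mat2 a b c d \<Rightarrow> case y of Mat2 a' b' c' d' \<Rightarrow>
       Mat2 (a \<oplus>\<^bsub>R\<^esub> a') (b \<oplus>\<^bsub>R\<^esub> b') (c \<oplus>\<^bsub>R\<^esub> c') (d \<oplus>\<^bsub>R\<^esub> d'))\<rparr>"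

definition GL2 :: "('r, 'm) ring_scheme \<Rightarrow> 'r mat2 monoid" where
  "GL2 R = units_of (gl2 R)"

definition unipotent :: "('r, 'm) ring_scheme \<Rightarrow> 'r mat2 set" where
  "unipotent R = {Mat2 \<one>\<^bsub>R\<^esub> u \<zero>\<^bsub>R\<^esub> \<one>\<^bsub>R\<^esub> | u. u \<in> carrier R}"

definition smult2 :: "('r, 'm) ring_scheme \<Rightarrow> 'r \<Rightarrow> 'r mat2 \<Rightarrow> 'r mat2" where
  "smult2 R s x = map_mat2 (\<lambda>a. s \<otimes>\<^bsub>R\<^esub> a) x"

fun trace2 :: "('r, 'm) ring_scheme \<Rightarrow> 'r mat2 \<Rightarrow> 'r" where
  "trace2 R (Mat2 a b c d) = a \<oplus>\<^bsub>R\<^esub> d"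

fun det2 :: "('r, 'm) ring_scheme \<Rightarrow> 'r mat2 \<Rightarrow> 'r" where
  "det2 R (Mat2 a b c d) = a \<otimes>\<^bsub>R\<^esub> d \<ominus>\<^bsub>R\<^esub> b \<otimes>\<^bsub>R\<^esub> c"

text \<open>\<open>T\<^sup>2 - tr(x) T + det(x)\<close>; list polynomials start with the leading coefficient.\<close>

definition charpoly2 :: "('r, 'm) ring_scheme \<Rightarrow> 'r mat2 \<Rightarrow> 'r list" where
  "charpoly2 R x = [\<one>\<^bsub>R\<^esub>, \<ominus>\<^bsub>R\<^esub> trace2 R x, det2 R x]"

definition regular_mat :: "('r, 'm) ring_scheme \<Rightarrow> 'r mat2 \<Rightarrow> bool" where
  "regular_mat R x \<longleftrightarrow> x \<in> carrier (gl2 R) \<and> (\<nexists>s. x = Mat2 s \<zero>\<^bsub>R\<^esub> \<zero>\<^bsub>R\<^esub> s)"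

definition cuspidal_mat :: "('r, 'm) ring_scheme \<Rightarrow> 'r mat2 \<Rightarrow> bool" where
  "cuspidal_mat R x \<longleftrightarrow> regular_mat R x \<and> (\<nexists>r. ring.is_root R (charpoly2 R x) r)"

definition split_semisimple_mat :: "('r, 'm) ring_scheme \<Rightarrow> 'r mat2 \<Rightarrow> bool" where
  "split_semisimple_mat R x \<longleftrightarrow> regular_mat R x \<and>
     (\<exists>r s. r \<noteq> s \<and> ring.is_root R (charpoly2 R x) r \<and> ring.is_root R (charpoly2 R x) s)"


section \<open>Complex representations\<close>

text \<open>
  A representation of \<open>G\<close> is a subspace \<open>V\<close> of a complex vector space with scalar
  multiplication \<open>scale\<close>, together with an action \<open>\<pi>\<close>. The values of \<open>\<pi>\<close> outside
  \<open>carrier G\<close> and \<open>V\<close> are irrelevant.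
\<close>

locale complex_rep = group G + vector_space scale
  for G :: "('g, 'm) monoid_scheme" (structure)
    and scale :: "complex \<Rightarrow> 'v::ab_group_add \<Rightarrow> 'v" +
  fixes V :: "'v set" and \<pi> :: "'g \<Rightarrow> 'v \<Rightarrow> 'v"
  assumes rep_subspace: "subspace V"
    and rep_closed: "g \<in> carrier G \<Longrightarrow> w \<in> V \<Longrightarrow> \<pi> g w \<in> V"
    and rep_add: "g \<in> carrier G \<Longrightarrow> w \<in> V \<Longrightarrow> w' \<in> V \<Longrightarrow> \<pi> g (w + w') = \<pi> g w + \<pi> g w'"
    and rep_scale: "g \<in> carrier G \<Longrightarrow> w \<in> V \<Longrightarrow> \<pi> g (scale c w) = scale c (\<pi> g w)"
    and rep_one: "w \<in> V \<Longrightarrow> \<pi> \<one> w = w"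
    and rep_mult: "g \<in> carrier G \<Longrightarrow> h \<in> carrier G \<Longrightarrow> w \<in> V \<Longrightarrow> \<pi> (g \<otimes> h) w = \<pi> g (\<pi> h w)"

locale irreducible_rep = complex_rep +
  assumes nonzero: "V \<noteq> {0}"
    and irreducible: "subspace W \<Longrightarrow> W \<subseteq> V \<Longrightarrow> (\<forall>g\<in>carrier G. \<forall>w\<in>W. \<pi> g w \<in> W) \<Longrightarrow>
      W = {0} \<or> W = V"

text \<open>Scalar multiplication on a space of functions with values in a complex vector space.\<close>

definition fun_scale :: "(complex \<Rightarrow> 'w \<Rightarrow> 'w) \<Rightarrow> complex \<Rightarrow> ('v \<Rightarrow> 'w) \<Rightarrow> 'v \<Rightarrow> 'w" where
  "fun_scale scale c f = (\<lambda>x. scale c (f x))"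

lemma vector_space_fun_scale:
  assumes "vector_space scale"
  shows "vector_space (fun_scale scale)"
proof -
  interpret vector_space scale by fact
  show ?thesis
    by unfold_locales
      (simp_all add: fun_scale_def fun_eq_iff scale_right_distrib scale_left_distrib)
qed

text \<open>
  Intertwining operators \<open>V \<rightarrow> W\<close>, extended by \<open>0\<close> outside \<open>V\<close> so that distinct elements
  are distinct as maps on \<open>V\<close>.
\<close>

definition Hom_rep :: "('g, 'm) monoid_scheme \<Rightarrow>
    (complex \<Rightarrow> 'v::ab_group_add \<Rightarrow> 'v) \<Rightarrow> 'v set \<Rightarrow> ('g \<Rightarrow> 'v \<Rightarrow> 'v) \<Rightarrow>
    (complex \<Rightarrow> 'w::ab_group_add \<Rightarrow> 'w) \<Rightarrow> 'w set \<Rightarrow> ('g \<Rightarrow> 'w \<Rightarrow> 'w) \<Rightarrow> ('v \<Rightarrow> 'w) set" where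
  "Hom_rep G scale\<^sub>V V \<pi> scale\<^sub>W W \<sigma> = {f.
     (\<forall>x\<in>V. f x \<in> W) \<and>
     (\<forall>x\<in>V. \<forall>y\<in>V. f (x + y) = f x + f y) \<and>
     (\<forall>c. \<forall>x\<in>V. f (scale\<^sub>V c x) = scale\<^sub>W c (f x)) \<and>
     (\<forall>g\<in>carrier G. \<forall>x\<in>V. f (\<pi> g x) = \<sigma> g (f x)) \<and>
     (\<forall>x. x \<notin> V \<longrightarrow> f x = 0)}"

text \<open>
  The library's \<open>dim\<close> is \<open>0\<close> on infinite-dimensional spaces. Here \<open>G\<close> is finite, \<open>V\<close> is
  finite-dimensional and \<open>W\<close> is irreducible, so this case does not arise.
\<close>

definition dim_Hom :: "('g, 'm) monoid_scheme \<Rightarrow>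
    (complex \<Rightarrow> 'v::ab_group_add \<Rightarrow> 'v) \<Rightarrow> 'v set \<Rightarrow> ('g \<Rightarrow> 'v \<Rightarrow> 'v) \<Rightarrow>
    (complex \<Rightarrow> 'w::ab_group_add \<Rightarrow> 'w) \<Rightarrow> 'w set \<Rightarrow> ('g \<Rightarrow> 'w \<Rightarrow> 'w) \<Rightarrow> nat" where
  "dim_Hom G scale\<^sub>V V \<pi> scale\<^sub>W W \<sigma> =
     vector_space.dim (fun_scale scale\<^sub>W) (Hom_rep G scale\<^sub>V V \<pi> scale\<^sub>W W \<sigma>)"

text \<open>
  The representation induced from a character \<open>\<chi>\<close> of a subgroup \<open>H\<close>: functions on \<open>G\<close>
  (extended by \<open>0\<close> outside the carrier) with \<open>f (h g) = \<chi> h f g\<close>, under right translation.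
\<close>

definition Ind_space :: "('g, 'm) monoid_scheme \<Rightarrow> 'g set \<Rightarrow> ('g \<Rightarrow> complex) \<Rightarrow> ('g \<Rightarrow> complex) set" where
  "Ind_space G H \<chi> = {f.
     (\<forall>h\<in>H. \<forall>g\<in>carrier G. f (h \<otimes>\<^bsub>G\<^esub> g) = \<chi> h * f g) \<and> (\<forall>g. g \<notin> carrier G \<longrightarrow> f g = 0)}"

definition right_translation ::
    "('g, 'm) monoid_scheme \<Rightarrow> 'g \<Rightarrow> ('g \<Rightarrow> complex) \<Rightarrow> 'g \<Rightarrow> complex" where
  "right_translation G g f = (\<lambda>x. if x \<in> carrier G then f (x \<otimes>\<^bsub>G\<^esub> g) else 0)"

text \<open>
  Representatives of all isomorphism classes of irreducible representations of a finite
  group: these are finite-dimensional, hence occur on subspaces of \<open>nat \<Rightarrow> complex\<close>.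
  A class may have several representatives here.
\<close>

definition Irr :: "('g, 'm) monoid_scheme \<Rightarrow>
    ((nat \<Rightarrow> complex) set \<times> ('g \<Rightarrow> (nat \<Rightarrow> complex) \<Rightarrow> (nat \<Rightarrow> complex))) set" where
  "Irr G = {(V, \<pi>). irreducible_rep G (fun_scale (*)) V \<pi>}"

definition char_occurs :: "(complex \<Rightarrow> 'v::ab_group_add \<Rightarrow> 'v) \<Rightarrow> 'v set \<Rightarrow> ('g \<Rightarrow> 'v \<Rightarrow> 'v) \<Rightarrow>
    'g set \<Rightarrow> ('g \<Rightarrow> complex) \<Rightarrow> bool" where
  "char_occurs scale V \<pi> K \<chi> \<longleftrightarrow> (\<exists>w\<in>V. w \<noteq> 0 \<and> (\<forall>k\<in>K. \<pi> k w = scale (\<chi> k) w))"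


section \<open>Representations of \<open>GL\<^sub>2(\<oo>\<^sub>l)\<close>\<close>

definition complex_units :: "complex monoid" where
  "complex_units = \<lparr>carrier = UNIV - {0}, monoid.mult = (*), one = 1\<rparr>"

definition unif_pow :: "('a::field \<Rightarrow> int) \<Rightarrow> 'a \<Rightarrow> nat \<Rightarrow> nat \<Rightarrow> 'a set" where
  "unif_pow v \<omega> l n = trunc v l \<omega> [^]\<^bsub>trunc_ring v l\<^esub> n"

definition primitive_char :: "('a::field \<Rightarrow> int) \<Rightarrow> 'a \<Rightarrow> nat \<Rightarrow> ('a set \<Rightarrow> complex) \<Rightarrow> bool" where
  "primitive_char v \<omega> l \<psi> \<longleftrightarrow>
     \<psi> \<in> hom (add_monoid (trunc_ring v l)) complex_units \<and>
     (\<exists>u\<in>carrier (trunc_ring v l). \<psi> (unif_pow v \<omega> l (l - 1) \<otimes>\<^bsub>trunc_ring v l\<^esub> u) \<noteq> 1)"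

fun psi_unip :: "('a::field \<Rightarrow> int) \<Rightarrow> 'a \<Rightarrow> ('a set \<Rightarrow> complex) \<Rightarrow> nat \<Rightarrow> nat \<Rightarrow>
    'a set mat2 \<Rightarrow> complex" where
  "psi_unip v \<omega> \<psi> t l (Mat2 a u c d) = \<psi> (unif_pow v \<omega> l (l - t) \<otimes>\<^bsub>trunc_ring v l\<^esub> u)"

definition dim_Hom_V :: "('a::field \<Rightarrow> int) \<Rightarrow> 'a \<Rightarrow> ('a set \<Rightarrow> complex) \<Rightarrow> nat \<Rightarrow> nat \<Rightarrow>
    (complex \<Rightarrow> 'v::ab_group_add \<Rightarrow> 'v) \<Rightarrow> 'v set \<Rightarrow> ('a set mat2 \<Rightarrow> 'v \<Rightarrow> 'v) \<Rightarrow> nat" where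
  "dim_Hom_V v \<omega> \<psi> t l scale W \<rho> =
     (let G = GL2 (trunc_ring v l) in
      dim_Hom G
        (fun_scale (*)) (Ind_space G (unipotent (trunc_ring v l)) (psi_unip v \<omega> \<psi> t l))
        (right_translation G)
        scale W \<rho>)"

definition max_mult :: "('a::field \<Rightarrow> int) \<Rightarrow> 'a \<Rightarrow> ('a set \<Rightarrow> complex) \<Rightarrow> nat \<Rightarrow> nat \<Rightarrow> enat" where
  "max_mult v \<omega> \<psi> t l =
     (SUP (W, \<rho>)\<in>Irr (GL2 (trunc_ring v l)). enat (dim_Hom_V v \<omega> \<psi> t l (fun_scale (*)) W \<rho>))"

text \<open>The group \<open>K\<^sup>l\<^sup>-\<^sup>1\<close>, for \<open>l \<ge> 2\<close>.\<close>

definition last_congruence :: "('a::field \<Rightarrow> int) \<Rightarrow> nat \<Rightarrow> 'a set mat2 set" where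
  "last_congruence v l = kernel (GL2 (trunc_ring v l)) (GL2 (trunc_ring v (l - 1)))
     (map_mat2 (reduce v (max_ideal_pow v (l - 1))))"

text \<open>
  The character \<open>I + \<omega>\<^sup>l\<^sup>-\<^sup>1 y \<mapsto> \<psi>(\<omega>\<^sup>l\<^sup>-\<^sup>1 tr(x' y))\<close>, where \<open>x'\<close> is a lift of \<open>x\<close>; the value
  does not depend on \<open>x'\<close> and \<open>y\<close>.
\<close>

definition psi_mat :: "('a::field \<Rightarrow> int) \<Rightarrow> 'a \<Rightarrow> ('a set \<Rightarrow> complex) \<Rightarrow> nat \<Rightarrow>
    'a set mat2 \<Rightarrow> 'a set mat2 \<Rightarrow> complex" where
  "psi_mat v \<omega> \<psi> l x k =
     (let R = trunc_ring v l; p = unif_pow v \<omega> l (l - 1) in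
      THE z. \<exists>x'\<in>carrier (gl2 R). \<exists>y\<in>carrier (gl2 R).
        map_mat2 (reduce v (max_ideal v)) x' = x \<and>
        k = \<one>\<^bsub>gl2 R\<^esub> \<oplus>\<^bsub>gl2 R\<^esub> smult2 R p y \<and>
        z = \<psi> (p \<otimes>\<^bsub>R\<^esub> trace2 R (x' \<otimes>\<^bsub>gl2 R\<^esub> y)))"

definition cuspidal_rep :: "('a::field \<Rightarrow> int) \<Rightarrow> 'a \<Rightarrow> ('a set \<Rightarrow> complex) \<Rightarrow> nat \<Rightarrow>
    (complex \<Rightarrow> 'v::ab_group_add \<Rightarrow> 'v) \<Rightarrow> 'v set \<Rightarrow> ('a set mat2 \<Rightarrow> 'v \<Rightarrow> 'v) \<Rightarrow> bool" where
  "cuspidal_rep v \<omega> \<psi> l scale W \<rho> \<longleftrightarrow>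
     irreducible_rep (GL2 (trunc_ring v l)) scale W \<rho> \<and>
     (\<forall>x\<in>carrier (gl2 (residue_field v)).
        char_occurs scale W \<rho> (last_congruence v l) (psi_mat v \<omega> \<psi> l x) \<longrightarrow>
        cuspidal_mat (residue_field v) x)"

definition split_semisimple_rep :: "('a::field \<Rightarrow> int) \<Rightarrow> 'a \<Rightarrow> ('a set \<Rightarrow> complex) \<Rightarrow> nat \<Rightarrow>
    (complex \<Rightarrow> 'v::ab_group_add \<Rightarrow> 'v) \<Rightarrow> 'v set \<Rightarrow> ('a set mat2 \<Rightarrow> 'v \<Rightarrow> 'v) \<Rightarrow> bool" where
  "split_semisimple_rep v \<omega> \<psi> l scale W \<rho> \<longleftrightarrow>
     irreducible_rep (GL2 (trunc_ring v l)) scale W \<rho> \<and>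
     (\<forall>x\<in>carrier (gl2 (residue_field v)).
        char_occurs scale W \<rho> (last_congruence v l) (psi_mat v \<omega> \<psi> l x) \<longrightarrow>
        split_semisimple_mat (residue_field v) x)"

end

theory Submission
  imports Defs "HOL-Computational_Algebra.Fundamental_Theorem_Algebra"
begin

text \<open>
  By Frobenius reciprocity the multiplicities are the dimensions of the spaces \<open>E t\<close> of vectors on
  which \<open>U\<close> acts through \<open>\<psi>\<^sub>t\<close>. For \<open>t = l\<close> they are at most one by Gelfand's trick, with the
  anti-automorphism that exchanges the diagonal entries.

  Let \<open>l \<ge> 2\<close> and \<open>t < l\<close>. Then \<open>\<psi>\<^sub>t\<close> is trivial on \<open>U \<inter> K\<^sup>l\<^sup>-\<^sup>1\<close>, so \<open>E t \<noteq> 0\<close> makes a character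
  \<open>\<psi>\<^sub>x\<close> with upper triangular \<open>x\<close> occur, which is impossible in the cuspidal case. If \<open>x\<close> has diagonal
  \<open>(r, s)\<close> with \<open>r - s\<close> a unit, let \<open>Wt r s\<close> be the space of vectors of this type under
  \<open>B \<inter> K\<^sup>l\<^sup>-\<^sup>1\<close>. Elements of \<open>U\<close> and of the lower unipotent group commute on it up to the character
  \<open>\<psi>((r - s) b c)\<close>, so the latter shifts the characters of \<open>U\<close>, and \<open>Wt r s\<close> meets every \<open>E t\<close> and
  contains an eigenvector of the Borel subgroup. Averaging the translates of that eigenvector shows,
  by the Bruhat decomposition, that \<open>E t\<close> is the sum of a line in \<open>Wt s r\<close> and of its intersection with
  \<open>Wt r s\<close>; exchanging \<open>r\<close> and \<open>s\<close>, both parts are lines.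

  The remaining types for \<open>t = l - 1 \<ge> 1\<close> have \<open>r = s\<close>, where Gelfand's trick for the group generated by
  \<open>U\<close> and the diagonal part of \<open>K\<^sup>l\<^sup>-\<^sup>1\<close> gives dimension at most one. For \<open>l = 1\<close> the bound is the Bruhat
  decomposition, and it is attained in the principal series of a nontrivial character.
\<close>

section \<open>Linear algebra\<close>

text \<open>No classification of the representations is used. Two facts carry the upper bounds: the
  translates of one nonzero vector span an irreducible representation, so an eigenspace of a
  subgroup is spanned by averages of these translates; and commuting operators have a common
  eigenvector. The more symmetric the chosen vector, the fewer averages remain. The obstacle is that
  for \<open>l \<ge> 2\<close> the Borel subgroup and the big cell do not exhaust the group: the
  lower left entry c can be a nonzero non-unit. Hence the Borel eigenvector is sought inside
  \<open>Wt r s\<close>, a space that all matrices with c in the maximal ideal preserve; the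
  intermediate cells stay in it, and the big cell contributes a single line. The part inside
  \<open>Wt r s\<close> is not bounded directly: its bound comes from the decomposition for the
  exchanged pair, because \<open>Wt r s\<close> and \<open>Wt s r\<close> meet only in 0. That
  intersection, like the shifting of characters, needs r - s to be a unit.\<close>

locale complex_vector_space = vector_space scale
  for scale :: "complex \<Rightarrow> 'v::ab_group_add \<Rightarrow> 'v" (infixr "*s" 75)
begin

text \<open>Relative to a subset \<open>V\<close>, since the operators of a representation are
  arbitrary outside the space they act on.\<close>

definition linear_op :: "'v set \<Rightarrow> ('v \<Rightarrow> 'v) \<Rightarrow> bool" where
  "linear_op V T \<longleftrightarrow> (\<forall>x\<in>V. T x \<in> V) \<and> (\<forall>x\<in>V. \<forall>y\<in>V. T (x + y) = T x + T y) \<and>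
     (\<forall>c. \<forall>x\<in>V. T (c *s x) = c *s T x)"

lemma linear_op_sum:
  assumes "linear_op V T" "subspace V" "\<And>i. i \<in> A \<Longrightarrow> f i \<in> V"
  shows "T (\<Sum>i\<in>A. f i) = (\<Sum>i\<in>A. T (f i))"
proof -
  have 0: "T 0 = 0"
    using assms(1) subspace_0[OF assms(2)] unfolding linear_op_def
    by (metis scale_zero_left)
  show ?thesis
  proof (cases "finite A")
    case True
    then show ?thesis using assms(3)
    proof (induction A)
      case (insert a A)
      then show ?case
        using assms(1) subspace_sum[OF assms(2), of A f] unfolding linear_op_def by simp
    qed (simp add: 0)
  qed (simp add: 0)
qed

text \<open>\<open>E q\<close> below is q(T) w. Among the nonzero polynomials with q(T) w = 0 take
  one of least degree; it has a root z, and the cofactor r of X - z gives the eigenvector r(T) w,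
  which is nonzero by minimality.\<close>

lemma linear_op_eigenvector:
  assumes V: "subspace V" "V \<subseteq> span B" "finite B" and nz: "V \<noteq> {0}" and T: "linear_op V T"
  shows "\<exists>c. \<exists>w\<in>V. w \<noteq> 0 \<and> T w = c *s w"
proof -
  obtain w where w: "w \<in> V" "w \<noteq> 0"
    using nz subspace_0[OF V(1)] by auto
  define E :: "complex poly \<Rightarrow> 'v" where "E q = (\<Sum>i\<le>degree q. coeff q i *s (T ^^ i) w)" for q
  have it: "(T ^^ i) w \<in> V" for i
    using T w(1) by (induction i) (auto simp: linear_op_def)
  have E_eq: "E q = (\<Sum>i\<le>N. coeff q i *s (T ^^ i) w)" if "degree q \<le> N" for q N
    unfolding E_def using that
    by (intro sum.mono_neutral_left) (auto simp: coeff_eq_0)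
  have E_in: "E q \<in> V" for q
    unfolding E_def by (intro subspace_sum[OF V(1)] subspace_scale[OF V(1)] it)
  have E_lin: "E ([:-z, 1:] * q) = T (E q) - z *s E q" for z q
  proof -
    define N where "N = Suc (degree q)"
    have d: "degree ([:-z, 1:] * q) \<le> N" "degree q \<le> N"
      using degree_mult_le[of "[:-z, 1:]" q] unfolding N_def by auto
    have c: "coeff ([:-z, 1:] * q) i = (case i of 0 \<Rightarrow> 0 | Suc j \<Rightarrow> coeff q j) - z * coeff q i" for i
      by (cases i) (auto simp: coeff_pCons)
    have "E ([:-z, 1:] * q) = (\<Sum>i\<le>N. (case i of 0 \<Rightarrow> 0 | Suc j \<Rightarrow> coeff q j) *s (T ^^ i) w)
        - z *s (\<Sum>i\<le>N. coeff q i *s (T ^^ i) w)"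
      unfolding E_eq[OF d(1)] c by (simp add: scale_left_diff_distrib sum_subtractf scale_sum_right)
    also have "(\<Sum>i\<le>N. (case i of 0 \<Rightarrow> 0 | Suc j \<Rightarrow> coeff q j) *s (T ^^ i) w)
        = (\<Sum>i\<le>degree q. coeff q i *s (T ^^ Suc i) w)"
      unfolding N_def by (subst sum.atMost_Suc_shift) simp
    also have "\<dots> = T (E q)"
      unfolding E_def using T it V(1)
      by (subst linear_op_sum[OF T V(1)]) (auto simp: linear_op_def subspace_scale)
    finally show ?thesis using E_eq[OF d(2)] by simp
  qed
  \<comment> \<open>There is one more iterate of \<open>w\<close> than there are elements in the
    spanning set, hence a linear relation. Coincident iterates are treated apart, because
    \<open>dependent\<close> speaks of sets and would lose the repetition.\<close>
  have "\<exists>q. q \<noteq> 0 \<and> E q = 0"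
  proof -
    let ?n = "card B"
    have "\<exists>u::nat \<Rightarrow> complex. (\<exists>i\<le>?n. u i \<noteq> 0) \<and> (\<Sum>i\<le>?n. u i *s (T ^^ i) w) = 0"
    proof (cases "inj_on (\<lambda>i. (T ^^ i) w) {..?n}")
      case True
      let ?S = "(\<lambda>i. (T ^^ i) w) ` {..?n}"
      have "card ?S = Suc ?n" using True by (simp add: card_image)
      moreover have "?S \<subseteq> span B" using it V(2) by auto
      ultimately have "dependent ?S"
        using independent_span_bound[OF V(3), of ?S] by auto
      then obtain u where u: "\<exists>v\<in>?S. u v \<noteq> 0" "(\<Sum>v\<in>?S. u v *s v) = 0"
        by (auto simp: dependent_finite)
      then show ?thesis
        by (intro exI[of _ "\<lambda>i. u ((T ^^ i) w)"]) (auto simp: sum.reindex[OF True])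
    next
      case False
      then obtain i j where ij: "i \<le> ?n" "j \<le> ?n" "i \<noteq> j" "(T ^^ i) w = (T ^^ j) w"
        by (auto simp: inj_on_def)
      let ?u = "\<lambda>k. if k = i then 1 else if k = j then -1 else (0::complex)"
      have "(\<Sum>k\<le>?n. ?u k *s (T ^^ k) w) = (\<Sum>k\<in>{i,j}. ?u k *s (T ^^ k) w)"
        using ij by (intro sum.mono_neutral_right) auto
      then show ?thesis using ij by (intro exI[of _ ?u]) auto
    qed
    then obtain u i where u: "i \<le> ?n" "u i \<noteq> 0" "(\<Sum>i\<le>?n. u i *s (T ^^ i) w) = 0" by auto
    define q where "q = (\<Sum>i\<le>?n. monom (u i) i)"
    have cq: "coeff q i = (if i \<le> ?n then u i else 0)" for i
      unfolding q_def by (simp add: coeff_sum)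
    have "degree q \<le> ?n" by (intro degree_le) (auto simp: cq)
    moreover have "q \<noteq> 0" using cq[of i] u by auto
    ultimately show ?thesis using u(3) E_eq[of q ?n] by (intro exI[of _ q]) (simp add: cq)
  qed
  then obtain q where q: "q \<noteq> 0" "E q = 0" and min: "\<And>r. r \<noteq> 0 \<Longrightarrow> E r = 0 \<Longrightarrow> degree q \<le> degree r"
    using ex_has_least_nat[of "\<lambda>q. q \<noteq> 0 \<and> E q = 0" _ degree] by metis
  have "degree q > 0"
  proof (rule ccontr)
    assume "\<not> degree q > 0"
    then obtain c where c: "q = [:c:]" by (auto elim: degree_eq_zeroE)
    then show False using q w by (simp add: E_def)
  qed
  then obtain z where "poly q z = 0" using alg_closed_imp_poly_has_root by blast
  then obtain r where r: "q = [:-z, 1:] * r" by (auto simp: poly_eq_0_iff_dvd)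
  then have r0: "r \<noteq> 0" using q by auto
  have "degree q = Suc (degree r)" unfolding r using r0 by (subst degree_mult_eq) auto
  then have "E r \<noteq> 0" using min[OF r0] by auto
  then show ?thesis using E_lin[of z r] E_in[of r] q(2) r by auto
qed

lemma dim_proper_subspace:
  assumes "subspace E" "E \<subseteq> V" "E \<noteq> V" "V \<subseteq> span B" "finite B"
  shows "dim E < dim V"
proof -
  obtain C where C: "C \<subseteq> E" "independent C" "E \<subseteq> span C" "card C = dim E"
    using basis_exists by blast
  obtain D where D: "D \<subseteq> V" "independent D" "V \<subseteq> span D" "card D = dim V"
    using basis_exists by blast
  have D': "finite D" using independent_span_bound[OF assms(5) D(2) subset_trans[OF D(1) assms(4)]] by simp
  obtain v where v: "v \<in> V" "v \<notin> E" using assms by blast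
  have "span C = E" using C assms(1) span_subspace by blast
  then have i: "independent (insert v C)" using C v independent_insertI by blast
  have "insert v C \<subseteq> span D" using C v D assms by blast
  then have b: "finite (insert v C) \<and> card (insert v C) \<le> card D"
    by (rule independent_span_bound[OF D' i])
  moreover have "v \<notin> C" using v C by blast
  ultimately show ?thesis using C D by auto
qed

text \<open>Induction on the dimension: an operator of the family that is not scalar on
  \<open>V\<close> has a proper nonzero eigenspace, which the operators commuting with it
  preserve.\<close>

lemma common_eigenvector:
  assumes "subspace V" "V \<subseteq> span B" "finite B" "V \<noteq> {0}"
    and "\<And>T. T \<in> F \<Longrightarrow> linear_op V T"
    and "\<And>S T x. S \<in> F \<Longrightarrow> T \<in> F \<Longrightarrow> x \<in> V \<Longrightarrow> S (T x) = T (S x)"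
  shows "\<exists>w\<in>V. w \<noteq> 0 \<and> (\<forall>T\<in>F. \<exists>c. T w = c *s w)"
  using assms
proof (induction "dim V" arbitrary: V rule: less_induct)
  case less
  obtain w where w: "w \<in> V" "w \<noteq> 0"
    using less.prems(4) subspace_0[OF less.prems(1)] by auto
  show ?case
  proof (cases "\<forall>T\<in>F. \<exists>c. \<forall>w\<in>V. T w = c *s w")
    case True
    then show ?thesis using w by blast
  next
    case False
    then obtain T where T: "T \<in> F" "\<not> (\<exists>c. \<forall>w\<in>V. T w = c *s w)" by blast
    obtain c w where c: "w \<in> V" "w \<noteq> 0" "T w = c *s w"
      using linear_op_eigenvector[OF less.prems(1-4) less.prems(5)[OF T(1)]] by blast
    define E where "E = {w\<in>V. T w = c *s w}"
    note lT = less.prems(5)[OF T(1), unfolded linear_op_def]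
    have E: "subspace E"
    proof (rule subspaceI)
      show "0 \<in> E"
        using lT subspace_0[OF less.prems(1)] unfolding E_def
        by (metis (mono_tags, lifting) mem_Collect_eq scale_zero_left scale_zero_right)
      show "x + y \<in> E" if "x \<in> E" "y \<in> E" for x y
        using that lT less.prems(1) unfolding E_def by (simp add: subspace_add scale_right_distrib)
      show "a *s x \<in> E" if "x \<in> E" for a x
        using that lT less.prems(1) unfolding E_def by (simp add: subspace_scale scale_left_commute)
    qed
    have EV: "E \<subseteq> V" "E \<noteq> V" using T unfolding E_def by auto
    have nz: "E \<noteq> {0}" using c unfolding E_def by auto
    have "linear_op E S" if "S \<in> F" for S
      using less.prems(5)[OF that] less.prems(6)[OF T(1) that]
      unfolding linear_op_def E_def by fastforce
    then obtain w where "w \<in> E" "w \<noteq> 0" "\<forall>T\<in>F. \<exists>c. T w = c *s w"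
      using less.hyps[OF dim_proper_subspace[OF E EV less.prems(2,3)] E] less.prems EV nz
      by (metis (no_types, lifting) subset_iff)
    then show ?thesis using EV by blast
  qed
qed

lemma dim_line:
  assumes "w \<in> S" "w \<noteq> 0" "S \<subseteq> span {w}"
  shows "dim S = 1"
  using basis_card_eq_dim[of "{w}" S] assms by simp

lemma dim_plane:
  assumes "x \<in> S" "y \<in> S" "S \<subseteq> span {x, y}" "x \<noteq> 0" "y \<notin> span {x}"
  shows "dim S = 2"
proof -
  have "independent {y, x}" using assms independent_empty by (intro independent_insertI) auto
  moreover have "y \<noteq> x" using assms span_base by auto
  ultimately show ?thesis using basis_card_eq_dim[of "{x, y}" S] assms
    by (simp add: insert_commute)
qed

end

section \<open>Representations of finite groups\<close>

sublocale complex_rep \<subseteq> complex_vector_space scale by unfold_locales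

definition char_on :: "('g, 'm) monoid_scheme \<Rightarrow> 'g set \<Rightarrow> ('g \<Rightarrow> complex) \<Rightarrow> bool" where
  "char_on G H \<theta> \<longleftrightarrow> subgroup H G \<and> finite H \<and> (\<forall>h\<in>H. \<theta> h \<noteq> 0) \<and>
     (\<forall>h\<in>H. \<forall>h'\<in>H. \<theta> (h \<otimes>\<^bsub>G\<^esub> h') = \<theta> h * \<theta> h')"

text \<open>Closure under inverses is automatic for finite \<open>H\<close>: left multiplication by
  h is injective on \<open>H\<close>, hence hits the identity. Likewise \<open>\<theta>\<close>
  vanishes nowhere once it is nonzero at the identity.\<close>

lemma (in group) char_onI:
  assumes "finite H" "H \<subseteq> carrier G" "\<one> \<in> H" "\<And>h h'. h \<in> H \<Longrightarrow> h' \<in> H \<Longrightarrow> h \<otimes> h' \<in> H"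
    and "\<And>h h'. h \<in> H \<Longrightarrow> h' \<in> H \<Longrightarrow> \<theta> (h \<otimes> h') = \<theta> h * \<theta> h'" "\<theta> \<one> \<noteq> 0"
  shows "char_on G H \<theta>"
proof -
  have inv: "inv h \<in> H" if h: "h \<in> H" for h
  proof -
    have "inj_on (\<lambda>x. h \<otimes> x) H"
      using h assms(2) by (auto simp: inj_on_def subset_iff)
    then have "(\<lambda>x. h \<otimes> x) ` H = H"
      using assms(1,4) h by (intro endo_inj_surj) auto
    then obtain x where "x \<in> H" "h \<otimes> x = \<one>" using assms(3) by (metis imageE)
    then show ?thesis using h assms(2) by (metis inv_equality inv_inv subsetD inv_closed)
  qed
  have "\<theta> h \<noteq> 0" if "h \<in> H" for h
    using assms(5)[OF that inv[OF that]] assms(2,6) that by (auto simp: subset_iff)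
  then show ?thesis
    using assms inv unfolding char_on_def by (auto intro!: subgroupI)
qed

context group
begin

context
  fixes H \<theta>
  assumes ch: "char_on G H \<theta>"
begin

lemma char_on_simps:
  shows "h \<in> H \<Longrightarrow> h \<in> carrier G" "h \<in> H \<Longrightarrow> inv h \<in> H" "\<one> \<in> H" "finite H"
    "h \<in> H \<Longrightarrow> h' \<in> H \<Longrightarrow> h \<otimes> h' \<in> H"
    "h \<in> H \<Longrightarrow> \<theta> h \<noteq> 0"
    "h \<in> H \<Longrightarrow> h' \<in> H \<Longrightarrow> \<theta> (h \<otimes> h') = \<theta> h * \<theta> h'"
  using ch unfolding char_on_def
  by (auto simp: subgroup.m_closed subgroup.m_inv_closed subgroup.one_closed subgroup.mem_carrier)

lemma char_on_one: "\<theta> \<one> = 1"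
  using char_on_simps(6)[of \<one>] char_on_simps(7)[of \<one> \<one>] char_on_simps(3) by simp

lemma char_on_inv: "h \<in> H \<Longrightarrow> \<theta> (inv h) = inverse (\<theta> h)"
  using char_on_simps(7)[of h "inv h"] char_on_simps char_on_one
  by (intro inverse_unique[symmetric]) simp

lemma char_on_bij_left: "h \<in> H \<Longrightarrow> bij_betw (\<lambda>x. h \<otimes> x) H H"
  using char_on_simps
  by (intro bij_betw_byWitness[where f' = "\<lambda>x. inv h \<otimes> x"])
     (auto simp: m_assoc[symmetric])

lemma char_on_bij_right: "h \<in> H \<Longrightarrow> bij_betw (\<lambda>x. x \<otimes> h) H H"
  using char_on_simps
  by (intro bij_betw_byWitness[where f' = "\<lambda>x. x \<otimes> inv h"]) (auto simp: m_assoc)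

lemma char_on_mem_left:
  assumes "h \<in> H" "g \<in> carrier G"
  shows "h \<otimes> g \<in> H \<longleftrightarrow> g \<in> H"
proof
  assume "h \<otimes> g \<in> H"
  then have "inv h \<otimes> (h \<otimes> g) \<in> H" using assms char_on_simps(2,5) by blast
  then show "g \<in> H" using assms char_on_simps(1)[of h] by (simp add: m_assoc[symmetric])
qed (use assms char_on_simps(5) in blast)

lemma char_on_mem_right:
  assumes "h \<in> H" "g \<in> carrier G"
  shows "g \<otimes> h \<in> H \<longleftrightarrow> g \<in> H"
proof
  assume "g \<otimes> h \<in> H"
  then have "(g \<otimes> h) \<otimes> inv h \<in> H" using assms char_on_simps(2,5) by blast
  then show "g \<in> H" using assms char_on_simps(1)[of h] by (simp add: m_assoc)
qed (use assms char_on_simps(5) in blast)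

lemma char_on_card: "card H \<noteq> 0"
  using char_on_simps by auto

end

end

context complex_rep
begin

definition eigsp :: "'g set \<Rightarrow> ('g \<Rightarrow> complex) \<Rightarrow> 'v set" where
  "eigsp H \<theta> = {w\<in>V. \<forall>h\<in>H. \<pi> h w = scale (\<theta> h) w}"

text \<open>The projection of \<open>V\<close> onto \<open>eigsp H \<theta>\<close>; see
  \<open>avg_in_eigsp\<close> and \<open>avg_eq\<close>.\<close>

definition avg :: "'g set \<Rightarrow> ('g \<Rightarrow> complex) \<Rightarrow> 'v \<Rightarrow> 'v" where
  "avg H \<theta> w = scale (1 / of_nat (card H)) (\<Sum>h\<in>H. scale (inverse (\<theta> h)) (\<pi> h w))"

lemma rep_zero: "g \<in> carrier G \<Longrightarrow> \<pi> g 0 = 0"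
  using rep_scale[of g 0 0] subspace_0[OF rep_subspace] by simp

lemma rep_linear_op: "g \<in> carrier G \<Longrightarrow> linear_op V (\<pi> g)"
  unfolding linear_op_def using rep_closed rep_add rep_scale by blast

lemma rep_sum: "g \<in> carrier G \<Longrightarrow> (\<And>i. i \<in> A \<Longrightarrow> f i \<in> V) \<Longrightarrow> \<pi> g (\<Sum>i\<in>A. f i) = (\<Sum>i\<in>A. \<pi> g (f i))"
  using linear_op_sum[OF rep_linear_op rep_subspace] .

lemmas rep_sub = subspace_scale[OF rep_subspace] subspace_add[OF rep_subspace] subspace_0[OF rep_subspace]

lemma rep_inv: "g \<in> carrier G \<Longrightarrow> w \<in> V \<Longrightarrow> \<pi> (inv g) (\<pi> g w) = w"
  using rep_mult[of "inv g" g w] rep_one by simp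

lemma rep_nonzero: "g \<in> carrier G \<Longrightarrow> w \<in> V \<Longrightarrow> w \<noteq> 0 \<Longrightarrow> \<pi> g w \<noteq> 0"
  using rep_inv[of g w] rep_zero[of "inv g"] by auto

lemma subspace_eigsp: "H \<subseteq> carrier G \<Longrightarrow> subspace (eigsp H \<theta>)"
  unfolding eigsp_def
  by (intro subspaceI)
     (auto simp: rep_sub rep_zero rep_add rep_scale scale_right_distrib subset_iff mult.commute)

context
  fixes H \<theta>
  assumes ch: "char_on G H \<theta>"
begin

lemmas char_on_simps' = char_on_simps[OF ch]

lemma avg_closed: "w \<in> V \<Longrightarrow> avg H \<theta> w \<in> V"
  unfolding avg_def using char_on_simps'
  by (intro rep_sub subspace_sum[OF rep_subspace] rep_closed) auto

lemma avg_linear_op: "linear_op V (avg H \<theta>)"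
  unfolding linear_op_def using char_on_simps'(1)
  by (simp add: avg_closed) (simp add: avg_def rep_add rep_scale scale_right_distrib sum.distrib
      scale_sum_right mult.commute mult.left_commute)

lemma avg_left:
  assumes h: "h \<in> H" and w: "w \<in> V"
  shows "\<pi> h (avg H \<theta> w) = scale (\<theta> h) (avg H \<theta> w)"
proof -
  note s = char_on_simps'
  have "\<pi> h (avg H \<theta> w) = scale (1 / of_nat (card H)) (\<Sum>x\<in>H. \<pi> h (scale (inverse (\<theta> x)) (\<pi> x w)))"
    unfolding avg_def using s h w
    by (subst rep_scale) (auto intro!: subspace_sum[OF rep_subspace] rep_sub rep_closed rep_sum)
  also have "(\<Sum>x\<in>H. \<pi> h (scale (inverse (\<theta> x)) (\<pi> x w)))
     = (\<Sum>x\<in>H. scale (\<theta> h) (scale (inverse (\<theta> (h \<otimes> x))) (\<pi> (h \<otimes> x) w)))"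
    using s h w by (intro sum.cong) (auto simp: rep_scale rep_closed rep_mult divide_simps)
  also have "\<dots> = scale (\<theta> h) (\<Sum>x\<in>H. scale (inverse (\<theta> (h \<otimes> x))) (\<pi> (h \<otimes> x) w))"
    by (simp only: scale_sum_right)
  also have "(\<Sum>x\<in>H. scale (inverse (\<theta> (h \<otimes> x))) (\<pi> (h \<otimes> x) w)) = (\<Sum>x\<in>H. scale (inverse (\<theta> x)) (\<pi> x w))"
    by (rule sum.reindex_bij_betw[OF char_on_bij_left[OF ch h], of "\<lambda>x. scale (inverse (\<theta> x)) (\<pi> x w)"])
  finally show ?thesis unfolding avg_def by (simp add: mult.commute)
qed

lemma avg_in_eigsp: "w \<in> V \<Longrightarrow> avg H \<theta> w \<in> eigsp H \<theta>"
  unfolding eigsp_def using avg_left avg_closed by auto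

lemma avg_right:
  assumes h: "h \<in> H" and w: "w \<in> V"
  shows "avg H \<theta> (\<pi> h w) = scale (\<theta> h) (avg H \<theta> w)"
proof -
  note s = char_on_simps'
  have "(\<Sum>x\<in>H. scale (inverse (\<theta> x)) (\<pi> x (\<pi> h w)))
     = (\<Sum>x\<in>H. scale (\<theta> h) (scale (inverse (\<theta> (x \<otimes> h))) (\<pi> (x \<otimes> h) w)))"
    using s h w by (intro sum.cong) (auto simp: rep_mult divide_simps)
  also have "\<dots> = scale (\<theta> h) (\<Sum>x\<in>H. scale (inverse (\<theta> (x \<otimes> h))) (\<pi> (x \<otimes> h) w))"
    by (simp only: scale_sum_right)
  also have "(\<Sum>x\<in>H. scale (inverse (\<theta> (x \<otimes> h))) (\<pi> (x \<otimes> h) w)) = (\<Sum>x\<in>H. scale (inverse (\<theta> x)) (\<pi> x w))"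
    by (rule sum.reindex_bij_betw[OF char_on_bij_right[OF ch h], of "\<lambda>x. scale (inverse (\<theta> x)) (\<pi> x w)"])
  finally show ?thesis unfolding avg_def by (simp add: mult.commute)
qed

lemma avg_eq:
  assumes "w \<in> eigsp H \<theta>"
  shows "avg H \<theta> w = w"
proof -
  have "(\<Sum>x\<in>H. scale (inverse (\<theta> x)) (\<pi> x w)) = (\<Sum>x\<in>H. w)"
    using assms char_on_simps' unfolding eigsp_def by (intro sum.cong) auto
  then show ?thesis unfolding avg_def
    using char_on_card[OF ch] by (simp add: sum_constant_scale)
qed

text \<open>Right multiplication by \<open>g\<close> is injective, so \<open>g H \<subseteq> H g\<close> forces equality for finite \<open>H\<close>.\<close>

lemma avg_commute:
  assumes g: "g \<in> carrier G" and w: "w \<in> V"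
    and n: "\<And>h. h \<in> H \<Longrightarrow> \<exists>h'\<in>H. g \<otimes> h = h' \<otimes> g \<and> \<theta> h' = \<theta> h"
  shows "\<pi> g (avg H \<theta> w) = avg H \<theta> (\<pi> g w)"
proof -
  note s = char_on_simps'
  obtain f where f: "\<And>h. h \<in> H \<Longrightarrow> f h \<in> H \<and> g \<otimes> h = f h \<otimes> g \<and> \<theta> (f h) = \<theta> h"
    using n by metis
  have "inj_on f H"
    by (rule inj_onI) (metis f g l_cancel s(1))
  then have b: "bij_betw f H H"
    using f s(4) by (metis bij_betw_imageI endo_inj_surj image_subsetI)
  have "\<pi> g (avg H \<theta> w) = scale (1 / of_nat (card H)) (\<Sum>x\<in>H. \<pi> g (scale (inverse (\<theta> x)) (\<pi> x w)))"
    unfolding avg_def using s g w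
    by (subst rep_scale) (auto intro!: subspace_sum[OF rep_subspace] rep_sub rep_closed rep_sum)
  also have "(\<Sum>x\<in>H. \<pi> g (scale (inverse (\<theta> x)) (\<pi> x w)))
     = (\<Sum>x\<in>H. scale (inverse (\<theta> (f x))) (\<pi> (f x) (\<pi> g w)))"
    using s g w f by (intro sum.cong) (auto simp: rep_scale rep_closed rep_mult[symmetric])
  also have "\<dots> = (\<Sum>x\<in>H. scale (inverse (\<theta> x)) (\<pi> x (\<pi> g w)))"
    by (rule sum.reindex_bij_betw[OF b, of "\<lambda>x. scale (inverse (\<theta> x)) (\<pi> x (\<pi> g w))"])
  finally show ?thesis unfolding avg_def .
qed

end

end

context irreducible_rep
begin

lemma orbit_span:
  assumes w: "w \<in> V" "w \<noteq> 0"
  shows "span ((\<lambda>g. \<pi> g w) ` carrier G) = V"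
proof -
  let ?S = "(\<lambda>g. \<pi> g w) ` carrier G"
  have sub: "span ?S \<subseteq> V" using w rep_closed by (intro span_minimal[OF _ rep_subspace]) auto
  \<comment> \<open>Membership in \<open>V\<close> is carried along in the induction, since
    additivity of \<open>\<pi> g\<close> is known on \<open>V\<close> only.\<close>
  have "\<pi> g x \<in> span ?S \<and> x \<in> V" if g: "g \<in> carrier G" and x: "x \<in> span ?S" for g x
    using x
  proof (induction rule: span_induct_alt)
    case base
    show ?case using g by (simp add: rep_zero span_zero rep_sub)
  next
    case (step c a b)
    then obtain k where k: "k \<in> carrier G" "a = \<pi> k w" by auto
    have "\<pi> g a \<in> ?S" using k g w by (auto simp: rep_mult[symmetric])
    moreover have "a \<in> V" "b \<in> V" using step sub k w rep_closed by auto
    ultimately show ?case using step g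
      by (simp add: rep_add rep_scale rep_sub span_add span_scale span_base)
  qed
  then have "span ?S = {0} \<or> span ?S = V"
    by (intro irreducible sub) auto
  moreover have "w \<in> span ?S"
    using w rep_one by (intro span_base) (metis imageI one_closed)
  ultimately show ?thesis using w by auto
qed

lemma finite_dimensional:
  assumes "finite (carrier G)"
  shows "\<exists>B. finite B \<and> V \<subseteq> span B"
proof -
  obtain w where "w \<in> V" "w \<noteq> 0"
    using nonzero subspace_0[OF rep_subspace] by auto
  then show ?thesis using orbit_span[of w] assms
    by (intro exI[of _ "(\<lambda>g. \<pi> g w) ` carrier G"]) auto
qed

text \<open>\<open>avg H \<theta>\<close> maps \<open>V\<close> onto the eigenspace, so it maps the
  spanning orbit of \<open>w\<close> to a spanning set. Translates in one double coset of
  \<open>H\<close> and the stabiliser of the line of \<open>w\<close> contribute proportional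
  vectors; this is how dimensions get bounded.\<close>

lemma eigsp_span:
  assumes ch: "char_on G H \<theta>" and w: "w \<in> V" "w \<noteq> 0"
  shows "eigsp H \<theta> \<subseteq> span ((\<lambda>g. avg H \<theta> (\<pi> g w)) ` carrier G)"
proof
  let ?A = "(\<lambda>g. avg H \<theta> (\<pi> g w)) ` carrier G"
  fix v assume v: "v \<in> eigsp H \<theta>"
  then have "v \<in> span ((\<lambda>g. \<pi> g w) ` carrier G)"
    using orbit_span[OF w] by (auto simp: eigsp_def)
  then have "avg H \<theta> v \<in> span ?A \<and> v \<in> V"
  proof (induction rule: span_induct_alt)
    case base
    show ?case using linear_op_sum[OF avg_linear_op[OF ch] rep_subspace, of "{}"]
      by (simp add: span_zero rep_sub)
  next
    case (step c a b)
    then have a: "a \<in> V" using w rep_closed by auto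
    have "avg H \<theta> (scale c a + b) = scale c (avg H \<theta> a) + avg H \<theta> b"
      using avg_linear_op[OF ch] a step unfolding linear_op_def by (simp add: rep_sub)
    then show ?case using step a
      by (auto intro!: span_add span_scale rep_sub intro: span_base)
  qed
  then show "v \<in> span ?A" using avg_eq[OF ch v] by simp
qed

lemma eigsp_span_subset:
  assumes "char_on G H \<theta>" "w \<in> V" "w \<noteq> 0" "subspace S"
    and "\<And>g. g \<in> carrier G \<Longrightarrow> avg H \<theta> (\<pi> g w) \<in> S"
  shows "eigsp H \<theta> \<subseteq> S"
  by (rule order_trans[OF eigsp_span[OF assms(1-3)] span_minimal[OF _ assms(4)]])
    (use assms(5) in auto)

text \<open>A form of Schur's lemma: the scalar by which a central element acts on one vector
  spreads along the orbit of that vector, which spans.\<close>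

lemma central_scalar:
  assumes z: "z \<in> carrier G" "\<And>g. g \<in> carrier G \<Longrightarrow> z \<otimes> g = g \<otimes> z"
    and w: "w \<in> V" "w \<noteq> 0" "\<pi> z w = scale c w" and x: "x \<in> V"
  shows "\<pi> z x = scale c x"
proof -
  have "x \<in> span ((\<lambda>g. \<pi> g w) ` carrier G)" using orbit_span[OF w(1,2)] x by simp
  then have "\<pi> z x = scale c x \<and> x \<in> V"
  proof (induction rule: span_induct_alt)
    case base
    show ?case using z by (simp add: rep_zero rep_sub)
  next
    case (step k a b)
    then obtain g where g: "g \<in> carrier G" "a = \<pi> g w" by auto
    have "\<pi> z a = \<pi> (g \<otimes> z) w" using g z w by (simp add: rep_mult[symmetric])
    also have "\<dots> = scale c a" using g z w by (simp add: rep_mult rep_scale)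
    finally show ?case using step g z w
      by (simp add: rep_add rep_scale rep_sub rep_closed scale_right_distrib mult.commute)
  qed
  then show ?thesis by simp
qed

text \<open>Gelfand's trick: the operators \<open>e \<pi>(g) e\<close>, where \<open>e\<close> projects onto the eigenspace, commute,
  because they are fixed by the anti-automorphism \<open>\<sigma>\<close>. A common eigenvector then spans the
  eigenspace.\<close>

lemma gelfand_trick:
  assumes fin: "finite (carrier G)" and ch: "char_on G H \<theta>"
    and \<sigma>: "\<And>g. g \<in> carrier G \<Longrightarrow> \<sigma> g \<in> carrier G" "\<And>g. g \<in> carrier G \<Longrightarrow> \<sigma> (\<sigma> g) = g"
      "\<And>g h. g \<in> carrier G \<Longrightarrow> h \<in> carrier G \<Longrightarrow> \<sigma> (g \<otimes> h) = \<sigma> h \<otimes> \<sigma> g"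
      "\<And>h. h \<in> H \<Longrightarrow> \<sigma> h \<in> H" "\<And>h. h \<in> H \<Longrightarrow> \<theta> (\<sigma> h) = \<theta> h"
    and crit: "\<And>g. g \<in> carrier G \<Longrightarrow>
      (\<exists>h\<in>H. \<exists>h'\<in>H. \<sigma> g = h \<otimes> g \<otimes> h' \<and> \<theta> h * \<theta> h' = 1) \<or>
      (\<exists>h\<in>H. \<exists>h'\<in>H. h \<otimes> g = g \<otimes> h' \<and> \<theta> h \<noteq> \<theta> h')"
    and w: "w \<in> eigsp H \<theta>" "w \<noteq> 0"
  shows "eigsp H \<theta> \<subseteq> span {w}"
proof -
  note s = char_on_simps[OF ch]
  define F where "F g x = avg H \<theta> (\<pi> g x)" for g x
  let ?E = "eigsp H \<theta>"
  have EV: "?E \<subseteq> V" unfolding eigsp_def by auto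
  have subE: "subspace ?E" using subspace_eigsp s by blast
  have eE: "\<pi> h x = scale (\<theta> h) x" if "h \<in> H" "x \<in> ?E" for h x
    using that unfolding eigsp_def by auto
  have Fin: "F g x \<in> ?E" if "g \<in> carrier G" "x \<in> V" for g x
    unfolding F_def using avg_in_eigsp[OF ch] rep_closed that by auto
  have lin: "linear_op ?E (F g)" if g: "g \<in> carrier G" for g
    using avg_linear_op[OF ch] Fin[OF g] rep_linear_op[OF g] EV unfolding linear_op_def F_def
    by (auto simp: subset_iff)
  have Fl: "F (h \<otimes> g) x = scale (\<theta> h) (F g x)" if "h \<in> H" "g \<in> carrier G" "x \<in> V" for h g x
    unfolding F_def using that s(1) by (simp add: rep_mult avg_right[OF ch] rep_closed)
  have Fr: "F (g \<otimes> h) x = scale (\<theta> h) (F g x)" if "h \<in> H" "g \<in> carrier G" "x \<in> ?E" for h g x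
  proof -
    have x: "x \<in> V" using that EV by auto
    have "F (g \<otimes> h) x = avg H \<theta> (scale (\<theta> h) (\<pi> g x))"
      unfolding F_def using that s(1) x by (simp add: rep_mult eE rep_scale)
    then show ?thesis unfolding F_def using avg_linear_op[OF ch] x rep_closed that
      by (simp add: linear_op_def)
  qed
  have F0: "F g x = 0" if "h \<in> H" "h' \<in> H" "h \<otimes> g = g \<otimes> h'" "\<theta> h \<noteq> \<theta> h'" "g \<in> carrier G" "x \<in> ?E" for g
      h h' x
  proof -
    have "scale (\<theta> h) (F g x) = scale (\<theta> h') (F g x)"
      using Fl[of h g x] Fr[of h' g x] that EV by auto
    then show ?thesis using that by simp
  qed
  \<comment> \<open>In the first case the scalars of h and h' cancel. In the second, g and, after
    applying \<open>\<sigma>\<close>, also \<open>\<sigma> g\<close> relate different values of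
    \<open>\<theta>\<close>, so both operators vanish.\<close>
  have F\<sigma>: "F (\<sigma> g) x = F g x" if g: "g \<in> carrier G" and x: "x \<in> ?E" for g x
    using crit[OF g]
  proof (elim disjE bexE conjE)
    fix h h' assume h: "h \<in> H" "h' \<in> H" "\<sigma> g = h \<otimes> g \<otimes> h'" "\<theta> h * \<theta> h' = 1"
    have "F (\<sigma> g) x = scale (\<theta> h') (scale (\<theta> h) (F g x))"
      unfolding h(3) using h g x s(1) EV by (subst Fr) (auto simp: Fl)
    then show ?thesis using h(4) by (simp add: mult.commute)
  next
    fix h h' assume h: "h \<in> H" "h' \<in> H" "h \<otimes> g = g \<otimes> h'" "\<theta> h \<noteq> \<theta> h'"
    have "\<sigma> h' \<otimes> \<sigma> g = \<sigma> g \<otimes> \<sigma> h"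
      using h g s(1) \<sigma>(3) by metis
    then have "F (\<sigma> g) x = 0" using h \<sigma> g x by (intro F0[of "\<sigma> h'" "\<sigma> h"]) auto
    then show ?thesis using F0[OF h g x] by simp
  qed
  \<comment> \<open>The composite of two of these operators is an average of operators of the same
    kind; \<open>\<sigma>\<close> reverses the products inside and permutes \<open>H\<close>, which
    gives the commutation.\<close>
  have Ff: "F g (F k x) = scale (1 / of_nat (card H)) (\<Sum>h\<in>H. scale (inverse (\<theta> h)) (F (g \<otimes> h \<otimes> k) x))"
    if "g \<in> carrier G" "k \<in> carrier G" "x \<in> V" for g k x
  proof -
    have V: "\<pi> k x \<in> V" using that rep_closed by auto
    have L: "linear_op V (F g)"
      using avg_linear_op[OF ch] rep_linear_op[OF that(1)] unfolding linear_op_def F_def by auto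
    have "F g (F k x) = F g (scale (1 / of_nat (card H)) (\<Sum>h\<in>H. scale (inverse (\<theta> h)) (\<pi> h (\<pi> k x))))"
      by (simp add: F_def[of k] avg_def[of H \<theta> "\<pi> k x"])
    also have "\<dots> = scale (1 / of_nat (card H)) (\<Sum>h\<in>H. scale (inverse (\<theta> h)) (F g (\<pi> h (\<pi> k x))))"
      using L V s(1)
      by (simp add: linear_op_def subspace_sum[OF rep_subspace] rep_sub rep_closed
          linear_op_sum[OF L rep_subspace])
    finally show ?thesis using that s(1) unfolding F_def by (simp add: rep_mult rep_closed m_assoc)
  qed
  have comm: "F g (F k x) = F k (F g x)" if g: "g \<in> carrier G" and k: "k \<in> carrier G" and x: "x \<in> ?E"
      for g k x
  proof -
    have xV: "x \<in> V" using x EV by auto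
    have b: "bij_betw \<sigma> H H"
      using \<sigma> s(1) by (intro bij_betw_byWitness[where f' = \<sigma>]) auto
    have "(\<Sum>h\<in>H. scale (inverse (\<theta> h)) (F (g \<otimes> h \<otimes> k) x))
        = (\<Sum>h\<in>H. scale (inverse (\<theta> (\<sigma> h))) (F (\<sigma> k \<otimes> \<sigma> h \<otimes> \<sigma> g) x))"
    proof (intro sum.cong refl)
      fix h assume h: "h \<in> H"
      have "\<sigma> (g \<otimes> h \<otimes> k) = \<sigma> k \<otimes> \<sigma> h \<otimes> \<sigma> g"
        using \<sigma> g k s(1)[OF h] by (simp add: m_assoc)
      then show "scale (inverse (\<theta> h)) (F (g \<otimes> h \<otimes> k) x)
          = scale (inverse (\<theta> (\<sigma> h))) (F (\<sigma> k \<otimes> \<sigma> h \<otimes> \<sigma> g) x)"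
        using F\<sigma>[of "g \<otimes> h \<otimes> k" x] g k s(1)[OF h] x \<sigma>(5)[OF h] by simp
    qed
    also have "\<dots> = (\<Sum>h\<in>H. scale (inverse (\<theta> h)) (F (\<sigma> k \<otimes> h \<otimes> \<sigma> g) x))"
      by (rule sum.reindex_bij_betw[OF b, of "\<lambda>h. scale (inverse (\<theta> h)) (F (\<sigma> k \<otimes> h \<otimes> \<sigma> g) x)"])
    finally have "F g (F k x) = F (\<sigma> k) (F (\<sigma> g) x)"
      using Ff[OF g k xV] Ff[OF \<sigma>(1)[OF k] \<sigma>(1)[OF g] xV] by simp
    then show ?thesis using F\<sigma> k g x Fin xV by simp
  qed
  obtain B where B: "finite B" "V \<subseteq> span B" using finite_dimensional[OF fin] by auto
  have nz: "?E \<noteq> {0}" using w by auto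
  have "\<exists>u\<in>?E. u \<noteq> 0 \<and> (\<forall>T\<in>F ` carrier G. \<exists>c. T u = scale c u)"
    using subE B EV nz lin comm
    by (intro common_eigenvector[of ?E B]) auto
  then obtain u where u: "u \<in> ?E" "u \<noteq> 0" "\<And>g. g \<in> carrier G \<Longrightarrow> \<exists>c. F g u = scale c u" by auto
  have "avg H \<theta> (\<pi> g u) \<in> span {u}" if "g \<in> carrier G" for g
    using u(3)[OF that] unfolding F_def span_singleton by auto
  then have "?E \<subseteq> span {u}"
    using u EV by (intro eigsp_span_subset[OF ch _ u(2) subspace_span]) auto
  moreover have "u \<in> span {w}"
  proof -
    obtain c where c: "w = scale c u" using calculation w by (auto simp: span_singleton)
    then have "u = scale (inverse c) w" using w by auto
    then show ?thesis by (auto simp: span_singleton)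
  qed
  ultimately show ?thesis using span_minimal[of "{u}" "span {w}"] by auto
qed

end

lemma sum_fun_apply: "(\<Sum>i\<in>A. f i) x = (\<Sum>i\<in>A. f i x)"
  by (induction A rule: infinite_finite_induct) auto

lemma dim_linear_image:
  assumes 1: "vector_space s1" and 2: "vector_space s2" and f: "Vector_Spaces.linear s1 s2 f"
    and S: "module.subspace s1 S" and inj: "\<And>x. x \<in> S \<Longrightarrow> f x = 0 \<Longrightarrow> x = 0"
  shows "vector_space.dim s2 (f ` S) = vector_space.dim s1 S"
proof -
  interpret a: vector_space s1 by fact
  interpret b: vector_space s2 by fact
  interpret f: Vector_Spaces.linear s1 s2 f by fact
  obtain B where B: "B \<subseteq> S" "a.independent B" "S \<subseteq> a.span B" "card B = a.dim S"
    using a.basis_exists by blast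
  have sp: "a.span B = S" using B S a.span_subspace by blast
  have inj': "inj_on f S"
  proof (rule inj_onI)
    fix x y assume "x \<in> S" "y \<in> S" "f x = f y"
    then show "x = y" using inj[of "x - y"] a.subspace_diff[OF S] by (simp add: f.diff)
  qed
  have "b.independent (f ` B)"
    using f.independent_injective_image[OF B(2)] inj' sp by simp
  moreover have "f ` S \<subseteq> b.span (f ` B)" using f.spans_image[OF B(3)] .
  moreover have "card (f ` B) = card B" using inj' B(1) by (meson card_image inj_on_subset)
  ultimately show ?thesis
    using b.basis_card_eq_dim[of "f ` B" "f ` S"] B(4) image_mono[OF B(1), of f] by simp
qed

context complex_rep
begin

lemma subspace_Hom_rep:
  assumes 1: "vector_space s" and 2: "module.subspace s Y" and \<sigma>: "\<And>g x. g \<in> carrier G \<Longrightarrow> x \<in> Y \<Longrightarrow> \<sigma> g x \<in> Y"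
  shows "module.subspace (fun_scale scale) (Hom_rep G s Y \<sigma> scale V \<pi>)"
proof -
  interpret f: vector_space "fun_scale scale"
    by (rule vector_space_fun_scale) (rule vector_space_axioms)
  show ?thesis
    by (rule f.subspaceI)
      (auto simp: Hom_rep_def fun_scale_def rep_sub rep_zero rep_add rep_scale scale_right_distrib
        scale_left_commute add_ac)
qed

text \<open>Frobenius reciprocity: an intertwiner is determined by the image of the function \<open>f0\<close> that
  extends \<open>\<chi>\<close> by zero.\<close>

lemma dim_Hom_Ind:
  assumes fin: "finite (carrier G)" and ch: "char_on G H \<chi>"
  shows "dim_Hom G (fun_scale (*)) (Ind_space G H \<chi>) (right_translation G) scale V \<pi> = dim (eigsp H \<chi>)"
proof -
  note s = char_on_simps[OF ch]
  let ?I = "Ind_space G H \<chi>" and ?R = "right_translation G"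
  let ?Hom = "Hom_rep G (fun_scale (*)) ?I ?R scale V \<pi>"
  interpret c: vector_space "(*) :: complex \<Rightarrow> complex \<Rightarrow> complex"
    by unfold_locales (auto simp: algebra_simps)
  interpret fc: vector_space "fun_scale (*) :: complex \<Rightarrow> ('g \<Rightarrow> complex) \<Rightarrow> _"
    by (rule vector_space_fun_scale) (rule c.vector_space_axioms)
  interpret fs: vector_space "fun_scale scale :: complex \<Rightarrow> (('g \<Rightarrow> complex) \<Rightarrow> 'v) \<Rightarrow> _"
    by (rule vector_space_fun_scale) (rule vector_space_axioms)
  define f0 where "f0 x = (if x \<in> H then \<chi> x else 0)" for x
  have sI: "fc.subspace ?I"
    by (rule fc.subspaceI) (auto simp: Ind_space_def fun_scale_def distrib_left mult.left_commute)
  have RI: "?R g f \<in> ?I" if "g \<in> carrier G" "f \<in> ?I" for g f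
    using that s by (auto simp: Ind_space_def right_translation_def m_assoc)
  note inH = char_on_mem_left[OF ch]
  note inH' = char_on_mem_right[OF ch]
  have f0: "f0 \<in> ?I"
    using s inH by (auto simp: Ind_space_def f0_def)
  have Rf0: "?R h f0 = fun_scale (*) (\<chi> h) f0" if "h \<in> H" for h
    using that s inH' by (auto simp: right_translation_def fun_scale_def f0_def fun_eq_iff)
  \<comment> \<open>The candidate for the intertwiner that sends \<open>f0\<close> to w. For w in
    the eigenspace the summand is constant on each coset H g, so every term occurs
    \<open>card H\<close> times; hence the factor.\<close>
  define D where "D f w = scale (1 / of_nat (card H)) (\<Sum>g\<in>carrier G. scale (f g) (\<pi> (inv g) w))" for f w
  have lin: "Vector_Spaces.linear (fun_scale scale) scale (\<lambda>F. F f0)"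
    unfolding Vector_Spaces.linear_iff using fs.vector_space_axioms vector_space_axioms
    by (auto simp: fun_scale_def)
  \<comment> \<open>The translates of \<open>f0\<close> span the induced space, with f itself
    supplying the coefficients; so an intertwiner that kills \<open>f0\<close> is zero.\<close>
  have rec: "f = fun_scale (*) (1 / of_nat (card H)) (\<Sum>g\<in>carrier G. fun_scale (*) (f g) (?R (inv g) f0))"
    if f: "f \<in> ?I" for f
  proof
    fix x
    show "f x = fun_scale (*) (1 / of_nat (card H)) (\<Sum>g\<in>carrier G. fun_scale (*) (f g) (?R (inv g) f0)) x"
    proof (cases "x \<in> carrier G")
      case True
      have "(\<Sum>g\<in>carrier G. fun_scale (*) (f g) (?R (inv g) f0)) x
          = (\<Sum>g\<in>carrier G. f g * f0 (x \<otimes> inv g))"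
        using True by (simp add: sum_fun_apply fun_scale_def right_translation_def)
      also have "\<dots> = (\<Sum>g\<in>(\<lambda>h. inv h \<otimes> x) ` H. f g * f0 (x \<otimes> inv g))"
      proof (intro sum.mono_neutral_right ballI)
        fix g assume "g \<in> carrier G - (\<lambda>h. inv h \<otimes> x) ` H"
        then have g: "g \<in> carrier G" "\<And>h. h \<in> H \<Longrightarrow> g \<noteq> inv h \<otimes> x" by auto
        have "x \<otimes> inv g \<notin> H"
          using g(2)[of "x \<otimes> inv g"] g(1) True by (auto simp: inv_mult_group m_assoc)
        then show "f g * f0 (x \<otimes> inv g) = 0" by (simp add: f0_def)
      qed (use fin True s in auto)
      also have "\<dots> = (\<Sum>h\<in>H. f (inv h \<otimes> x) * f0 (x \<otimes> inv (inv h \<otimes> x)))"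
        using s True by (subst sum.reindex) (auto simp: inj_on_def)
      also have "\<dots> = (\<Sum>h\<in>H. f x)"
      proof (intro sum.cong refl)
        fix h assume h: "h \<in> H"
        have "x \<otimes> inv (inv h \<otimes> x) = h"
          using h s True by (simp add: inv_mult_group m_assoc[symmetric])
        moreover have "f (inv h \<otimes> x) = \<chi> (inv h) * f x"
          using f h s True by (simp add: Ind_space_def)
        ultimately show "f (inv h \<otimes> x) * f0 (x \<otimes> inv (inv h \<otimes> x)) = f x"
          using h s(6)[OF h] by (simp add: f0_def char_on_inv[OF ch])
      qed
      finally show ?thesis using char_on_card[OF ch] by (simp add: fun_scale_def)
    next
      case False
      then show ?thesis using f by (simp add: Ind_space_def fun_scale_def sum_fun_apply
          right_translation_def)
    qed
  qed
  have inj: "F = 0" if F: "F \<in> ?Hom" and 0: "F f0 = 0" for F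
  proof
    have L: "F (\<Sum>i\<in>A. k i) = (\<Sum>i\<in>A. F (k i))" if "finite A" "\<And>i. i \<in> A \<Longrightarrow> k i \<in> ?I" for A :: "'g set" and k
      using that
    proof (induction A)
      case empty
      have "F (fun_scale (*) 0 f0) = scale 0 (F f0)" using F f0 unfolding Hom_rep_def by blast
      then show ?case by (simp add: fun_scale_def zero_fun_def)
    next
      case (insert a A)
      then have "F (k a + sum k A) = F (k a) + F (sum k A)"
        using F fc.subspace_sum[OF sI, of A k] unfolding Hom_rep_def by blast
      moreover have "F (sum k A) = (\<Sum>i\<in>A. F (k i))" using insert by blast
      moreover have "sum k (insert a A) = k a + sum k A" using insert by (intro sum.insert)
      moreover have "(\<Sum>i\<in>insert a A. F (k i)) = F (k a) + (\<Sum>i\<in>A. F (k i))"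
        using insert by (intro sum.insert)
      ultimately show ?case by presburger
    qed
    fix f
    show "F f = 0 f"
    proof (cases "f \<in> ?I")
      case True
      have "F (fun_scale (*) (f g) (?R (inv g) f0)) = 0" if "g \<in> carrier G" for g
        using F f0 0 RI[of "inv g" f0] rep_zero[of "inv g"] that unfolding Hom_rep_def by auto
      then have "F (\<Sum>g\<in>carrier G. fun_scale (*) (f g) (?R (inv g) f0)) = 0"
        by (subst L) (auto simp: fin RI f0 fc.subspace_scale[OF sI])
      moreover have "F f = scale (1 / of_nat (card H)) (F (\<Sum>g\<in>carrier G. fun_scale (*) (f g) (?R (inv g)
          f0)))"
        by (subst rec[OF True]) (use F in \<open>auto simp: Hom_rep_def RI f0 fc.subspace_scale[OF sI]
            fc.subspace_sum[OF sI]\<close>)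
      ultimately show ?thesis by simp
    next
      case False
      then show ?thesis using F by (auto simp: Hom_rep_def)
    qed
  qed
  have img: "(\<lambda>F. F f0) ` ?Hom = eigsp H \<chi>"
  proof (intro equalityI subsetI)
    fix w assume "w \<in> (\<lambda>F. F f0) ` ?Hom"
    then obtain F where F: "F \<in> ?Hom" "w = F f0" by auto
    show "w \<in> eigsp H \<chi>"
      unfolding eigsp_def
    proof (intro CollectI conjI ballI)
      show "w \<in> V" using F f0 unfolding Hom_rep_def by auto
      fix h assume h: "h \<in> H"
      have "\<pi> h w = F (?R h f0)" using F f0 s(1)[OF h] unfolding Hom_rep_def by auto
      also have "\<dots> = scale (\<chi> h) w" unfolding Rf0[OF h] using F f0 unfolding Hom_rep_def by auto
      finally show "\<pi> h w = scale (\<chi> h) w" .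
    qed
  next
    fix w assume w: "w \<in> eigsp H \<chi>"
    then have wV: "w \<in> V" and wh: "\<And>h. h \<in> H \<Longrightarrow> \<pi> h w = scale (\<chi> h) w" by (auto simp: eigsp_def)
    define F where "F f = (if f \<in> ?I then D f w else 0)" for f
    have DV: "D f w \<in> V" for f
      unfolding D_def using wV by (intro rep_sub subspace_sum[OF rep_subspace] rep_closed) auto
    have "D (?R k f) w = \<pi> k (D f w)" if k: "k \<in> carrier G" and f: "f \<in> ?I" for k f
    proof -
      have "(\<Sum>g\<in>carrier G. scale (?R k f g) (\<pi> (inv g) w))
          = (\<Sum>g\<in>carrier G. scale (f (g \<otimes> k)) (\<pi> (k \<otimes> inv (g \<otimes> k)) w))"
        using k by (intro sum.cong) (auto simp: right_translation_def inv_mult_group m_assoc[symmetric])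
      also have "\<dots> = (\<Sum>g\<in>carrier G. scale (f g) (\<pi> (k \<otimes> inv g) w))"
      proof (rule sum.reindex_bij_betw[of "\<lambda>g. g \<otimes> k" _ _ "\<lambda>g. scale (f g) (\<pi> (k \<otimes> inv g) w)"])
        show "bij_betw (\<lambda>g. g \<otimes> k) (carrier G) (carrier G)"
          using k by (intro bij_betw_byWitness[where f' = "\<lambda>g. g \<otimes> inv k"]) (auto simp: m_assoc)
      qed
      also have "\<dots> = (\<Sum>g\<in>carrier G. \<pi> k (scale (f g) (\<pi> (inv g) w)))"
        using k wV by (intro sum.cong) (auto simp: rep_mult rep_scale rep_closed)
      also have "\<dots> = \<pi> k (\<Sum>g\<in>carrier G. scale (f g) (\<pi> (inv g) w))"
        using k wV by (subst rep_sum) (auto intro!: rep_sub rep_closed)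
      finally show ?thesis unfolding D_def
        using k wV by (subst rep_scale) (auto intro!: subspace_sum[OF rep_subspace] rep_sub rep_closed)
    qed
    then have "F \<in> ?Hom"
      unfolding Hom_rep_def F_def
      using fc.subspace_add[OF sI] fc.subspace_scale[OF sI] RI DV
      by (auto simp: D_def fun_scale_def scale_left_distrib sum.distrib scale_right_distrib
          scale_sum_right mult.left_commute)
    moreover have "F f0 = w"
    proof -
      have "(\<Sum>g\<in>carrier G. scale (f0 g) (\<pi> (inv g) w)) = (\<Sum>g\<in>H. scale (f0 g) (\<pi> (inv g) w))"
        using fin s by (intro sum.mono_neutral_right) (auto simp: f0_def)
      also have "\<dots> = (\<Sum>g\<in>H. w)"
      proof (intro sum.cong refl)
        fix g assume g: "g \<in> H"
        show "scale (f0 g) (\<pi> (inv g) w) = w"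
          using g s(6)[OF g] s(2)[OF g] by (simp add: f0_def wh char_on_inv[OF ch])
      qed
      finally show ?thesis using f0 char_on_card[OF ch] by (simp add: F_def D_def sum_constant_scale)
    qed
    ultimately show "w \<in> (\<lambda>F. F f0) ` ?Hom" by force
  qed
  show ?thesis
    unfolding dim_Hom_def img[symmetric]
    using subspace_Hom_rep[OF fc.vector_space_axioms sI RI]
    by (intro dim_linear_image[symmetric, OF fs.vector_space_axioms vector_space_axioms lin] inj) auto
qed

lemma irreducible_subrep:
  assumes "finite B" "V \<subseteq> span B" "V \<noteq> {0}"
  shows "\<exists>W\<subseteq>V. irreducible_rep G scale W \<pi>"
proof -
  define P where "P W \<longleftrightarrow> subspace W \<and> W \<subseteq> V \<and> (\<forall>g\<in>carrier G. \<forall>w\<in>W. \<pi> g w \<in> W) \<and> W \<noteq> {0}" for W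
  have "P V" unfolding P_def using assms rep_subspace rep_closed by auto
  then obtain W where W: "P W" and min: "\<And>Y. P Y \<Longrightarrow> dim W \<le> dim Y"
    using ex_has_least_nat[of P V dim] by auto
  have W': "subspace W" "W \<subseteq> V" "\<And>g w. g \<in> carrier G \<Longrightarrow> w \<in> W \<Longrightarrow> \<pi> g w \<in> W" "W \<noteq> {0}"
    using W unfolding P_def by auto
  have "irreducible_rep G scale W \<pi>"
  proof unfold_locales
    fix Y assume Y: "subspace Y" "Y \<subseteq> W" "\<forall>g\<in>carrier G. \<forall>w\<in>Y. \<pi> g w \<in> Y"
    show "Y = {0} \<or> Y = W"
    proof (rule ccontr)
      assume a: "\<not> (Y = {0} \<or> Y = W)"
      then have "P Y" unfolding P_def using Y W' by auto
      moreover have "dim Y < dim W"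
        using a Y W' assms by (intro dim_proper_subspace[of Y W B]) auto
      ultimately show False using min by fastforce
    qed
  qed (use W' in \<open>auto simp: subset_iff rep_add rep_scale rep_one rep_mult\<close>)
  then show ?thesis using W' by auto
qed

end

text \<open>Frobenius reciprocity by hand: an irreducible subspace of the representation induced
  from \<open>\<theta>\<close> contains the desired eigenvector. The enumeration \<open>e\<close> of
  the group carries the induced representation to functions on the natural numbers, where the
  members of \<open>Irr\<close> live.\<close>

lemma Irr_with_eigenvector:
  fixes G (structure)
  assumes "group G" and fin: "finite (carrier G)" and ch: "char_on G H \<theta>"
  shows "\<exists>W \<rho>. (W, \<rho>) \<in> Irr G \<and> complex_rep.eigsp (fun_scale (*)) W \<rho> H \<theta> \<noteq> {0}"
proof -
  interpret group G by fact
  note s = char_on_simps[OF ch]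
  interpret c: vector_space "(*) :: complex \<Rightarrow> complex \<Rightarrow> complex"
    by unfold_locales (auto simp: algebra_simps)
  interpret fc: vector_space "fun_scale (*) :: complex \<Rightarrow> (nat \<Rightarrow> complex) \<Rightarrow> _"
    by (rule vector_space_fun_scale) (rule c.vector_space_axioms)
  obtain e where e: "bij_betw e (carrier G) {0..<card (carrier G)}"
    using ex_bij_betw_finite_nat[OF fin] by blast
  define n where "n = card (carrier G)"
  define d where "d = the_inv_into (carrier G) e"
  have ed: "\<And>i. i < n \<Longrightarrow> d i \<in> carrier G" "\<And>i. i < n \<Longrightarrow> e (d i) = i"
    "\<And>g. g \<in> carrier G \<Longrightarrow> d (e g) = g" "\<And>g. g \<in> carrier G \<Longrightarrow> e g < n"
    using e unfolding d_def n_def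
    by (auto simp: bij_betw_def the_inv_into_f_f f_the_inv_into_f
        intro: the_inv_into_into[of e "carrier G" _ "carrier G", simplified])
  define Y where "Y = {f :: nat \<Rightarrow> complex. (\<forall>i\<ge>n. f i = 0) \<and>
     (\<forall>h\<in>H. \<forall>g\<in>carrier G. f (e (h \<otimes> g)) = \<theta> h * f (e g))}"
  define \<rho> where "\<rho> g f = (\<lambda>i. if i < n then f (e (d i \<otimes> g)) else 0)" for g and f :: "nat \<Rightarrow> complex"
  interpret Y: complex_rep G "fun_scale (*)" Y \<rho>
  proof unfold_locales
    show "fc.subspace Y"
      by (rule fc.subspaceI) (auto simp: Y_def fun_scale_def distrib_left mult.left_commute)
    show "\<rho> g f \<in> Y" if "g \<in> carrier G" "f \<in> Y" for g f
      using that s ed by (auto simp: Y_def \<rho>_def m_assoc)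
    show "\<rho> \<one> f = f" if "f \<in> Y" for f
      using that ed by (auto simp: Y_def \<rho>_def fun_eq_iff)
    show "\<rho> (g \<otimes> h) f = \<rho> g (\<rho> h f)" if "g \<in> carrier G" "h \<in> carrier G" for g h f
      using that ed by (auto simp: \<rho>_def fun_eq_iff m_assoc)
  qed (auto simp: \<rho>_def fun_scale_def fun_eq_iff)
  define \<delta> where "\<delta> i = (\<lambda>j::nat. if j = i then 1 else (0::complex))" for i
  have sp: "Y \<subseteq> fc.span (\<delta> ` {..<n})"
  proof
    fix f assume f: "f \<in> Y"
    have "f = (\<Sum>i<n. fun_scale (*) (f i) (\<delta> i))"
    proof
      fix j
      have "(\<Sum>i<n. fun_scale (*) (f i) (\<delta> i)) j = (\<Sum>i<n. if j = i then f i else 0)"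
        by (simp add: sum_fun_apply fun_scale_def \<delta>_def if_distrib cong: if_cong)
      then show "f j = (\<Sum>i<n. fun_scale (*) (f i) (\<delta> i)) j"
        using f by (auto simp: Y_def)
    qed
    then show "f \<in> fc.span (\<delta> ` {..<n})"
      by (metis (no_types, lifting) fc.span_sum fc.span_scale fc.span_base imageI)
  qed
  define f0 where "f0 i = (if i < n \<and> d i \<in> H then \<theta> (d i) else 0)" for i
  note inH = char_on_mem_left[OF ch]
  have "f0 \<in> Y" using s inH ed by (auto simp: Y_def f0_def)
  moreover have "f0 (e \<one>) \<noteq> 0" using s ed by (simp add: f0_def char_on_one[OF ch])
  then have "f0 \<noteq> 0" by auto
  ultimately have "Y \<noteq> {0}" by auto
  then obtain W where W: "W \<subseteq> Y" "irreducible_rep G (fun_scale (*)) W \<rho>"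
    using Y.irreducible_subrep[of "\<delta> ` {..<n}"] sp by auto
  interpret W: irreducible_rep G "fun_scale (*)" W \<rho> by (rule W(2))
  obtain f where f: "f \<in> W" "f \<noteq> 0" using W.nonzero fc.subspace_0[OF W.rep_subspace] by auto
  then obtain i where i: "f i \<noteq> 0" by (auto simp: fun_eq_iff)
  then have i': "i < n" using f W(1) by (auto simp: Y_def not_less[symmetric])
  \<comment> \<open>A translate that is nonzero at the identity. Averaging over \<open>H\<close>
    leaves the value there unchanged, because h multiplies it by \<open>\<theta> h\<close>.\<close>
  define f' where "f' = \<rho> (d i) f"
  have f': "f' \<in> W" "f' (e \<one>) \<noteq> 0"
    unfolding f'_def using W.rep_closed f ed i i' by (auto simp: \<rho>_def)
  have "W.avg H \<theta> f' (e \<one>) = f' (e \<one>)"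
  proof -
    have "(\<Sum>h\<in>H. fun_scale (*) (inverse (\<theta> h)) (\<rho> h f')) (e \<one>) = (\<Sum>h\<in>H. f' (e \<one>))"
      unfolding sum_fun_apply
    proof (intro sum.cong refl)
      fix h assume h: "h \<in> H"
      have "f' (e (h \<otimes> \<one>)) = \<theta> h * f' (e \<one>)" using f' W(1) h by (auto simp: Y_def)
      then show "fun_scale (*) (inverse (\<theta> h)) (\<rho> h f') (e \<one>) = f' (e \<one>)"
        using s(6)[OF h] s(1)[OF h] ed by (simp add: fun_scale_def \<rho>_def)
    qed
    then show ?thesis using char_on_card[OF ch] by (simp add: W.avg_def fun_scale_def)
  qed
  then have "W.avg H \<theta> f' \<noteq> 0" using f' by auto
  then have "W.eigsp H \<theta> \<noteq> {0}" using W.avg_in_eigsp[OF ch f'(1)] by auto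
  moreover have "(W, \<rho>) \<in> Irr G" using W(2) by (simp add: Irr_def)
  ultimately show ?thesis by blast
qed

section \<open>Characters of finite abelian groups\<close>

lemma (in group) sum_character_eq_0:
  fixes \<chi> :: "'a \<Rightarrow> complex"
  assumes "\<And>g h. g \<in> carrier G \<Longrightarrow> h \<in> carrier G \<Longrightarrow> \<chi> (g \<otimes> h) = \<chi> g * \<chi> h"
    and "k \<in> carrier G" "\<chi> k \<noteq> 1"
  shows "(\<Sum>g\<in>carrier G. \<chi> g) = 0"
proof -
  have "(\<Sum>g\<in>carrier G. \<chi> g) = (\<Sum>g\<in>carrier G. \<chi> (k \<otimes> g))"
  proof (rule sum.reindex_bij_betw[symmetric, of "\<lambda>g. k \<otimes> g" _ _ \<chi>])
    show "bij_betw (\<lambda>g. k \<otimes> g) (carrier G) (carrier G)"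
      using assms(2) by (intro bij_betw_byWitness[where f' = "\<lambda>g. inv k \<otimes> g"]) (auto simp:
          m_assoc[symmetric])
  qed
  also have "\<dots> = \<chi> k * (\<Sum>g\<in>carrier G. \<chi> g)"
    using assms by (simp add: sum_distrib_left)
  finally show ?thesis using assms(3) by (metis mult_cancel_right1)
qed

text \<open>The translations commute on the space of functions with sum zero, which is nonzero
  because the group has two elements. A common eigenvector is proportional to its system of
  eigenvalues, a character; this cannot be trivial, as a nonzero constant function does not have sum
  zero.\<close>

lemma (in comm_group) nontrivial_character:
  assumes fin: "finite (carrier G)" and a: "a \<in> carrier G" "a \<noteq> \<one>"
  shows "\<exists>\<eta> :: 'a \<Rightarrow> complex. (\<forall>g\<in>carrier G. \<forall>h\<in>carrier G. \<eta> (g \<otimes> h) = \<eta> g * \<eta> h) \<and>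
    \<eta> \<one> = 1 \<and> (\<exists>g\<in>carrier G. \<eta> g \<noteq> 1)"
proof -
  interpret c: vector_space "(*) :: complex \<Rightarrow> complex \<Rightarrow> complex"
    by unfold_locales (auto simp: algebra_simps)
  interpret fc: complex_vector_space "fun_scale (*) :: complex \<Rightarrow> ('a \<Rightarrow> complex) \<Rightarrow> _"
    unfolding complex_vector_space_def by (rule vector_space_fun_scale) (rule c.vector_space_axioms)
  define V where "V = {f :: 'a \<Rightarrow> complex. (\<forall>x. x \<notin> carrier G \<longrightarrow> f x = 0) \<and> (\<Sum>x\<in>carrier G. f x) = 0}"
  define T where "T g f = (\<lambda>x. if x \<in> carrier G then f (x \<otimes> g) else 0)" for g and f :: "'a \<Rightarrow> complex"
  define \<delta> where "\<delta> y = (\<lambda>x. if x = y then 1 else (0::complex))" for y :: 'a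
  have V: "fc.subspace V"
    by (rule fc.subspaceI) (auto simp: V_def fun_scale_def sum.distrib sum_distrib_left[symmetric])
  have sp: "V \<subseteq> fc.span (\<delta> ` carrier G)"
  proof
    fix f assume f: "f \<in> V"
    have "f = (\<Sum>y\<in>carrier G. fun_scale (*) (f y) (\<delta> y))"
    proof
      fix x
      have "(\<Sum>y\<in>carrier G. fun_scale (*) (f y) (\<delta> y)) x = (\<Sum>y\<in>carrier G. if x = y then f y else 0)"
        by (simp add: sum_fun_apply fun_scale_def \<delta>_def if_distrib cong: if_cong)
      then show "f x = (\<Sum>y\<in>carrier G. fun_scale (*) (f y) (\<delta> y)) x"
        using f fin by (auto simp: V_def)
    qed
    moreover have "(\<Sum>y\<in>carrier G. fun_scale (*) (f y) (\<delta> y)) \<in> fc.span (\<delta> ` carrier G)"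
      by (intro fc.span_sum fc.span_scale fc.span_base imageI)
    ultimately show "f \<in> fc.span (\<delta> ` carrier G)" by metis
  qed
  have "(\<lambda>x. \<delta> \<one> x - \<delta> a x) \<in> V"
    using a fin by (auto simp: V_def \<delta>_def sum_subtractf)
  moreover have "\<delta> \<one> \<one> - \<delta> a \<one> \<noteq> 0" using a by (simp add: \<delta>_def)
  then have "(\<lambda>x. \<delta> \<one> x - \<delta> a x) \<noteq> 0" by (metis zero_fun_def)
  ultimately have nz: "V \<noteq> {0}" by blast
  have lin: "fc.linear_op V S" if S: "S \<in> T ` carrier G" for S
  proof -
    obtain g where g: "g \<in> carrier G" "S = T g" using S by blast
    have "T g f \<in> V" if f: "f \<in> V" for f
    proof -
      have "(\<Sum>x\<in>carrier G. T g f x) = (\<Sum>x\<in>carrier G. f (x \<otimes> g))" by (simp add: T_def)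
      also have "\<dots> = (\<Sum>x\<in>carrier G. f x)"
      proof (rule sum.reindex_bij_betw[of "\<lambda>x. x \<otimes> g" _ _ f])
        show "bij_betw (\<lambda>x. x \<otimes> g) (carrier G) (carrier G)"
          using g by (intro bij_betw_byWitness[where f' = "\<lambda>x. x \<otimes> inv g"]) (auto simp: m_assoc)
      qed
      finally show ?thesis using f by (simp add: V_def T_def)
    qed
    then show ?thesis unfolding g(2) fc.linear_op_def by (auto simp: T_def fun_scale_def fun_eq_iff)
  qed
  have "\<exists>f\<in>V. f \<noteq> 0 \<and> (\<forall>S\<in>T ` carrier G. \<exists>c. S f = fun_scale (*) c f)"
  proof (rule fc.common_eigenvector[OF V sp _ nz lin])
    show "finite (\<delta> ` carrier G)" using fin by simp
    show "S (S' f) = S' (S f)" if "S \<in> T ` carrier G" "S' \<in> T ` carrier G" for S S' f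
      using that by (auto simp: T_def fun_eq_iff m_assoc m_comm m_lcomm)
  qed
  then obtain f where f: "f \<in> V" "f \<noteq> 0" "\<And>g. g \<in> carrier G \<Longrightarrow> \<exists>c. T g f = fun_scale (*) c f" by auto
  obtain c where "\<And>g. g \<in> carrier G \<Longrightarrow> T g f = fun_scale (*) (c g) f" using f(3) by metis
  then have c: "f (x \<otimes> g) = c g * f x" if "g \<in> carrier G" "x \<in> carrier G" for g x
    using that unfolding T_def fun_scale_def by (metis (mono_tags, lifting))
  have f1: "f g = c g * f \<one>" if "g \<in> carrier G" for g using c[of g \<one>] that by simp
  obtain x0 where "f x0 \<noteq> 0" using f(2) by (auto simp: fun_eq_iff)
  moreover from this have "x0 \<in> carrier G" using f(1) by (auto simp: V_def)
  ultimately have f10: "f \<one> \<noteq> 0" using f1[of x0] by auto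
  have c1: "c \<one> = 1" using f1[of \<one>] f10 by simp
  have "\<exists>g\<in>carrier G. c g \<noteq> 1"
  proof (rule ccontr)
    assume "\<not> ?thesis"
    then have "f x = f \<one>" if "x \<in> carrier G" for x using f1[OF that] that by auto
    then have "(\<Sum>x\<in>carrier G. f x) = (\<Sum>x\<in>carrier G. f \<one>)" by (intro sum.cong refl)
    then have "of_nat (card (carrier G)) * f \<one> = 0" using f(1) by (simp add: V_def)
    moreover have "card (carrier G) \<noteq> 0" using fin carrier_not_empty by simp
    ultimately show False using f10 by simp
  qed
  moreover have "c (g \<otimes> h) = c g * c h" if "g \<in> carrier G" "h \<in> carrier G" for g h
  proof -
    have "c (g \<otimes> h) * f \<one> = c g * c h * f \<one>"
      using c[OF that(2,1)] f1[OF that(1)] f1[OF m_closed[OF that]] by (metis mult.assoc mult.commute)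
    then show ?thesis using f10 by simp
  qed
  ultimately show ?thesis using c1 by blast
qed

section \<open>The rings \<open>\<oo>/\<pp>\<^sup>n\<close> and their additive characters\<close>

text \<open>The powers of the maximal ideal, read off from the valuation;
  \<open>max_ideal_pow_eq\<close> identifies them with the powers taken in the monoid of
  ideals.\<close>

definition val_ideal :: "('a::field \<Rightarrow> int) \<Rightarrow> nat \<Rightarrow> 'a set" where
  "val_ideal v n = {x. val_ge v (int n) x}"

context nonarch_local_field
begin

abbreviation \<pp> :: "nat \<Rightarrow> 'a set" where
  "\<pp> \<equiv> val_ideal v"

text \<open>Units of the valuation ring, kept as elements of the field so that quotients by them are
  quotients in the field.\<close>

definition unit :: "'a \<Rightarrow> bool" where
  "unit x \<longleftrightarrow> x \<noteq> 0 \<and> v x = 0"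

lemma val_one: "v 1 = 0"
  using val_mult[of 1 1] by simp

lemma val_uminus: "v (- x) = v x"
proof (cases "x = 0")
  case False
  have "v (-1) = 0" using val_mult[of "-1" "-1"] val_one by simp
  then show ?thesis using val_mult[of "-1" x] False by simp
qed simp

lemma val_inverse: "x \<noteq> 0 \<Longrightarrow> v (inverse x) = - v x"
  using val_mult[of x "inverse x"] val_one by simp

lemma val_power: "x \<noteq> 0 \<Longrightarrow> v (x ^ n) = int n * v x"
  by (induction n) (auto simp: val_one val_mult algebra_simps)

lemma pp_iff: "x \<in> \<pp> n \<longleftrightarrow> x = 0 \<or> int n \<le> v x"
  by (simp add: val_ideal_def val_ge_def)

lemma pp_0: "0 \<in> \<pp> n"
  by (simp add: pp_iff)

lemma pp_1: "1 \<in> \<pp> 0"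
  by (simp add: pp_iff val_one)

lemma pp_add: "x \<in> \<pp> n \<Longrightarrow> y \<in> \<pp> n \<Longrightarrow> x + y \<in> \<pp> n"
  unfolding pp_iff using val_add[of x y] by (cases "x = 0"; cases "y = 0") auto

lemma pp_uminus: "- x \<in> \<pp> n \<longleftrightarrow> x \<in> \<pp> n"
  unfolding pp_iff by (simp add: val_uminus)

lemma pp_diff: "x \<in> \<pp> n \<Longrightarrow> y \<in> \<pp> n \<Longrightarrow> x - y \<in> \<pp> n"
  using pp_add[of x n "- y"] pp_uminus[of y n] by simp

lemma pp_mult: "x \<in> \<pp> m \<Longrightarrow> y \<in> \<pp> n \<Longrightarrow> x * y \<in> \<pp> (m + n)"
  unfolding pp_iff using val_mult[of x y] by (cases "x = 0"; cases "y = 0") auto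

lemma pp_mono: "x \<in> \<pp> n \<Longrightarrow> m \<le> n \<Longrightarrow> x \<in> \<pp> m"
  unfolding pp_iff by auto

lemma pp_int: "x \<in> \<pp> n \<Longrightarrow> x \<in> \<pp> 0"
  using pp_mono by blast

lemma pp_mult_left: "x \<in> \<pp> 0 \<Longrightarrow> y \<in> \<pp> n \<Longrightarrow> x * y \<in> \<pp> n"
  using pp_mult[of x 0 y n] by simp

lemma pp_mult_right: "x \<in> \<pp> n \<Longrightarrow> y \<in> \<pp> 0 \<Longrightarrow> x * y \<in> \<pp> n"
  using pp_mult[of x n y 0] by simp

lemma pp_mult_le: "x \<in> \<pp> m \<Longrightarrow> y \<in> \<pp> n \<Longrightarrow> k \<le> m + n \<Longrightarrow> x * y \<in> \<pp> k"
  using pp_mult pp_mono by blast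

lemma pp_power: "x \<in> \<pp> 0 \<Longrightarrow> x ^ n \<in> \<pp> 0"
  by (induction n) (auto simp: pp_1 pp_mult_left)

lemmas pp_closed = pp_0 pp_1 pp_add pp_diff pp_uminus pp_mult_left pp_mult_right pp_power

lemma unit_iff: "unit x \<longleftrightarrow> x \<in> \<pp> 0 \<and> x \<notin> \<pp> 1"
  unfolding unit_def pp_iff by auto

lemma unit_int: "unit x \<Longrightarrow> x \<in> \<pp> 0"
  by (simp add: unit_iff)

lemma unit_nonzero: "unit x \<Longrightarrow> x \<noteq> 0"
  by (simp add: unit_def)

lemma unit_1: "unit 1"
  by (simp add: unit_def val_one)

lemma unit_mult: "unit x \<Longrightarrow> unit y \<Longrightarrow> unit (x * y)"
  by (simp add: unit_def val_mult)

lemma unit_inverse: "unit x \<Longrightarrow> unit (inverse x)"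
  by (simp add: unit_def val_inverse)

lemma unit_divide: "unit x \<Longrightarrow> unit y \<Longrightarrow> unit (x / y)"
  by (simp add: divide_inverse unit_mult unit_inverse)

lemma unit_uminus: "unit (- x) \<longleftrightarrow> unit x"
  by (simp add: unit_def val_uminus)

lemma unit_mult_iff: "x \<in> \<pp> 0 \<Longrightarrow> y \<in> \<pp> 0 \<Longrightarrow> unit (x * y) \<longleftrightarrow> unit x \<and> unit y"
  unfolding unit_def pp_iff using val_mult[of x y] by auto

lemma pp_divide_unit: "x \<in> \<pp> n \<Longrightarrow> unit y \<Longrightarrow> x / y \<in> \<pp> n"
  using unit_inverse[of y] unit_int[of "inverse y"] by (simp add: divide_inverse pp_mult_right)

lemma pp_mult_unit_iff: "unit u \<Longrightarrow> x * u \<in> \<pp> n \<longleftrightarrow> x \<in> \<pp> n"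
  unfolding pp_iff unit_def using val_mult[of x u] by auto

lemma unit_add: "unit x \<Longrightarrow> y \<in> \<pp> 1 \<Longrightarrow> unit (x + y)"
  unfolding unit_iff using pp_add[of x 0 y] pp_diff[of "x + y" 1 y] pp_int[of y 1] by auto

lemma unit_diff: "unit x \<Longrightarrow> y \<in> \<pp> 1 \<Longrightarrow> unit (x - y)"
  using unit_add[of x "- y"] pp_uminus by simp

lemma val_ring_simps:
  "carrier (val_ring v) = \<pp> 0" "monoid.mult (val_ring v) = (*)" "monoid.one (val_ring v) = 1"
  "ring.zero (val_ring v) = 0" "ring.add (val_ring v) = (+)"
  by (simp_all add: val_ring_def val_ideal_def)

lemma cring_val_ring: "cring (val_ring v)"
proof (rule cringI)
  show "abelian_group (val_ring v)"
    by (rule abelian_groupI) (auto simp: val_ring_simps pp_closed algebra_simps intro!: bexI[of _ "- x"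
        for x])
  show "comm_monoid (val_ring v)"
    by (rule comm_monoidI) (auto simp: val_ring_simps pp_closed)
qed (auto simp: val_ring_simps algebra_simps)

lemma val_ring_minus: "x \<in> \<pp> 0 \<Longrightarrow> \<ominus>\<^bsub>val_ring v\<^esub> x = - x"
proof -
  interpret cring "val_ring v" by (rule cring_val_ring)
  assume "x \<in> \<pp> 0"
  then show ?thesis by (intro minus_equality) (auto simp: val_ring_simps pp_closed)
qed

lemma ideal_pp: "ideal (\<pp> n) (val_ring v)"
proof -
  interpret cring "val_ring v" by (rule cring_val_ring)
  show ?thesis
  proof (rule idealI[OF ring_axioms])
    show "subgroup (\<pp> n) (add_monoid (val_ring v))"
    proof (rule group.subgroupI)
      show "group (add_monoid (val_ring v))" by (rule a_group)
      fix a assume "a \<in> \<pp> n"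
      then show "inv\<^bsub>add_monoid (val_ring v)\<^esub> a \<in> \<pp> n"
        using val_ring_minus[of a] pp_int[of a n] by (simp add: a_inv_def pp_uminus)
    qed (use pp_0 in \<open>auto simp: val_ring_simps pp_int pp_add\<close>)
  qed (auto simp: val_ring_simps pp_mult_left pp_mult_right)
qed

lemma max_ideal_eq: "max_ideal v = \<pp> 1"
  by (simp add: max_ideal_def val_ideal_def)

lemma max_ideal_pow_eq: "max_ideal_pow v n = \<pp> n"
proof (induction n)
  case 0
  show ?case by (simp add: max_ideal_pow_def nat_pow_def ideals_set_def val_ring_simps)
next
  case (Suc n)
  have "max_ideal_pow v (Suc n) = ideal_prod (val_ring v) (\<pp> n) (\<pp> 1)"
    using Suc by (simp add: max_ideal_pow_def nat_pow_def ideals_set_def max_ideal_eq)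
  also have "\<dots> = \<pp> (Suc n)"
  proof (intro equalityI subsetI)
    fix x assume "x \<in> ideal_prod (val_ring v) (\<pp> n) (\<pp> 1)"
    then show "x \<in> \<pp> (Suc n)"
      by induction (auto simp: val_ring_simps pp_add pp_mult_le)
  next
    fix x assume x: "x \<in> \<pp> (Suc n)"
    obtain t where t: "t \<noteq> 0" "v t = 1" using val_normalised by blast
    have "x / t \<in> \<pp> n"
      using x t val_mult[of x "inverse t"] by (auto simp: pp_iff divide_inverse val_inverse)
    moreover have "t \<in> \<pp> 1" using t by (simp add: pp_iff)
    ultimately have "(x / t) \<otimes>\<^bsub>val_ring v\<^esub> t \<in> ideal_prod (val_ring v) (\<pp> n) (\<pp> 1)"
      by (rule ideal_prod.prod)
    then show "x \<in> ideal_prod (val_ring v) (\<pp> n) (\<pp> 1)" using t by (simp add: val_ring_simps)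
  qed
  finally show ?case .
qed

lemma trunc_ring_eq: "trunc_ring v n = val_ring v Quot \<pp> n"
  by (simp add: trunc_ring_def max_ideal_pow_eq)

lemma residue_field_eq: "residue_field v = trunc_ring v 1"
  by (simp add: trunc_ring_eq residue_field_def max_ideal_eq)

lemma cring_trunc_ring: "cring (trunc_ring v n)"
  unfolding trunc_ring_eq by (rule ideal.quotient_is_cring[OF ideal_pp cring_val_ring])

lemma trunc_ring_hom: "trunc v n \<in> ring_hom (val_ring v) (trunc_ring v n)"
  unfolding trunc_def trunc_ring_eq max_ideal_pow_eq by (rule ideal.rcos_ring_hom[OF ideal_pp])

lemma trunc_simps:
  "x \<in> \<pp> 0 \<Longrightarrow> y \<in> \<pp> 0 \<Longrightarrow> trunc v n x \<otimes>\<^bsub>trunc_ring v n\<^esub> trunc v n y = trunc v n (x * y)"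
  "x \<in> \<pp> 0 \<Longrightarrow> y \<in> \<pp> 0 \<Longrightarrow> trunc v n x \<oplus>\<^bsub>trunc_ring v n\<^esub> trunc v n y = trunc v n (x + y)"
  "x \<in> \<pp> 0 \<Longrightarrow> \<ominus>\<^bsub>trunc_ring v n\<^esub> trunc v n x = trunc v n (- x)"
  "x \<in> \<pp> 0 \<Longrightarrow> y \<in> \<pp> 0 \<Longrightarrow> trunc v n x \<ominus>\<^bsub>trunc_ring v n\<^esub> trunc v n y = trunc v n (x - y)"
  "\<one>\<^bsub>trunc_ring v n\<^esub> = trunc v n 1"
  "\<zero>\<^bsub>trunc_ring v n\<^esub> = trunc v n 0"
  "x \<in> \<pp> 0 \<Longrightarrow> trunc v n x \<in> carrier (trunc_ring v n)"
proof -
  interpret a: cring "val_ring v" by (rule cring_val_ring)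
  interpret b: cring "trunc_ring v n" by (rule cring_trunc_ring)
  interpret ring_hom_cring "val_ring v" "trunc_ring v n" "trunc v n"
    by unfold_locales (rule trunc_ring_hom)
  show "x \<in> \<pp> 0 \<Longrightarrow> y \<in> \<pp> 0 \<Longrightarrow> trunc v n x \<otimes>\<^bsub>trunc_ring v n\<^esub> trunc v n y = trunc v n (x * y)"
    using hom_mult[of x y] by (simp add: val_ring_simps)
  show add: "x \<in> \<pp> 0 \<Longrightarrow> y \<in> \<pp> 0 \<Longrightarrow> trunc v n x \<oplus>\<^bsub>trunc_ring v n\<^esub> trunc v n y = trunc v n (x + y)" for x y
    using hom_add[of x y] by (simp add: val_ring_simps)
  show mi: "x \<in> \<pp> 0 \<Longrightarrow> \<ominus>\<^bsub>trunc_ring v n\<^esub> trunc v n x = trunc v n (- x)" for x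
    using hom_a_inv[of x] val_ring_minus[of x] by (simp add: val_ring_simps)
  show "x \<in> \<pp> 0 \<Longrightarrow> y \<in> \<pp> 0 \<Longrightarrow> trunc v n x \<ominus>\<^bsub>trunc_ring v n\<^esub> trunc v n y = trunc v n (x - y)"
    by (simp add: a_minus_def mi add pp_uminus)
  show "\<one>\<^bsub>trunc_ring v n\<^esub> = trunc v n 1" using hom_one by (simp add: val_ring_simps)
  show "\<zero>\<^bsub>trunc_ring v n\<^esub> = trunc v n 0" using hom_zero by (simp add: val_ring_simps)
  show "x \<in> \<pp> 0 \<Longrightarrow> trunc v n x \<in> carrier (trunc_ring v n)"
    using hom_closed[of x] by (simp add: val_ring_simps)
qed

lemma carrier_trunc_ring: "carrier (trunc_ring v n) = trunc v n ` \<pp> 0"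
  unfolding trunc_ring_eq FactRing_def trunc_def max_ideal_pow_eq
  by (auto simp: A_RCOSETS_def' val_ring_simps)

lemma trunc_alt: "trunc v n x = {y. y - x \<in> \<pp> n}"
  unfolding trunc_def max_ideal_pow_eq a_r_coset_def' val_ring_simps
  by (auto intro!: bexI[of _ "y - x" for y])

lemma trunc_eq_iff: "trunc v n x = trunc v n y \<longleftrightarrow> x - y \<in> \<pp> n"
proof
  have "x \<in> trunc v n x" by (simp add: trunc_alt pp_0)
  then show "trunc v n x = trunc v n y \<Longrightarrow> x - y \<in> \<pp> n" by (auto simp: trunc_alt)
  assume a: "x - y \<in> \<pp> n"
  have "z - x \<in> \<pp> n \<longleftrightarrow> z - y \<in> \<pp> n" for z
    using pp_add[OF _ a, of "z - x"] pp_diff[OF _ a, of "z - y"] by auto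
  then show "trunc v n x = trunc v n y" by (auto simp: trunc_alt)
qed

lemma reduce_trunc: "m \<le> n \<Longrightarrow> reduce v (\<pp> m) (trunc v n x) = trunc v m x"
proof -
  assume mn: "m \<le> n"
  have "trunc v m x \<subseteq> (\<Union>h\<in>\<pp> m. \<Union>k\<in>trunc v n x. {h + k})"
    by (auto simp: trunc_alt pp_0 intro!: bexI[of _ "y - x" for y] bexI[of _ x])
  moreover have "h + k - x \<in> \<pp> m" if "h \<in> \<pp> m" "k - x \<in> \<pp> n" for h k
    using pp_add[OF that(1) pp_mono[OF that(2) mn]] by (simp add: algebra_simps)
  ultimately show ?thesis
    unfolding reduce_def set_add_def' val_ring_simps by (auto simp: trunc_alt)
qed

text \<open>Induction on \<open>n\<close>: if F represents the classes modulo \<open>\<pp> n\<close>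
  and S the residue field, then the elements f + t^n s represent the classes modulo
  \<open>\<pp> (Suc n)\<close>, where t has valuation one.\<close>

lemma finite_carrier_trunc_ring: "finite (carrier (trunc_ring v n))"
proof -
  obtain t where t: "t \<noteq> 0" "v t = 1" using val_normalised by blast
  have "\<exists>F. finite F \<and> F \<subseteq> \<pp> 0 \<and> (\<forall>x\<in>\<pp> 0. \<exists>f\<in>F. x - f \<in> \<pp> n)"
  proof (induction n)
    case 0
    show ?case by (intro exI[of _ "{0}"]) (auto simp: pp_0)
  next
    case (Suc n)
    then obtain F where F: "finite F" "F \<subseteq> \<pp> 0" "\<And>x. x \<in> \<pp> 0 \<Longrightarrow> \<exists>f\<in>F. x - f \<in> \<pp> n" by blast
    have "finite (trunc v 1 ` \<pp> 0)"
      using finite_residue_field carrier_trunc_ring[of 1] by (simp add: residue_field_eq)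
    then obtain S where S: "S \<subseteq> \<pp> 0" "finite S" "trunc v 1 ` \<pp> 0 = trunc v 1 ` S"
      by (metis finite_subset_image order_refl)
    have tn: "t ^ n \<in> \<pp> n" "t ^ n \<noteq> 0" "v (t ^ n) = int n" using t by (auto simp: pp_iff val_power)
    show ?case
    proof (intro exI[of _ "(\<lambda>(f, s). f + t ^ n * s) ` (F \<times> S)"] conjI ballI)
      show "(\<lambda>(f, s). f + t ^ n * s) ` (F \<times> S) \<subseteq> \<pp> 0"
        using F S tn by (auto intro!: pp_add pp_mult_left intro: pp_int)
      fix x assume "x \<in> \<pp> 0"
      then obtain f where f: "f \<in> F" "x - f \<in> \<pp> n" using F by blast
      define y where "y = (x - f) / t ^ n"
      have y: "x - f = t ^ n * y" using tn by (simp add: y_def)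
      have "y \<in> \<pp> 0"
        using f(2) tn val_mult[of "x - f" "inverse (t ^ n)"]
        by (auto simp: y_def pp_iff divide_inverse val_inverse)
      then obtain s where s: "s \<in> S" "trunc v 1 y = trunc v 1 s"
        using S(3) by (metis imageE imageI)
      then have "y - s \<in> \<pp> 1" by (simp add: trunc_eq_iff)
      then have "t ^ n * (y - s) \<in> \<pp> (Suc n)" using tn pp_mult_le by fastforce
      moreover have "x - (f + t ^ n * s) = t ^ n * (y - s)" using y by (simp add: algebra_simps)
      ultimately have "x - (f + t ^ n * s) \<in> \<pp> (Suc n)" by simp
      then show "\<exists>f\<in>(\<lambda>(f, s). f + t ^ n * s) ` (F \<times> S). x - f \<in> \<pp> (Suc n)"
        using f s by force
    qed (use F S in auto)
  qed
  then obtain F where F: "finite F" "\<And>x. x \<in> \<pp> 0 \<Longrightarrow> \<exists>f\<in>F. x - f \<in> \<pp> n" by blast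
  have "trunc v n ` \<pp> 0 \<subseteq> trunc v n ` F"
    using F(2) by (auto simp: trunc_eq_iff[symmetric])
  then show ?thesis using F(1) finite_subset carrier_trunc_ring by (metis finite_imageI)
qed

text \<open>The residue characteristic is the additive order of the unit element. If 2 lay in the
  maximal ideal, this order would divide 2, hence be 1 by oddness, and the residue field would be
  zero.\<close>

lemma unit_two: "odd (residue_char v) \<Longrightarrow> unit 2"
proof (rule ccontr)
  assume odd: "odd (residue_char v)" and "\<not> unit 2"
  have two: "2 \<in> \<pp> 0" using pp_add[OF pp_1 pp_1] by simp
  let ?R = "trunc_ring v 1"
  interpret R: cring ?R by (rule cring_trunc_ring)
  have "2 \<in> \<pp> 1" using two \<open>\<not> unit 2\<close> by (simp add: unit_iff)
  then have t: "trunc v 1 2 = trunc v 1 0" by (simp add: trunc_eq_iff)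
  have c: "\<one>\<^bsub>?R\<^esub> \<in> carrier (add_monoid ?R)" using R.one_closed by simp
  have "\<one>\<^bsub>?R\<^esub> [^]\<^bsub>add_monoid ?R\<^esub> (2::nat) = \<one>\<^bsub>?R\<^esub> \<oplus>\<^bsub>?R\<^esub> \<one>\<^bsub>?R\<^esub>"
    using R.one_closed R.l_zero[OF R.one_closed] by (simp add: numeral_2_eq_2)
  also have "\<dots> = \<one>\<^bsub>add_monoid ?R\<^esub>"
    using t by (simp add: trunc_simps pp_1)
  finally have "group.ord (add_monoid ?R) \<one>\<^bsub>?R\<^esub> dvd 2" using group.pow_eq_id[OF R.a_group c] by simp
  then have "group.ord (add_monoid ?R) \<one>\<^bsub>?R\<^esub> = 1"
    using odd unfolding residue_char_def residue_field_eq
    by (metis One_nat_def dvd_triv_left even_iff_mod_2_eq_zero prime_nat_iff two_is_prime_nat dvd_refl)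
  then have "\<one>\<^bsub>?R\<^esub> = \<zero>\<^bsub>?R\<^esub>" using group.ord_eq_1[OF R.a_group c] by simp
  then have "(1::'a) - 0 \<in> \<pp> 1" by (simp only: trunc_simps trunc_eq_iff)
  then show False using unit_1 by (simp add: unit_iff)
qed

end

section \<open>Level, uniformiser and primitive character\<close>

locale trunc_data = nonarch_local_field v
  for v :: "'a::field \<Rightarrow> int" +
  fixes \<omega> :: 'a and l :: nat and \<psi> :: "'a set \<Rightarrow> complex"
  assumes odd_residue_char: "odd (residue_char v)"
    and uniformiser: "\<omega> \<in> carrier (val_ring v)" "max_ideal v = PIdl\<^bsub>val_ring v\<^esub> \<omega>"
    and l_pos: "l \<ge> 1"
    and primitive: "primitive_char v \<omega> l \<psi>"
begin

abbreviation R :: "'a set ring" where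
  "R \<equiv> trunc_ring v l"

abbreviation tr :: "'a \<Rightarrow> 'a set" where
  "tr \<equiv> trunc v l"

text \<open>\<open>\<psi>\<close> pulled back to the field, so that its values can be computed from
  lifts.\<close>

definition \<Psi> :: "'a \<Rightarrow> complex" where
  "\<Psi> x = \<psi> (tr x)"

sublocale R: cring R by (rule cring_trunc_ring)

lemma val_uniformiser: "\<omega> \<noteq> 0" "v \<omega> = 1"
proof -
  interpret cring "val_ring v" by (rule cring_val_ring)
  obtain t where t: "t \<noteq> 0" "v t = 1" using val_normalised by blast
  have "t \<in> max_ideal v" using t by (simp add: max_ideal_eq pp_iff)
  then have "t \<in> PIdl\<^bsub>val_ring v\<^esub> \<omega>" using uniformiser(2) by simp
  then obtain x where x: "x \<in> \<pp> 0" "t = x * \<omega>"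
    by (auto simp: cgenideal_def val_ring_simps)
  have "\<omega> \<in> max_ideal v"
    using uniformiser cgenideal_self by simp
  then show "\<omega> \<noteq> 0" "v \<omega> = 1"
    using x t val_mult[of x \<omega>] by (auto simp: max_ideal_eq pp_iff)
qed

lemma uniformiser_power: "\<omega> ^ n \<in> \<pp> n" "\<omega> ^ n \<noteq> 0" "\<omega> ^ n \<in> \<pp> 0"
  using val_uniformiser by (auto simp: pp_iff val_power)

lemma pp_divide: "x \<in> \<pp> (m + n) \<Longrightarrow> x / \<omega> ^ n \<in> \<pp> m"
  using val_mult[of x "inverse (\<omega> ^ n)"] val_uniformiser
  by (auto simp: pp_iff divide_inverse val_inverse val_power)

lemma pp_mult_uniformiser_iff: "\<omega> ^ n * x \<in> \<pp> (m + n) \<longleftrightarrow> x \<in> \<pp> m"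
  using val_mult[of "\<omega> ^ n" x] val_uniformiser by (auto simp: pp_iff val_power)

lemma uniformiser_factor:
  assumes "x \<in> \<pp> 0" "x \<noteq> 0"
  obtains k u where "unit u" "x = \<omega> ^ k * u" "x \<in> \<pp> k" "x \<notin> \<pp> (Suc k)"
proof -
  define k where "k = nat (v x)"
  have "v x = int k" using assms by (auto simp: k_def pp_iff)
  moreover from this have "unit (x / \<omega> ^ k)"
    using assms val_uniformiser val_mult[of x "inverse (\<omega> ^ k)"]
    by (auto simp: unit_def divide_inverse val_inverse val_power)
  ultimately show ?thesis
    using that[of "x / \<omega> ^ k" k] assms val_uniformiser by (auto simp: pp_iff)
qed

lemma carrier_R: "carrier R = tr ` \<pp> 0"
  by (rule carrier_trunc_ring)

lemma finite_R: "finite (carrier R)"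
  by (rule finite_carrier_trunc_ring)

lemma psi_hom:
  "A \<in> carrier R \<Longrightarrow> B \<in> carrier R \<Longrightarrow> \<psi> (A \<oplus>\<^bsub>R\<^esub> B) = \<psi> A * \<psi> B"
  "A \<in> carrier R \<Longrightarrow> \<psi> A \<noteq> 0"
  using primitive by (auto simp: primitive_char_def hom_def complex_units_def)

lemma Psi_add: "x \<in> \<pp> 0 \<Longrightarrow> y \<in> \<pp> 0 \<Longrightarrow> \<Psi> (x + y) = \<Psi> x * \<Psi> y"
  using psi_hom(1)[of "tr x" "tr y"] by (simp add: \<Psi>_def trunc_simps)

lemma Psi_nonzero: "x \<in> \<pp> 0 \<Longrightarrow> \<Psi> x \<noteq> 0"
  using psi_hom(2)[of "tr x"] by (simp add: \<Psi>_def trunc_simps)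

lemma Psi_0: "\<Psi> 0 = 1"
  using Psi_add[of 0 0] Psi_nonzero[of 0] pp_0[of 0] by simp

lemma Psi_cong: "x - y \<in> \<pp> l \<Longrightarrow> \<Psi> x = \<Psi> y"
  unfolding \<Psi>_def by (simp add: trunc_eq_iff[symmetric])

lemma Psi_eq_1: "x \<in> \<pp> l \<Longrightarrow> \<Psi> x = 1"
  using Psi_cong[of x 0] Psi_0 by simp

lemma Psi_uminus: "x \<in> \<pp> 0 \<Longrightarrow> \<Psi> (- x) = inverse (\<Psi> x)"
  using Psi_add[of x "- x"] Psi_0 by (simp add: pp_uminus inverse_unique[symmetric])

lemma Psi_diff: "x \<in> \<pp> 0 \<Longrightarrow> y \<in> \<pp> 0 \<Longrightarrow> \<Psi> (x - y) = \<Psi> x / \<Psi> y"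
  using Psi_add[of x "- y"] Psi_uminus[of y] by (simp add: pp_uminus divide_inverse)

lemma unif_pow_eq: "unif_pow v \<omega> l n = tr (\<omega> ^ n)"
proof (induction n)
  case 0
  show ?case by (simp add: unif_pow_def trunc_simps)
next
  case (Suc n)
  have "\<omega> \<in> \<pp> 0" using uniformiser(1) by (simp add: val_ring_simps)
  then show ?case using Suc by (simp add: unif_pow_def trunc_simps uniformiser_power mult.commute)
qed

lemma Psi_primitive:
  obtains z where "z \<in> \<pp> 0" "\<Psi> (\<omega> ^ (l - 1) * z) \<noteq> 1"
proof -
  obtain u where u: "u \<in> carrier R" "\<psi> (unif_pow v \<omega> l (l - 1) \<otimes>\<^bsub>R\<^esub> u) \<noteq> 1"
    using primitive by (auto simp: primitive_char_def)
  then obtain z where z: "z \<in> \<pp> 0" "u = tr z" by (auto simp: carrier_R)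
  then show ?thesis using u that[of z] by (simp add: unif_pow_eq trunc_simps uniformiser_power \<Psi>_def)
qed

text \<open>The annihilator of \<open>\<pp> k\<close> under the pairing
  \<open>\<Psi> (x * z)\<close> lies in \<open>\<pp> (l - k)\<close>: an x of smaller valuation
  multiplies \<open>\<pp> k\<close> onto an ideal that contains the multiples of
  \<open>\<omega> ^ (l - 1)\<close>, on which \<open>\<Psi>\<close> is nontrivial by
  primitivity.\<close>

lemma Psi_faithful:
  assumes x: "x \<in> \<pp> 0" and k: "k \<le> l" and 1: "\<And>z. z \<in> \<pp> k \<Longrightarrow> \<Psi> (x * z) = 1"
  shows "x \<in> \<pp> (l - k)"
proof (rule ccontr)
  assume n: "x \<notin> \<pp> (l - k)"
  then have "x \<noteq> 0" by (auto simp: pp_0)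
  with x obtain j u where j: "unit u" "x = \<omega> ^ j * u" "x \<in> \<pp> j" by (metis uniformiser_factor)
  have jl: "j < l - k" using n j pp_mono[of x j "l - k"] by (meson not_less)
  obtain z where z: "z \<in> \<pp> 0" "\<Psi> (\<omega> ^ (l - 1) * z) \<noteq> 1" by (rule Psi_primitive)
  define y where "y = \<omega> ^ (l - 1 - j) * (z / u)"
  have "y \<in> \<pp> (l - 1 - j)"
    unfolding y_def using z j by (intro pp_mult_right uniformiser_power pp_divide_unit)
  then have "y \<in> \<pp> k" using pp_mono jl by fastforce
  moreover have "x * y = \<omega> ^ (j + (l - 1 - j)) * z"
    using j unit_nonzero[OF j(1)] by (simp add: y_def power_add)
  moreover have "j + (l - 1 - j) = l - 1" using jl by simp
  ultimately show False using 1 z by metis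
qed

text \<open>Self-duality of the finite ring through orthogonality. If \<open>\<phi>\<close> differed
  from every character B to \<open>\<psi>\<close> of A B, its inner product with each of them would
  vanish; summing these over A leaves only the term at zero, which is \<open>\<phi>\<close> at zero
  times the number of elements.\<close>

lemma additive_char_R:
  assumes \<phi>: "\<And>A B. A \<in> carrier R \<Longrightarrow> B \<in> carrier R \<Longrightarrow> \<phi> (A \<oplus>\<^bsub>R\<^esub> B) = \<phi> A * \<phi> B"
    and nz: "\<phi> \<zero>\<^bsub>R\<^esub> \<noteq> (0::complex)"
  shows "\<exists>A\<in>carrier R. \<forall>B\<in>carrier R. \<phi> B = \<psi> (A \<otimes>\<^bsub>R\<^esub> B)"
proof (rule ccontr)
  assume no: "\<not> ?thesis"
  note sc = group.sum_character_eq_0[OF R.a_group, simplified]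
  have c: "\<And>A B. A \<in> carrier R \<Longrightarrow> B \<in> carrier R \<Longrightarrow> \<psi> (A \<otimes>\<^bsub>R\<^esub> B) \<noteq> 0" by (simp add: psi_hom)
  have 1: "(\<Sum>B\<in>carrier R. \<phi> B / \<psi> (A \<otimes>\<^bsub>R\<^esub> B)) = 0" if A: "A \<in> carrier R" for A
  proof -
    obtain B where B: "B \<in> carrier R" "\<phi> B \<noteq> \<psi> (A \<otimes>\<^bsub>R\<^esub> B)" using no A by blast
    then show ?thesis
      using sc[of "\<lambda>B. \<phi> B / \<psi> (A \<otimes>\<^bsub>R\<^esub> B)" B] A c[OF A]
      by (simp add: \<phi> R.r_distr psi_hom divide_eq_eq)
  qed
  have 2: "(\<Sum>A\<in>carrier R. 1 / \<psi> (A \<otimes>\<^bsub>R\<^esub> B)) = 0" if B: "B \<in> carrier R" "B \<noteq> \<zero>\<^bsub>R\<^esub>" for B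
  proof -
    obtain x where x: "x \<in> \<pp> 0" "B = tr x" using B by (auto simp: carrier_R)
    have "x \<notin> \<pp> l" using B x by (auto simp: trunc_simps trunc_eq_iff)
    then obtain z where z: "z \<in> \<pp> 0" "\<Psi> (x * z) \<noteq> 1" using Psi_faithful[OF x(1), of 0] by auto
    have "\<psi> (tr z \<otimes>\<^bsub>R\<^esub> B) \<noteq> 1" using z x by (simp add: trunc_simps \<Psi>_def mult.commute)
    then show ?thesis
      using sc[of "\<lambda>A. 1 / \<psi> (A \<otimes>\<^bsub>R\<^esub> B)" "tr z"] z B c[of "tr z" B]
      by (simp add: R.l_distr psi_hom trunc_simps)
  qed
  have "0 = (\<Sum>A\<in>carrier R. \<Sum>B\<in>carrier R. \<phi> B / \<psi> (A \<otimes>\<^bsub>R\<^esub> B))" using 1 by simp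
  also have "\<dots> = (\<Sum>B\<in>carrier R. \<phi> B * (\<Sum>A\<in>carrier R. 1 / \<psi> (A \<otimes>\<^bsub>R\<^esub> B)))"
    by (subst sum.swap) (simp add: sum_distrib_left)
  also have "\<dots> = (\<Sum>B\<in>{\<zero>\<^bsub>R\<^esub>}. \<phi> B * (\<Sum>A\<in>carrier R. 1 / \<psi> (A \<otimes>\<^bsub>R\<^esub> B)))"
    using 2 by (intro sum.mono_neutral_right) (auto simp: finite_R)
  also have "\<dots> = \<phi> \<zero>\<^bsub>R\<^esub> * of_nat (card (carrier R))"
    using Psi_0 by (simp add: \<Psi>_def trunc_simps(6)[symmetric])
  finally show False using nz finite_R R.zero_closed by auto
qed

lemma additive_char:
  assumes add: "\<And>x y. x \<in> \<pp> 0 \<Longrightarrow> y \<in> \<pp> 0 \<Longrightarrow> \<phi> (x + y) = \<phi> x * \<phi> y"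
    and one: "\<And>x. x \<in> \<pp> l \<Longrightarrow> \<phi> x = (1::complex)"
  shows "\<exists>a\<in>\<pp> 0. \<forall>x\<in>\<pp> 0. \<phi> x = \<Psi> (a * x)"
proof -
  define r where "r A = (SOME x. x \<in> \<pp> 0 \<and> tr x = A)" for A
  have r: "r A \<in> \<pp> 0" "tr (r A) = A" if "A \<in> carrier R" for A
    using someI_ex[of "\<lambda>x. x \<in> \<pp> 0 \<and> tr x = A"] that unfolding r_def carrier_R by auto
  have cong: "\<phi> x = \<phi> y" if "x \<in> \<pp> 0" "y \<in> \<pp> 0" "tr x = tr y" for x y
    using add[of y "x - y"] one[of "x - y"] that by (simp add: trunc_eq_iff pp_closed)
  have r': "\<phi> (r (tr x)) = \<phi> x" if "x \<in> \<pp> 0" for x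
    using cong[of "r (tr x)" x] r[of "tr x"] that by (simp add: trunc_simps)
  have "\<phi> (r (A \<oplus>\<^bsub>R\<^esub> B)) = \<phi> (r A) * \<phi> (r B)" if "A \<in> carrier R" "B \<in> carrier R" for A B
    using that unfolding carrier_R by (auto simp: trunc_simps r' add pp_closed)
  moreover have "\<phi> (r \<zero>\<^bsub>R\<^esub>) \<noteq> 0" by (simp add: trunc_simps r' one pp_0)
  ultimately obtain A where A: "A \<in> carrier R" "\<And>B. B \<in> carrier R \<Longrightarrow> \<phi> (r B) = \<psi> (A \<otimes>\<^bsub>R\<^esub> B)"
    using additive_char_R[of "\<lambda>A. \<phi> (r A)"] by blast
  have "\<phi> x = \<Psi> (r A * x)" if x: "x \<in> \<pp> 0" for x
    using A(2)[of "tr x"] r[OF A(1)] x by (simp add: r' trunc_simps \<Psi>_def) (metis trunc_simps(1))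
  then show ?thesis using r[OF A(1)] by blast
qed

end

section \<open>The group \<open>GL\<^sub>2\<close>\<close>

text \<open>Otherwise the simplifier turns \<open>\<pp> 1\<close> into \<open>\<pp> (Suc 0)\<close>, which no rule below matches.\<close>

declare One_nat_def [simp del]

context trunc_data
begin

abbreviation GL :: "'a set mat2 monoid" where
  "GL \<equiv> GL2 R"

definition M :: "'a \<Rightarrow> 'a \<Rightarrow> 'a \<Rightarrow> 'a \<Rightarrow> 'a set mat2" where
  "M a b c d = Mat2 (tr a) (tr b) (tr c) (tr d)"

text \<open>A condition on lifts of the entries, which depends only on the classes because
  \<open>l \<ge> 1\<close>. Lifts are used since division in the field is available for
  them.\<close>

definition gl :: "'a \<Rightarrow> 'a \<Rightarrow> 'a \<Rightarrow> 'a \<Rightarrow> bool" where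
  "gl a b c d \<longleftrightarrow> a \<in> \<pp> 0 \<and> b \<in> \<pp> 0 \<and> c \<in> \<pp> 0 \<and> d \<in> \<pp> 0 \<and> unit (a * d - b * c)"

lemma M_eq_iff:
  "M a b c d = M a' b' c' d' \<longleftrightarrow> a - a' \<in> \<pp> l \<and> b - b' \<in> \<pp> l \<and> c - c' \<in> \<pp> l \<and> d - d' \<in> \<pp> l"
  by (simp add: M_def trunc_eq_iff)

lemma carrier_gl2: "carrier (gl2 R) = {M a b c d | a b c d. a \<in> \<pp> 0 \<and> b \<in> \<pp> 0 \<and> c \<in> \<pp> 0 \<and> d \<in> \<pp> 0}"
  unfolding gl2_def M_def carrier_R by auto

lemma gl2_carrierI: "a \<in> \<pp> 0 \<Longrightarrow> b \<in> \<pp> 0 \<Longrightarrow> c \<in> \<pp> 0 \<Longrightarrow> d \<in> \<pp> 0 \<Longrightarrow> M a b c d \<in> carrier (gl2 R)"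
  unfolding carrier_gl2 by blast

lemma gl2_mult:
  assumes "a \<in> \<pp> 0" "b \<in> \<pp> 0" "c \<in> \<pp> 0" "d \<in> \<pp> 0" "a' \<in> \<pp> 0" "b' \<in> \<pp> 0" "c' \<in> \<pp> 0" "d' \<in> \<pp> 0"
  shows "M a b c d \<otimes>\<^bsub>gl2 R\<^esub> M a' b' c' d'
    = M (a * a' + b * c') (a * b' + b * d') (c * a' + d * c') (c * b' + d * d')"
  using assms by (simp add: gl2_def M_def trunc_simps pp_closed)

lemma gl2_one: "\<one>\<^bsub>gl2 R\<^esub> = M 1 0 0 1"
  by (simp add: gl2_def M_def trunc_simps)

lemma monoid_gl2: "monoid (gl2 R)"
proof (rule monoidI)
  show "\<one>\<^bsub>gl2 R\<^esub> \<in> carrier (gl2 R)" unfolding gl2_one by (intro gl2_carrierI pp_0 pp_1)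
  show "x \<otimes>\<^bsub>gl2 R\<^esub> y \<in> carrier (gl2 R)" if xy: "x \<in> carrier (gl2 R)" "y \<in> carrier (gl2 R)" for x y
  proof -
    obtain a b c d where 1: "a \<in> \<pp> 0" "b \<in> \<pp> 0" "c \<in> \<pp> 0" "d \<in> \<pp> 0" "x = M a b c d"
      using xy(1) by (auto simp: carrier_gl2)
    obtain a' b' c' d' where 2: "a' \<in> \<pp> 0" "b' \<in> \<pp> 0" "c' \<in> \<pp> 0" "d' \<in> \<pp> 0" "y = M a' b' c' d'"
      using xy(2) by (auto simp: carrier_gl2)
    show ?thesis
      unfolding 1(5) 2(5) gl2_mult[OF 1(1-4) 2(1-4)]
      using 1 2 by (intro gl2_carrierI) (simp_all add: pp_closed)
  qed
qed (auto simp: carrier_gl2 gl2_mult gl2_one pp_closed distrib_left distrib_right mult.assoc add_ac)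

text \<open>An inverse in the quotient is an inverse of lifts up to errors \<open>e1\<close> to
  \<open>e4\<close> in \<open>\<pp> l\<close>, so the product of the two determinants is 1 plus an
  element of the maximal ideal. Conversely, the adjugate divided by the determinant is an
  inverse.\<close>

lemma Units_gl2: "Units (gl2 R) = {M a b c d | a b c d. gl a b c d}"
proof (intro equalityI subsetI)
  fix g assume g: "g \<in> Units (gl2 R)"
  then have "g \<in> carrier (gl2 R)" by (simp add: Units_def)
  then obtain a b c d where abcd: "a \<in> \<pp> 0" "b \<in> \<pp> 0" "c \<in> \<pp> 0" "d \<in> \<pp> 0" "g = M a b c d"
    by (auto simp: carrier_gl2)
  obtain h where "h \<in> carrier (gl2 R)" "g \<otimes>\<^bsub>gl2 R\<^esub> h = \<one>\<^bsub>gl2 R\<^esub>" using g by (auto simp: Units_def)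
  then obtain a' b' c' d' where p: "a' \<in> \<pp> 0" "b' \<in> \<pp> 0" "c' \<in> \<pp> 0" "d' \<in> \<pp> 0"
      "M a b c d \<otimes>\<^bsub>gl2 R\<^esub> M a' b' c' d' = M 1 0 0 1"
    by (auto simp: carrier_gl2 gl2_one abcd)
  define e1 e2 e3 e4 where e: "e1 = a * a' + b * c' - 1" "e2 = a * b' + b * d'"
    "e3 = c * a' + d * c'" "e4 = c * b' + d * d' - 1"
  have e': "e1 \<in> \<pp> l" "e2 \<in> \<pp> l" "e3 \<in> \<pp> l" "e4 \<in> \<pp> l"
    using p(5) unfolding e gl2_mult[OF abcd(1-4) p(1-4)] M_eq_iff by simp_all
  have "(a * d - b * c) * (a' * d' - b' * c') = (1 + e1) * (1 + e4) - e2 * e3"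
    unfolding e by (simp add: algebra_simps)
  also have "\<dots> = 1 + (e1 + e4 + e1 * e4 - e2 * e3)" by (simp add: algebra_simps)
  also have "unit \<dots>"
    using e' by (intro unit_add unit_1 pp_mono[OF _ l_pos] pp_add pp_diff pp_mult_left) (auto intro: pp_int)
  finally have "unit (a * d - b * c)"
    using abcd p by (subst (asm) unit_mult_iff) (auto simp: pp_closed)
  then show "g \<in> {M a b c d | a b c d. gl a b c d}"
    using abcd by (auto simp: gl_def)
next
  fix g assume "g \<in> {M a b c d | a b c d. gl a b c d}"
  then obtain a b c d where g: "gl a b c d" "g = M a b c d" by blast
  define D where "D = a * d - b * c"
  have D: "unit D" using g by (simp add: gl_def D_def)
  then have D0: "D \<noteq> 0" by (rule unit_nonzero)
  have i: "a \<in> \<pp> 0" "b \<in> \<pp> 0" "c \<in> \<pp> 0" "d \<in> \<pp> 0" using g by (auto simp: gl_def)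
  note i' = i[THEN pp_divide_unit[OF _ D]]
  let ?h = "M (d / D) (- (b / D)) (- (c / D)) (a / D)"
  have r: "(a * d - b * c) / D = 1" using D0 by (simp add: D_def)
  have "g \<otimes>\<^bsub>gl2 R\<^esub> ?h = \<one>\<^bsub>gl2 R\<^esub>" "?h \<otimes>\<^bsub>gl2 R\<^esub> g = \<one>\<^bsub>gl2 R\<^esub>"
    unfolding g gl2_one using r
    by (auto simp: gl2_mult i i' pp_uminus M_eq_iff diff_divide_distrib mult.commute pp_0)
  moreover have "?h \<in> carrier (gl2 R)" "g \<in> carrier (gl2 R)"
    unfolding g using i i' by (intro gl2_carrierI; simp add: pp_uminus)+
  ultimately show "g \<in> Units (gl2 R)" unfolding Units_def by blast
qed

lemma carrier_GL: "carrier GL = {M a b c d | a b c d. gl a b c d}"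
  by (simp add: GL2_def units_of_def Units_gl2)

lemma M_in_GL: "gl a b c d \<Longrightarrow> M a b c d \<in> carrier GL"
  by (auto simp: carrier_GL)

lemma GL_mult:
  "gl a b c d \<Longrightarrow> gl a' b' c' d' \<Longrightarrow> M a b c d \<otimes>\<^bsub>GL\<^esub> M a' b' c' d'
    = M (a * a' + b * c') (a * b' + b * d') (c * a' + d * c') (c * b' + d * d')"
  by (simp add: GL2_def units_of_def gl2_mult gl_def)

lemma GL_one: "\<one>\<^bsub>GL\<^esub> = M 1 0 0 1"
  by (simp add: GL2_def units_of_def gl2_one)

lemma group_GL: "group GL"
  unfolding GL2_def by (rule monoid.units_group[OF monoid_gl2])

lemma finite_GL: "finite (carrier GL)"
proof -
  have "finite ((\<lambda>(a, b, c, d). Mat2 a b c d) ` (carrier R \<times> carrier R \<times> carrier R \<times> carrier R))"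
    using finite_R by auto
  moreover have "carrier GL \<subseteq> (\<lambda>(a, b, c, d). Mat2 a b c d) ` (carrier R \<times> carrier R \<times> carrier R \<times>
      carrier R)"
    unfolding carrier_GL M_def gl_def carrier_R by (auto simp: image_iff)
  ultimately show ?thesis using finite_subset by blast
qed

lemma gl_mult:
  assumes "gl a b c d" "gl a' b' c' d'"
  shows "gl (a * a' + b * c') (a * b' + b * d') (c * a' + d * c') (c * b' + d * d')"
proof -
  have "(a * a' + b * c') * (c * b' + d * d') - (a * b' + b * d') * (c * a' + d * c')
    = (a * d - b * c) * (a' * d' - b' * c')" by (simp add: algebra_simps)
  then show ?thesis using assms by (simp add: gl_def pp_closed unit_mult)
qed

lemma unipotent_R: "unipotent R = {M 1 b 0 1 | b. b \<in> \<pp> 0}"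
  unfolding unipotent_def M_def carrier_R by (auto simp: trunc_simps)

lemma psi_unip_M: "b \<in> \<pp> 0 \<Longrightarrow> psi_unip v \<omega> \<psi> t l (M a b c d) = \<Psi> (\<omega> ^ (l - t) * b)"
  by (simp add: M_def \<Psi>_def unif_pow_eq trunc_simps uniformiser_power)

section \<open>The last congruence subgroup and its characters \<open>\<psi>\<^sub>x\<close>\<close>

abbreviation P :: 'a where
  "P \<equiv> \<omega> ^ (l - 1)"

lemma P_pp: "P \<in> \<pp> (l - 1)" "P \<in> \<pp> 0"
  by (rule uniformiser_power)+

lemma P_mult: "P * x \<in> \<pp> l \<longleftrightarrow> x \<in> \<pp> 1"
  using pp_mult_uniformiser_iff[of "l - 1" x 1] l_pos by simp

lemma Psi_P_cong:
  assumes "x - y \<in> \<pp> 1"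
  shows "\<Psi> (P * x) = \<Psi> (P * y)"
proof (rule Psi_cong)
  have "P * (x - y) \<in> \<pp> l" using assms by (simp add: P_mult)
  then show "P * x - P * y \<in> \<pp> l" by (simp add: algebra_simps)
qed

text \<open>\<open>char_occurs\<close> tests a vector against the elements of this kernel, so each
  of them has to be put in the form I + P y.\<close>

lemma last_congruence_sub:
  assumes "l \<ge> 2" "k \<in> last_congruence v l"
  shows "\<exists>a\<in>\<pp> 0. \<exists>b\<in>\<pp> 0. \<exists>c\<in>\<pp> 0. \<exists>d\<in>\<pp> 0. k = M (1 + P * a) (P * b) (P * c) (1 + P * d)"
proof -
  obtain a b c d where k: "gl a b c d" "k = M a b c d"
    "map_mat2 (reduce v (max_ideal_pow v (l - 1))) k = \<one>\<^bsub>GL2 (trunc_ring v (l - 1))\<^esub>"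
    using assms(2) by (auto simp: last_congruence_def kernel_def carrier_GL)
  have *: "a - 1 \<in> \<pp> (0 + (l - 1))" "b \<in> \<pp> (0 + (l - 1))" "c \<in> \<pp> (0 + (l - 1))" "d - 1 \<in> \<pp> (0 + (l - 1))"
    using k(3) unfolding k(2) M_def
    by (simp_all add: max_ideal_pow_eq reduce_trunc GL2_def units_of_def gl2_def trunc_simps trunc_eq_iff)
  note ** = *[THEN pp_divide]
  have "k = M (1 + P * ((a - 1) / P)) (P * (b / P)) (P * (c / P)) (1 + P * ((d - 1) / P))"
    using val_uniformiser(1) by (simp add: k(2))
  then show ?thesis using ** by blast
qed

text \<open>The value in \<open>psi_mat\<close> is a definite description. Two choices of lifts
  change the trace by an element of \<open>\<pp> 1\<close>, which multiplication by \<open>P\<close>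
  moves into \<open>\<pp> l\<close>, where \<open>\<Psi>\<close> is 1.\<close>

lemma psi_mat_M:
  assumes x: "x11 \<in> \<pp> 0" "x12 \<in> \<pp> 0" "x21 \<in> \<pp> 0" "x22 \<in> \<pp> 0"
    and y: "a \<in> \<pp> 0" "b \<in> \<pp> 0" "c \<in> \<pp> 0" "d \<in> \<pp> 0"
  shows "psi_mat v \<omega> \<psi> l (Mat2 (trunc v 1 x11) (trunc v 1 x12) (trunc v 1 x21) (trunc v 1 x22))
      (M (1 + P * a) (P * b) (P * c) (1 + P * d)) = \<Psi> (P * (x11 * a + x12 * c + x21 * b + x22 * d))"
proof -
  have red: "reduce v (max_ideal v) (tr x) = trunc v 1 x" for x
    using reduce_trunc[OF l_pos] by (simp add: max_ideal_eq)
  have red': "map_mat2 (reduce v (max_ideal v)) (M x y z w) = Mat2 (trunc v 1 x) (trunc v 1 y) (trunc v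
      1 z) (trunc v 1 w)" for x y z w
    by (simp add: M_def red)
  have sm: "smult2 R (unif_pow v \<omega> l (l - 1)) (M a b c d) = M (P * a) (P * b) (P * c) (P * d)"
    if "a \<in> \<pp> 0" "b \<in> \<pp> 0" "c \<in> \<pp> 0" "d \<in> \<pp> 0" for a b c d
    using that by (simp add: smult2_def M_def unif_pow_eq trunc_simps P_pp)
  have ad: "\<one>\<^bsub>gl2 R\<^esub> \<oplus>\<^bsub>gl2 R\<^esub> M a b c d = M (1 + a) b c (1 + d)"
    if "a \<in> \<pp> 0" "b \<in> \<pp> 0" "c \<in> \<pp> 0" "d \<in> \<pp> 0" for a b c d
    using that by (simp add: gl2_def M_def trunc_simps pp_closed)
  have tr: "unif_pow v \<omega> l (l - 1) \<otimes>\<^bsub>R\<^esub> trace2 R (M x11 x12 x21 x22 \<otimes>\<^bsub>gl2 R\<^esub> M a b c d)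
      = tr (P * (x11 * a + x12 * c + x21 * b + x22 * d))"
    if "x11 \<in> \<pp> 0" "x12 \<in> \<pp> 0" "x21 \<in> \<pp> 0" "x22 \<in> \<pp> 0"
      "a \<in> \<pp> 0" "b \<in> \<pp> 0" "c \<in> \<pp> 0" "d \<in> \<pp> 0" for x11 x12 x21 x22 a b c d
    unfolding gl2_mult[OF that]
    using that by (simp add: M_def unif_pow_eq trunc_simps P_pp pp_closed add_ac)
  show ?thesis
    unfolding psi_mat_def Let_def
  proof (rule the_equality)
    show "\<exists>x'\<in>carrier (gl2 R). \<exists>y\<in>carrier (gl2 R).
        map_mat2 (reduce v (max_ideal v)) x' = Mat2 (trunc v 1 x11) (trunc v 1 x12) (trunc v 1 x21)
            (trunc v 1 x22) \<and>
        M (1 + P * a) (P * b) (P * c) (1 + P * d) = \<one>\<^bsub>gl2 R\<^esub> \<oplus>\<^bsub>gl2 R\<^esub> smult2 R (unif_pow v \<omega> l (l - 1)) y \<and>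
        \<Psi> (P * (x11 * a + x12 * c + x21 * b + x22 * d)) = \<psi> (unif_pow v \<omega> l (l - 1) \<otimes>\<^bsub>R\<^esub> trace2 R (x'
            \<otimes>\<^bsub>gl2 R\<^esub> y))"
      by (rule bexI[of _ "M x11 x12 x21 x22"], rule bexI[of _ "M a b c d"])
        (use x y in \<open>simp_all add: sm ad tr red' \<Psi>_def P_pp pp_closed gl2_carrierI\<close>)
  next
    fix z assume "\<exists>x'\<in>carrier (gl2 R). \<exists>y\<in>carrier (gl2 R).
        map_mat2 (reduce v (max_ideal v)) x' = Mat2 (trunc v 1 x11) (trunc v 1 x12) (trunc v 1 x21)
            (trunc v 1 x22) \<and>
        M (1 + P * a) (P * b) (P * c) (1 + P * d) = \<one>\<^bsub>gl2 R\<^esub> \<oplus>\<^bsub>gl2 R\<^esub> smult2 R (unif_pow v \<omega> l (l - 1)) y \<and>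
        z = \<psi> (unif_pow v \<omega> l (l - 1) \<otimes>\<^bsub>R\<^esub> trace2 R (x' \<otimes>\<^bsub>gl2 R\<^esub> y))"
    then obtain Xm Y where XY: "Xm \<in> carrier (gl2 R)" "Y \<in> carrier (gl2 R)"
      and 1: "map_mat2 (reduce v (max_ideal v)) Xm =
          Mat2 (trunc v 1 x11) (trunc v 1 x12) (trunc v 1 x21) (trunc v 1 x22)"
      and 2: "M (1 + P * a) (P * b) (P * c) (1 + P * d) =
          \<one>\<^bsub>gl2 R\<^esub> \<oplus>\<^bsub>gl2 R\<^esub> smult2 R (unif_pow v \<omega> l (l - 1)) Y"
      and 3: "z = \<psi> (unif_pow v \<omega> l (l - 1) \<otimes>\<^bsub>R\<^esub> trace2 R (Xm \<otimes>\<^bsub>gl2 R\<^esub> Y))"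
      by (elim bexE conjE)
    obtain X11 X12 X21 X22 where
      Xm: "X11 \<in> \<pp> 0" "X12 \<in> \<pp> 0" "X21 \<in> \<pp> 0" "X22 \<in> \<pp> 0" and XE: "Xm = M X11 X12 X21 X22"
      using XY(1) by (auto simp: carrier_gl2)
    obtain A B C D where Y: "A \<in> \<pp> 0" "B \<in> \<pp> 0" "C \<in> \<pp> 0" "D \<in> \<pp> 0" and Y': "Y = M A B C D"
      using XY(2) by (auto simp: carrier_gl2)
    note 1 = 1[unfolded XE red'] and 2 = 2[unfolded Y'] and 3 = 3[unfolded XE Y']
    have dX: "X11 - x11 \<in> \<pp> 1" "X12 - x12 \<in> \<pp> 1" "X21 - x21 \<in> \<pp> 1" "X22 - x22 \<in> \<pp> 1"
      using 1 by (auto simp: trunc_eq_iff)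
    have "P * a - P * A \<in> \<pp> l" "P * b - P * B \<in> \<pp> l" "P * c - P * C \<in> \<pp> l" "P * d - P * D \<in> \<pp> l"
      using 2 by (auto simp: sm ad Y P_pp pp_closed M_eq_iff)
    then have dY: "a - A \<in> \<pp> 1" "b - B \<in> \<pp> 1" "c - C \<in> \<pp> 1" "d - D \<in> \<pp> 1"
      by (simp_all add: right_diff_distrib[symmetric] P_mult)
    have d: "Xm * Y - x * y \<in> \<pp> 1" if "Xm - x \<in> \<pp> 1" "y - Y \<in> \<pp> 1" "Y \<in> \<pp> 0" "x \<in> \<pp> 0" for Xm x y Y
    proof -
      have "Xm * Y - x * y = (Xm - x) * Y - x * (y - Y)" by (simp add: algebra_simps)
      then show ?thesis using that by (simp add: pp_closed)
    qed
    have "(X11 * A + X12 * C + X21 * B + X22 * D) - (x11 * a + x12 * c + x21 * b + x22 * d)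
      = (X11 * A - x11 * a) + (X12 * C - x12 * c) + (X21 * B - x21 * b) + (X22 * D - x22 * d)" by simp
    also have "\<dots> \<in> \<pp> 1" using dX dY x Y by (intro pp_add d) auto
    finally show "z = \<Psi> (P * (x11 * a + x12 * c + x21 * b + x22 * d))"
      unfolding 3 tr[OF Xm Y] \<Psi>_def[symmetric] by (rule Psi_P_cong)
  qed
qed

lemma is_root_charpoly2:
  assumes x: "x11 \<in> \<pp> 0" "x12 \<in> \<pp> 0" "x21 \<in> \<pp> 0" "x22 \<in> \<pp> 0" and r: "r \<in> \<pp> 0"
  shows "ring.is_root (residue_field v)
      (charpoly2 (residue_field v) (Mat2 (trunc v 1 x11) (trunc v 1 x12) (trunc v 1 x21) (trunc v 1
          x22))) (trunc v 1 r)
    \<longleftrightarrow> r * r - (x11 + x22) * r + (x11 * x22 - x12 * x21) \<in> \<pp> 1"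
proof -
  interpret F: cring "trunc_ring v 1" by (rule cring_trunc_ring)
  have [simp]: "trunc v 1 y \<in> carrier (trunc_ring v 1)" if "y \<in> \<pp> 0" for y using that by (simp only:
      trunc_simps)
  have "F.eval (charpoly2 (trunc_ring v 1) (Mat2 (trunc v 1 x11) (trunc v 1 x12) (trunc v 1 x21) (trunc
      v 1 x22))) (trunc v 1 r)
    = trunc v 1 (r * r - (x11 + x22) * r + (x11 * x22 - x12 * x21))"
    using x r
    by (simp add: charpoly2_def numeral_2_eq_2 trunc_simps pp_closed algebra_simps)
  then show ?thesis
    using r unfolding residue_field_eq F.is_root_def by (simp add: trunc_simps charpoly2_def trunc_eq_iff)
qed

end

context trunc_data
begin

lemma gl_upper: "unit a \<Longrightarrow> b \<in> \<pp> 0 \<Longrightarrow> unit d \<Longrightarrow> gl a b 0 d"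
  by (simp add: gl_def unit_int pp_0 unit_mult)

lemma gl_unip: "b \<in> \<pp> 0 \<Longrightarrow> gl 1 b 0 1"
  by (simp add: gl_upper unit_1)

lemma gl_low: "c \<in> \<pp> 0 \<Longrightarrow> gl 1 0 c 1"
  by (simp add: gl_def pp_0 pp_1 unit_1)

lemma gl_anti: "d \<in> \<pp> 0 \<Longrightarrow> gl 0 1 1 d"
  by (simp add: gl_def pp_0 pp_1 unit_uminus unit_1)

lemma gl_unit_cases:
  assumes "gl a b c d" "c \<in> \<pp> 1"
  shows "unit a" "unit d"
proof -
  have "unit (a * d - b * c + b * c)"
    using assms by (intro unit_add) (auto simp: gl_def pp_mult_left)
  then have "unit (a * d)" by simp
  then show "unit a" "unit d" using assms by (auto simp: gl_def unit_mult_iff)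
qed

lemma gl_int: "gl a b c d \<Longrightarrow> a \<in> \<pp> 0 \<and> b \<in> \<pp> 0 \<and> c \<in> \<pp> 0 \<and> d \<in> \<pp> 0"
  by (simp add: gl_def)

lemma char_on_unipotent: "char_on GL (unipotent R) (psi_unip v \<omega> \<psi> t l)"
proof -
  interpret group GL by (rule group_GL)
  show ?thesis
  proof (rule char_onI)
    show sub: "unipotent R \<subseteq> carrier GL"
      by (auto simp: unipotent_R intro!: M_in_GL gl_unip)
    show "finite (unipotent R)" using sub finite_GL finite_subset by blast
    show "\<one>\<^bsub>GL\<^esub> \<in> unipotent R" unfolding GL_one unipotent_R using pp_0 by blast
    fix h h' assume h: "h \<in> unipotent R" "h' \<in> unipotent R"
    then obtain b b' where b: "b \<in> \<pp> 0" "h = M 1 b 0 1" "b' \<in> \<pp> 0" "h' = M 1 b' 0 1"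
      by (auto simp: unipotent_R)
    have m: "h \<otimes>\<^bsub>GL\<^esub> h' = M 1 (b + b') 0 1"
      using b by (simp add: GL_mult gl_unip add.commute)
    show "h \<otimes>\<^bsub>GL\<^esub> h' \<in> unipotent R"
      unfolding m unipotent_R using b pp_add by blast
    show "psi_unip v \<omega> \<psi> t l (h \<otimes>\<^bsub>GL\<^esub> h') = psi_unip v \<omega> \<psi> t l h * psi_unip v \<omega> \<psi> t l h'"
      unfolding m using b
      by (simp add: psi_unip_M pp_add distrib_left Psi_add pp_mult_left uniformiser_power)
  next
    show "psi_unip v \<omega> \<psi> t l \<one>\<^bsub>GL\<^esub> \<noteq> 0"
      by (simp add: GL_one psi_unip_M pp_0 Psi_0)
  qed
qed

section \<open>Coordinates on the last congruence subgroup, and the reflection for Gelfand's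
  trick\<close>

definition Kel :: "'a \<Rightarrow> 'a \<Rightarrow> 'a \<Rightarrow> 'a \<Rightarrow> 'a set mat2" where
  "Kel a b c d = M (1 + P * a) (P * b) (P * c) (1 + P * d)"

text \<open>Transposition followed by conjugation with the Weyl element, that is, reflection in the
  antidiagonal. It reverses products and fixes every upper unipotent matrix.\<close>

definition gl2_flip :: "'a set mat2 \<Rightarrow> 'a set mat2" where
  "gl2_flip g = (case g of Mat2 a b c d \<Rightarrow> Mat2 d b c a)"

lemma gl2_flip_M: "gl2_flip (M a b c d) = M d b c a"
  by (simp add: gl2_flip_def M_def)

lemma gl_flip: "gl a b c d \<Longrightarrow> gl d b c a"
  by (simp add: gl_def mult.commute)

lemma gl2_flip_anti:
  assumes "g \<in> carrier GL" "h \<in> carrier GL"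
  shows "gl2_flip (g \<otimes>\<^bsub>GL\<^esub> h) = gl2_flip h \<otimes>\<^bsub>GL\<^esub> gl2_flip g"
proof -
  obtain a b c d where g: "gl a b c d" "g = M a b c d" using assms(1) by (auto simp: carrier_GL)
  obtain a' b' c' d' where h: "gl a' b' c' d'" "h = M a' b' c' d'" using assms(2) by (auto simp: carrier_GL)
  show ?thesis using g h gl_flip by (simp add: GL_mult gl2_flip_M algebra_simps)
qed

lemma gl2_flip_flip: "gl2_flip (gl2_flip g) = g"
  by (cases g) (simp add: gl2_flip_def)

lemma gl2_flip_closed: "g \<in> carrier GL \<Longrightarrow> gl2_flip g \<in> carrier GL"
  unfolding carrier_GL using gl_flip gl2_flip_M by fastforce

context
  assumes l2: "l \<ge> 2"
begin

lemma P_1: "P \<in> \<pp> 1"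
  using P_pp(1) pp_mono l2 by fastforce

lemma PP: "x \<in> \<pp> 0 \<Longrightarrow> P * P * x \<in> \<pp> l"
  using pp_mult_le[OF P_pp(1) P_pp(1), of l] l2 by (simp add: pp_mult_right)

lemma P_x_1: "x \<in> \<pp> 0 \<Longrightarrow> P * x \<in> \<pp> 1"
  using P_1 by (simp add: pp_mult_right)

lemma gl_K:
  assumes "a \<in> \<pp> 0" "b \<in> \<pp> 0" "c \<in> \<pp> 0" "d \<in> \<pp> 0"
  shows "gl (1 + P * a) (P * b) (P * c) (1 + P * d)"
proof -
  have "unit ((1 + P * a) * (1 + P * d) - (P * b) * (P * c))"
    using assms by (intro unit_diff unit_mult unit_add unit_1 pp_mult_right P_1) (auto simp:
        pp_mult_right P_pp)
  then show ?thesis using assms by (simp add: gl_def pp_closed P_pp)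
qed

lemma Kel_in: "a \<in> \<pp> 0 \<Longrightarrow> b \<in> \<pp> 0 \<Longrightarrow> c \<in> \<pp> 0 \<Longrightarrow> d \<in> \<pp> 0 \<Longrightarrow> Kel a b c d \<in> carrier GL"
  unfolding Kel_def by (intro M_in_GL gl_K)

text \<open>The quadratic terms carry \<open>P * P\<close>, which lies in \<open>\<pp> l\<close>
  because 2 (l - 1) \<ge> l. In particular these elements commute.\<close>

lemma Kel_mult:
  assumes "a \<in> \<pp> 0" "b \<in> \<pp> 0" "c \<in> \<pp> 0" "d \<in> \<pp> 0" "a' \<in> \<pp> 0" "b' \<in> \<pp> 0" "c' \<in> \<pp> 0" "d' \<in> \<pp> 0"
  shows "Kel a b c d \<otimes>\<^bsub>GL\<^esub> Kel a' b' c' d' = Kel (a + a') (b + b') (c + c') (d + d')"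
proof -
  have "P * P * (a * a' + b * c') \<in> \<pp> l" "P * P * (a * b' + b * d') \<in> \<pp> l"
    "P * P * (c * a' + d * c') \<in> \<pp> l" "P * P * (c * b' + d * d') \<in> \<pp> l"
    using assms by (auto intro!: PP simp: pp_closed)
  then show ?thesis
    unfolding Kel_def GL_mult[OF gl_K[OF assms(1-4)] gl_K[OF assms(5-8)]] M_eq_iff
    by (simp add: algebra_simps)
qed

lemma Kel_cong: "a - a' \<in> \<pp> 1 \<Longrightarrow> b - b' \<in> \<pp> 1 \<Longrightarrow> c - c' \<in> \<pp> 1 \<Longrightarrow> d - d' \<in> \<pp> 1 \<Longrightarrow> Kel a b c d = Kel a' b' c' d'"
  unfolding Kel_def M_eq_iff by (simp add: right_diff_distrib[symmetric] P_mult)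

lemma Kel_0: "Kel 0 0 0 0 = \<one>\<^bsub>GL\<^esub>"
  by (simp add: Kel_def GL_one)

text \<open>The relation y g = g z is required only modulo the maximal ideal, since \<open>P\<close>
  carries the difference into \<open>\<pp> l\<close>. In this form no inverse matrix has to be
  written down.\<close>

lemma Kel_conj:
  assumes g: "gl a b c d"
    and y: "y11 \<in> \<pp> 0" "y12 \<in> \<pp> 0" "y21 \<in> \<pp> 0" "y22 \<in> \<pp> 0"
    and z: "z11 \<in> \<pp> 0" "z12 \<in> \<pp> 0" "z21 \<in> \<pp> 0" "z22 \<in> \<pp> 0"
    and eq: "y11 * a + y12 * c - (a * z11 + b * z21) \<in> \<pp> 1" "y11 * b + y12 * d - (a * z12 + b * z22) \<in> \<pp> 1"
      "y21 * a + y22 * c - (c * z11 + d * z21) \<in> \<pp> 1" "y21 * b + y22 * d - (c * z12 + d * z22) \<in> \<pp> 1"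
  shows "Kel y11 y12 y21 y22 \<otimes>\<^bsub>GL\<^esub> M a b c d = M a b c d \<otimes>\<^bsub>GL\<^esub> Kel z11 z12 z21 z22"
  unfolding Kel_def GL_mult[OF gl_K[OF y] g] GL_mult[OF g gl_K[OF z]] M_eq_iff
  using eq[THEN P_mult[THEN iffD2]] by (simp add: algebra_simps)

end

end

section \<open>The symmetry used in Gelfand's trick\<close>

context trunc_data
begin

text \<open>The lower left entry is only given modulo \<open>\<pp> l\<close>, so it may be taken nonzero, also when its class
  vanishes; then \<open>c\<close> can be divided by.\<close>

lemma lower_left_representative:
  assumes g: "gl a b c d"
  obtains c' k where "gl a b c' d" "M a b c d = M a b c' d" "c' \<noteq> 0" "k \<le> l" "c' \<in> \<pp> k"
    "\<forall>x\<in>\<pp> k. x / c' \<in> \<pp> 0"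
proof -
  note i = gl_int[OF g]
  have *: "\<exists>k\<le>l. c' \<in> \<pp> k \<and> (\<forall>x\<in>\<pp> k. x / c' \<in> \<pp> 0)" if c': "c' \<in> \<pp> 0" "c' \<noteq> 0" "c' \<notin> \<pp> (Suc l)" for c'
  proof -
    obtain k u where k: "unit u" "c' = \<omega> ^ k * u" "c' \<in> \<pp> k"
      by (rule uniformiser_factor[OF c'(1,2)])
    have "k \<le> l" using k(3) c'(3) pp_mono[of c' k "Suc l"] by (meson not_less_eq_eq)
    moreover have "x / c' \<in> \<pp> 0" if "x \<in> \<pp> k" for x
      using pp_divide_unit[OF pp_divide[of x 0 k] k(1)] that by (simp add: k(2))
    ultimately show ?thesis using k by auto
  qed
  show thesis
  proof (cases "c \<in> \<pp> l")
    case False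
    then have "c \<noteq> 0" "c \<notin> \<pp> (Suc l)" using pp_0 pp_mono[of c "Suc l" l] by auto
    then show ?thesis using *[of c] i that[OF g] by auto
  next
    case True
    define c' where "c' = \<omega> ^ l"
    have c': "c' \<in> \<pp> l" "c' \<in> \<pp> 0" "c' \<noteq> 0" "c' \<notin> \<pp> (Suc l)"
      using uniformiser_power[of l] val_uniformiser by (auto simp: c'_def pp_iff val_power)
    have cc: "c - c' \<in> \<pp> l" using True c' by (simp add: pp_diff)
    have "unit (a * d - b * c + b * (c - c'))"
      using g i cc pp_mono[OF cc l_pos] by (intro unit_add) (auto simp: gl_def pp_mult_left)
    then have "gl a b c' d" using i c' by (simp add: gl_def algebra_simps)
    moreover have "M a b c d = M a b c' d" using cc by (simp add: M_eq_iff pp_0)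
    ultimately show ?thesis using *[OF c'(2,3,4)] that c'(3) by auto
  qed
qed

text \<open>Conjugation by the upper unipotent element with entry x adds x c to the upper left entry
  and subtracts it from the lower right one. With x c = d - a the two are exchanged, and the upper
  right entry returns to b.\<close>

lemma flip_conj:
  assumes g: "gl a b c d" and x: "x \<in> \<pp> 0" "x * c = d - a"
  shows "gl2_flip (M a b c d) = M 1 x 0 1 \<otimes>\<^bsub>GL\<^esub> M a b c d \<otimes>\<^bsub>GL\<^esub> M 1 (- x) 0 1"
proof -
  have u: "gl 1 x 0 1" "gl 1 (- x) 0 1" using x by (auto intro!: gl_unip simp: pp_uminus)
  have m: "gl d (b + x * d) c d" using gl_mult[OF u(1) g] x by simp
  have "M 1 x 0 1 \<otimes>\<^bsub>GL\<^esub> M a b c d = M d (b + x * d) c d"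
    using GL_mult[OF u(1) g] x by simp
  moreover have "d * 1 + (b + x * d) * 0 = d" "d * - x + (b + x * d) * 1 = b" "c * 1 + d * 0 = c" "c * -
      x + d * 1 = a"
    using x(2) by (simp_all add: algebra_simps)
  ultimately show ?thesis using GL_mult[OF m u(2)] by (simp only: gl2_flip_M)
qed

text \<open>If c divides d - a, then \<open>flip_conj\<close> applies. Otherwise c has larger
  valuation than d - a, so c is not a unit while a and d are. Some x then kills c without killing d
  - a, and moving its unipotent element past the matrix turns x into y = x d / a, which changes the
  character.\<close>

lemma gelfand_criterion_unipotent:
  assumes "gl a b c d"
  shows "(\<exists>x\<in>\<pp> 0. gl2_flip (M a b c d) = M 1 x 0 1 \<otimes>\<^bsub>GL\<^esub> M a b c d \<otimes>\<^bsub>GL\<^esub> M 1 (- x) 0 1) \<or>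
    (\<exists>x\<in>\<pp> 0. \<exists>y\<in>\<pp> 0. M 1 x 0 1 \<otimes>\<^bsub>GL\<^esub> M a b c d = M a b c d \<otimes>\<^bsub>GL\<^esub> M 1 y 0 1 \<and> \<Psi> x \<noteq> \<Psi> y)"
proof -
  obtain c' k where c': "gl a b c' d" "M a b c d = M a b c' d" "c' \<noteq> 0" "k \<le> l" "c' \<in> \<pp> k"
    "\<forall>x\<in>\<pp> k. x / c' \<in> \<pp> 0"
    by (rule lower_left_representative[OF assms])
  note i = gl_int[OF c'(1)]
  show ?thesis
  proof (cases "d - a \<in> \<pp> k")
    case True
    then show ?thesis unfolding c'(2)
      using flip_conj[OF c'(1) bspec[OF c'(6) True]] c'(3) bspec[OF c'(6) True] by auto
  next
    case False
    then have "d - a \<noteq> 0" by (auto simp: pp_0)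
    then obtain j u where j: "unit u" "d - a = \<omega> ^ j * u" "d - a \<in> \<pp> j"
      using i by (metis uniformiser_factor pp_diff)
    have jk: "j < k" using False j(3) pp_mono by (meson not_less)
    have "c' \<in> \<pp> 1" using c'(5) jk pp_mono[of c' k 1] by simp
    then have ua: "unit a" using gl_unit_cases[OF c'(1)] by blast
    obtain z where z: "z \<in> \<pp> 0" "\<Psi> (P * z) \<noteq> 1" by (rule Psi_primitive)
    \<comment> \<open>With this scaling y - x = x (d - a) / a equals \<open>P * z\<close>, where
      \<open>\<Psi>\<close> is not 1; the product of x with the lower left entry is still in
      \<open>\<pp> l\<close> because j < k.\<close>
    define x where "x = \<omega> ^ (l - 1 - j) * (z * a / u)"
    define y where "y = x * d / a"
    have x: "x \<in> \<pp> (l - 1 - j)"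
      unfolding x_def using z i j by (intro pp_mult_right uniformiser_power pp_divide_unit) (auto simp:
          pp_closed)
    have xI: "x \<in> \<pp> 0" using x pp_int by blast
    have y: "y \<in> \<pp> (l - 1 - j)" "y \<in> \<pp> 0" "a * y = x * d"
      using x xI i ua unit_nonzero[OF ua] by (auto simp: y_def intro!: pp_divide_unit pp_mult_right)
    have xc: "x * c' \<in> \<pp> l" "c' * y \<in> \<pp> l"
      using pp_mult_le[OF x c'(5), of l] pp_mult_le[OF c'(5) y(1), of l] jk c'(4) by simp_all
    have "y - x = x * (d - a) / a" using unit_nonzero[OF ua] by (simp add: y_def field_simps)
    also have "\<dots> = \<omega> ^ (l - 1 - j + j) * z"
      using unit_nonzero[OF ua] unit_nonzero[OF j(1)] by (simp add: x_def j(2) power_add)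
    finally have "y - x = P * z" using jk c'(4) by simp
    then have "\<Psi> y = \<Psi> x * \<Psi> (P * z)"
      using Psi_add[OF xI, of "P * z"] z by (simp add: pp_closed P_pp algebra_simps)
    then have "\<Psi> x \<noteq> \<Psi> y" using z Psi_nonzero[OF xI] by auto
    moreover have "M 1 x 0 1 \<otimes>\<^bsub>GL\<^esub> M a b c' d = M a b c' d \<otimes>\<^bsub>GL\<^esub> M 1 y 0 1"
      using xc y(3) unfolding GL_mult[OF gl_unip[OF xI] c'(1)] GL_mult[OF c'(1) gl_unip[OF y(2)]] M_eq_iff
      by (simp add: pp_0 pp_uminus[of "c' * y", symmetric])
    ultimately show ?thesis unfolding c'(2) using xI y(2) by blast
  qed
qed

text \<open>The group generated by \<open>U\<close> and the diagonal part of \<open>K\<^sup>l\<^sup>-\<^sup>1\<close>; for \<open>l \<ge> 2\<close> the character below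
  extends \<open>\<psi>\<^bsub>l-1\<^esub>\<close> to it.\<close>

definition H2 :: "'a set mat2 set" where
  "H2 = {M a b 0 d | a b d. b \<in> \<pp> 0 \<and> a - 1 \<in> \<pp> (l - 1) \<and> d - 1 \<in> \<pp> (l - 1)}"

definition H2_char :: "'a \<Rightarrow> 'a \<Rightarrow> 'a set mat2 \<Rightarrow> complex" where
  "H2_char r s g = (case g of Mat2 A B C D \<Rightarrow>
     \<psi> ((tr \<omega> \<otimes>\<^bsub>R\<^esub> B) \<oplus>\<^bsub>R\<^esub> ((tr r \<otimes>\<^bsub>R\<^esub> (A \<ominus>\<^bsub>R\<^esub> \<one>\<^bsub>R\<^esub>)) \<oplus>\<^bsub>R\<^esub> (tr s \<otimes>\<^bsub>R\<^esub> (D \<ominus>\<^bsub>R\<^esub> \<one>\<^bsub>R\<^esub>)))))"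

lemma omega_pp: "\<omega> \<in> \<pp> 1" "\<omega> \<in> \<pp> 0"
  using uniformiser_power[of 1] by auto

lemma H2_char_M:
  "a \<in> \<pp> 0 \<Longrightarrow> b \<in> \<pp> 0 \<Longrightarrow> d \<in> \<pp> 0 \<Longrightarrow> r \<in> \<pp> 0 \<Longrightarrow> s \<in> \<pp> 0 \<Longrightarrow>
    H2_char r s (M a b c d) = \<Psi> (\<omega> * b + (r * (a - 1) + s * (d - 1)))"
  by (simp add: H2_char_def M_def \<Psi>_def trunc_simps pp_closed omega_pp)

context
  assumes l2: "l \<ge> 2"
begin

lemma unit_near_1: "a - 1 \<in> \<pp> (l - 1) \<Longrightarrow> unit a"
  using unit_add[OF unit_1 pp_mono[of "a - 1" "l - 1" 1]] l2 by simp

text \<open>The deviation from multiplicativity consists of products of two elements of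
  \<open>\<pp> (l - 1)\<close> and of \<open>\<omega>\<close> times an element of
  \<open>\<pp> (l - 1)\<close>. Both lie in \<open>\<pp> l\<close>, the former by
  \<open>l \<ge> 2\<close>.\<close>

lemma char_on_H2:
  assumes rs: "r \<in> \<pp> 0" "s \<in> \<pp> 0"
  shows "char_on GL H2 (H2_char r s)"
proof -
  interpret group GL by (rule group_GL)
  have H2E: "\<exists>a b d. h = M a b 0 d \<and> gl a b 0 d \<and> b \<in> \<pp> 0 \<and> a - 1 \<in> \<pp> (l - 1) \<and> d - 1 \<in> \<pp> (l - 1) \<and> a \<in>
      \<pp> 0 \<and> d \<in> \<pp> 0"
    if "h \<in> H2" for h
    using that unit_near_1 unfolding H2_def by (fastforce intro: gl_upper simp: unit_int)
  show ?thesis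
  proof (rule char_onI)
    show sub: "H2 \<subseteq> carrier GL" using H2E M_in_GL by blast
    show "finite H2" using sub finite_GL finite_subset by blast
    have "(1::'a) - 1 \<in> \<pp> (l - 1)" by (simp add: pp_0)
    then show "\<one>\<^bsub>GL\<^esub> \<in> H2" unfolding GL_one H2_def using pp_0 by blast
    show "H2_char r s \<one>\<^bsub>GL\<^esub> \<noteq> 0" using rs by (simp add: GL_one H2_char_M pp_0 pp_1 Psi_0)
    fix h h' assume "h \<in> H2" "h' \<in> H2"
    then obtain a b d a' b' d' where
      h: "h = M a b 0 d" "gl a b 0 d" "b \<in> \<pp> 0" "a - 1 \<in> \<pp> (l - 1)" "d - 1 \<in> \<pp> (l - 1)" "a \<in> \<pp> 0" "d \<in> \<pp>
          0" and
      h': "h' = M a' b' 0 d'" "gl a' b' 0 d'" "b' \<in> \<pp> 0" "a' - 1 \<in> \<pp> (l - 1)" "d' - 1 \<in> \<pp> (l - 1)" "a' \<in>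
          \<pp> 0" "d' \<in> \<pp> 0"
      using H2E by meson
    have m: "h \<otimes>\<^bsub>GL\<^esub> h' = M (a * a') (a * b' + b * d') 0 (d * d')"
      using GL_mult[OF h(2) h'(2)] by (simp add: h h')
    have aa: "a * a' - 1 = (a - 1) * a' + (a' - 1)" "d * d' - 1 = (d - 1) * d' + (d' - 1)" by (simp_all
        add: algebra_simps)
    have "a * a' - 1 \<in> \<pp> (l - 1)" "d * d' - 1 \<in> \<pp> (l - 1)" "a * b' + b * d' \<in> \<pp> 0"
      unfolding aa using h h' by (simp_all add: pp_closed)
    then show "h \<otimes>\<^bsub>GL\<^esub> h' \<in> H2" unfolding m H2_def by blast
    have sq: "x * y * z \<in> \<pp> l" if "x \<in> \<pp> (l - 1)" "y \<in> \<pp> (l - 1)" "z \<in> \<pp> 0" for x y z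
      using pp_mult_le[OF that(1,2), of l] l2 that(3) by (simp add: pp_mult_right)
    have om: "\<omega> * (x * y) \<in> \<pp> l" if "x \<in> \<pp> (l - 1)" "y \<in> \<pp> 0" for x y
      using pp_mult_le[OF omega_pp(1) that(1), of l] l_pos that(2) by (simp add: mult.assoc[symmetric]
          pp_mult_right)
    have "H2_char r s (h \<otimes>\<^bsub>GL\<^esub> h') = \<Psi> ((\<omega> * b + (r * (a - 1) + s * (d - 1))) + (\<omega> * b' + (r * (a' - 1)
        + s * (d' - 1))))"
      unfolding m using h h' rs
    proof (subst H2_char_M)
      have "(\<omega> * (a * b' + b * d') + (r * (a * a' - 1) + s * (d * d' - 1))) -
         ((\<omega> * b + (r * (a - 1) + s * (d - 1))) + (\<omega> * b' + (r * (a' - 1) + s * (d' - 1))))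
        = \<omega> * ((a - 1) * b') + \<omega> * ((d' - 1) * b) + (a - 1) * (a' - 1) * r + (d - 1) * (d' - 1) * s"
        by (simp add: algebra_simps)
      also have "\<dots> \<in> \<pp> l" using h h' rs by (intro pp_add om sq)
      finally show "\<Psi> (\<omega> * (a * b' + b * d') + (r * (a * a' - 1) + s * (d * d' - 1))) =
        \<Psi> ((\<omega> * b + (r * (a - 1) + s * (d - 1))) + (\<omega> * b' + (r * (a' - 1) + s * (d' - 1))))"
        by (rule Psi_cong)
    qed (use h h' rs in \<open>simp_all add: pp_closed\<close>)
    also have "\<dots> = H2_char r s h * H2_char r s h'"
      using h h' rs by (simp add: H2_char_M Psi_add pp_closed omega_pp)
    finally show "H2_char r s (h \<otimes>\<^bsub>GL\<^esub> h') = H2_char r s h * H2_char r s h'" .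
  qed
qed

lemma unip_in_H2: "b \<in> \<pp> 0 \<Longrightarrow> M 1 b 0 1 \<in> H2"
  unfolding H2_def using pp_0[of "l - 1"] by force

lemma H2_char_unip: "b \<in> \<pp> 0 \<Longrightarrow> r \<in> \<pp> 0 \<Longrightarrow> H2_char r r (M 1 b 0 1) = \<Psi> (\<omega> * b)"
  by (simp add: H2_char_M pp_1)

text \<open>As for U when c divides d - a. Otherwise let j be the valuation of d - a. For j = l - 1
  the matrix is upper triangular and the diagonal part of \<open>H2\<close> realises the flip; for
  smaller j an upper unipotent element is moved past the matrix, and what comes out has a different
  character value.\<close>

lemma gelfand_criterion_H2:
  assumes g: "gl a b c d" and r: "r \<in> \<pp> 0"
  shows "(\<exists>h\<in>H2. \<exists>h'\<in>H2. gl2_flip (M a b c d) = h \<otimes>\<^bsub>GL\<^esub> M a b c d \<otimes>\<^bsub>GL\<^esub> h' \<and> H2_char r r h * H2_char r r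
      h' = 1) \<or>
    (\<exists>h\<in>H2. \<exists>h'\<in>H2. h \<otimes>\<^bsub>GL\<^esub> M a b c d = M a b c d \<otimes>\<^bsub>GL\<^esub> h' \<and> H2_char r r h \<noteq> H2_char r r h')"
proof -
  obtain c' k where c': "gl a b c' d" "M a b c d = M a b c' d" "c' \<noteq> 0" "k \<le> l" "c' \<in> \<pp> k"
    "\<forall>x\<in>\<pp> k. x / c' \<in> \<pp> 0"
    by (rule lower_left_representative[OF g])
  note i = gl_int[OF c'(1)]
  show ?thesis
  proof (cases "d - a \<in> \<pp> k")
    case True
    define x where "x = (d - a) / c'"
    have x: "x \<in> \<pp> 0" "x * c' = d - a" using bspec[OF c'(6) True] c'(3) by (auto simp: x_def)
    have "H2_char r r (M 1 x 0 1) * H2_char r r (M 1 (- x) 0 1) = \<Psi> (\<omega> * x + \<omega> * - x)"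
      using x r by (subst Psi_add) (simp_all add: H2_char_unip pp_closed omega_pp)
    then have "H2_char r r (M 1 x 0 1) * H2_char r r (M 1 (- x) 0 1) = 1" by (simp add: Psi_0)
    then show ?thesis unfolding c'(2)
      using flip_conj[OF c'(1) x] unip_in_H2[of x] unip_in_H2[of "- x"] x(1) by (auto simp: pp_uminus)
  next
    case False
    then have "d - a \<noteq> 0" by (auto simp: pp_0)
    then obtain j u where j: "unit u" "d - a = \<omega> ^ j * u" "d - a \<in> \<pp> j"
      using i by (metis uniformiser_factor pp_diff)
    have jk: "j < k" using False j(3) pp_mono by (meson not_less)
    have c1: "c' \<in> \<pp> 1" using c'(5) jk pp_mono[of c' k 1] by simp
    then have u: "unit a" "unit d" using gl_unit_cases[OF c'(1)] by blast+
    note u0 = u[THEN unit_nonzero]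
    show ?thesis
    proof (cases "j = l - 1")
      case True
      then have kl: "k = l" using jk c'(4) by simp
      have c0: "M a b c' d = M a b 0 d" using c'(5) kl by (simp add: M_eq_iff pp_0)
      \<comment> \<open>Multiplying by \<open>?h\<close> on the left and \<open>?h'\<close> on the
        right exchanges the diagonal entries. Since both diagonal weights are r, the two character
        values cancel up to the term r (d - a)^2 / (a d), which lies in
        \<open>\<pp> l\<close>.\<close>
      let ?h = "M (d / a) 0 0 1" and ?h' = "M 1 0 0 (a / d)"
      have e: "d / a - 1 = (d - a) / a" "a / d - 1 = - ((d - a) / d)" using u0 by (simp_all add:
          field_simps)
      have da: "d - a \<in> \<pp> (l - 1)" using j(3) True by simp
      have ep: "d / a - 1 \<in> \<pp> (l - 1)" "a / d - 1 \<in> \<pp> (l - 1)"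
        unfolding e pp_uminus using da u by (auto intro: pp_divide_unit)
      have H: "?h \<in> H2" "?h' \<in> H2" using ep pp_0[of 0] pp_0[of "l - 1"] unfolding H2_def by force+
      have q: "d / a \<in> \<pp> 0" "a / d \<in> \<pp> 0" using i u by (auto intro: pp_divide_unit)
      have sq: "(d - a) * (d - a) \<in> \<pp> l" by (rule pp_mult_le[OF da da]) (use l2 in simp)
      have "H2_char r r ?h * H2_char r r ?h' = \<Psi> (r * (d / a - 1)) * \<Psi> (r * (a / d - 1))"
        using q r by (simp add: H2_char_M pp_0 pp_1)
      also have "\<dots> = \<Psi> (r * (d / a - 1) + r * (a / d - 1))"
        using q r by (simp add: Psi_add pp_closed)
      also have "r * (d / a - 1) + r * (a / d - 1) = r * ((d - a) * (d - a) / (a * d))"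
        using u0 by (simp add: field_simps)
      also have "\<Psi> \<dots> = 1"
        by (rule Psi_eq_1[OF pp_mult_left[OF r pp_divide_unit[OF sq unit_mult[OF u]]]])
      finally have t: "H2_char r r ?h * H2_char r r ?h' = 1" .
      have qb: "d / a * b \<in> \<pp> 0" using pp_mult_left[OF q(1)] i by blast
      have gg: "gl (d / a) 0 0 1" "gl 1 0 0 (a / d)" "gl a b 0 d" "gl d (d / a * b) 0 d"
        using u i gl_upper[OF u(2) qb u(2)] by (auto intro!: gl_upper unit_divide unit_1 pp_0)
      have "gl2_flip (M a b c' d) = ?h \<otimes>\<^bsub>GL\<^esub> M a b 0 d \<otimes>\<^bsub>GL\<^esub> ?h'"
        using GL_mult[OF gg(1,3)] GL_mult[OF gg(4,2)] u0 c0 by (simp add: gl2_flip_M)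
      then show ?thesis unfolding c'(2) c0 using H t by blast
    next
      case False
      then have jl: "j \<le> l - 2" using jk c'(4) by simp
      obtain z where z: "z \<in> \<pp> 0" "\<Psi> (P * z) \<noteq> 1" by (rule Psi_primitive)
      define D where "D = a * d - b * c'"
      have D: "unit D" using c'(1) by (simp add: gl_def D_def)
      note D0 = unit_nonzero[OF D]
      \<comment> \<open>The exponent is one less than for U, because the character of an upper
        unipotent element with entry b is \<open>\<Psi> (\<omega> * b)\<close> and supplies one
        factor of the uniformiser itself. The price is that x c is only in
        \<open>\<pp> (l - 1)\<close>.\<close>
      define x where "x = \<omega> ^ (l - 2 - j) * (z * a / u)"
      have x: "x \<in> \<pp> (l - 2 - j)"
        unfolding x_def using z i j by (intro pp_mult_right uniformiser_power pp_divide_unit) (auto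
            simp: pp_closed)
      have xI: "x \<in> \<pp> 0" using x pp_int by blast
      have xc: "x * c' \<in> \<pp> (l - 1)" using pp_mult_le[OF x c'(5), of "l - 1"] jk jl l2 by simp
      have xcc: "x * c' * c' \<in> \<pp> l" using pp_mult_le[OF xc c1, of l] l_pos by simp
      \<comment> \<open>\<open>e\<close>, \<open>e'\<close> and \<open>f\<close> solve the equation
        u(x) g = g h' in all entries except the lower left one, where the error e c lies in
        \<open>\<pp> l\<close>. They cost nothing in the character: e + e' and the
        \<open>\<omega>\<close>-multiple of the correction in f lie in
        \<open>\<pp> l\<close>.\<close>
      define e where "e = x * c' / a"
      define e' where "e' = - (x * c' * d / D)"
      define f where "f = (x * d - b * e') / a"
      have e: "e \<in> \<pp> (l - 1)" "e' \<in> \<pp> (l - 1)"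
        unfolding e_def e'_def pp_uminus using xc u D i by (auto intro!: pp_divide_unit pp_mult_right)
      have eI: "e \<in> \<pp> 0" "e' \<in> \<pp> 0" using e pp_int by blast+
      have f: "f \<in> \<pp> 0" unfolding f_def using xI i eI u by (intro pp_divide_unit) (auto simp: pp_closed)
      have fa: "a * f = x * d - b * e'" "a * e = x * c'" using u0 by (simp_all add: f_def e_def)
      have fc: "c' * f + d * e' = 0"
      proof -
        have "a * (c' * f + d * e') = c' * (a * f) + a * d * e'" by (simp add: algebra_simps)
        also have "\<dots> = c' * x * d + D * e'" unfolding fa D_def by (simp add: algebra_simps)
        also have "\<dots> = 0" using D0 by (simp add: e'_def)
        finally show ?thesis using u0 by simp
      qed
      let ?h' = "M (1 + e) f 0 (1 + e')"
      have H: "?h' \<in> H2" unfolding H2_def using e f by force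
      have gh: "gl (1 + e) f 0 (1 + e')"
        using e f by (intro gl_upper unit_near_1) auto
      have "e * c' \<in> \<pp> l" using xcc pp_divide_unit[OF _ u(1), of "x * c' * c'"] by (simp add: e_def)
      then have eq: "M 1 x 0 1 \<otimes>\<^bsub>GL\<^esub> M a b c' d = M a b c' d \<otimes>\<^bsub>GL\<^esub> ?h'"
        using fa fc unfolding GL_mult[OF gl_unip[OF xI] c'(1)] GL_mult[OF c'(1) gh] M_eq_iff
        by (simp add: algebra_simps pp_0 pp_uminus)
      have ee: "e + e' \<in> \<pp> l"
      proof -
        have "e + e' = x * c' * c' * (- b / (a * D))"
          using u0 D0 unfolding e_def e'_def by (simp add: field_simps) (simp add: D_def algebra_simps)
        moreover have "- b / (a * D) \<in> \<pp> 0" using i u D by (intro pp_divide_unit unit_mult) (auto simp: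
            pp_uminus)
        ultimately show ?thesis using xcc by (simp only: pp_mult_right)
      qed
      have ome: "\<omega> * (b * e' / a) \<in> \<pp> l"
        using i e u by (intro pp_mult_le[OF omega_pp(1), of _ "l - 1"] pp_divide_unit pp_mult_left) auto
      have "\<omega> * f + (r * e + r * e') - (\<omega> * x + P * z) = r * (e + e') - \<omega> * (b * e' / a)"
      proof -
        have "\<omega> * f - \<omega> * x = \<omega> * (x * (d - a) / a) - \<omega> * (b * e' / a)"
          using u0 by (simp add: f_def field_simps)
        also have "\<omega> * (x * (d - a) / a) = \<omega> ^ Suc (l - 2 - j + j) * z"
          using u0 unit_nonzero[OF j(1)] by (simp add: x_def j(2) power_add)
        also have "Suc (l - 2 - j + j) = l - 1" using jl l2 by simp
        finally show ?thesis by (simp add: algebra_simps)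
      qed
      also have "\<dots> \<in> \<pp> l" by (rule pp_diff[OF pp_mult_left[OF r ee] ome])
      finally have "H2_char r r ?h' = \<Psi> (\<omega> * x + P * z)"
        using r eI f by (simp add: H2_char_M pp_closed Psi_cong)
      also have "\<dots> = \<Psi> (\<omega> * x) * \<Psi> (P * z)" using xI z by (intro Psi_add) (simp_all add: pp_closed
          omega_pp P_pp)
      finally have "H2_char r r (M 1 x 0 1) \<noteq> H2_char r r ?h'"
        using z Psi_nonzero[of "\<omega> * x"] xI r by (simp add: H2_char_unip pp_closed omega_pp)
      then show ?thesis unfolding c'(2) using eq H unip_in_H2[OF xI] by blast
    qed
  qed
qed

lemma H2_flip:
  assumes "h \<in> H2" "r \<in> \<pp> 0"
  shows "gl2_flip h \<in> H2" "H2_char r r (gl2_flip h) = H2_char r r h"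
proof -
  obtain a b d where h: "h = M a b 0 d" "b \<in> \<pp> 0" "a - 1 \<in> \<pp> (l - 1)" "d - 1 \<in> \<pp> (l - 1)"
    using assms(1) by (auto simp: H2_def)
  then show "gl2_flip h \<in> H2" unfolding H2_def h(1) gl2_flip_M by blast
  have "a \<in> \<pp> 0" "d \<in> \<pp> 0" using unit_near_1 unit_int h by blast+
  then show "H2_char r r (gl2_flip h) = H2_char r r h" using h assms(2) by (simp add: gl2_flip_M
      H2_char_M add.commute)
qed

end

end

section \<open>Eigenspaces in irreducible representations\<close>

locale gl2_rep = trunc_data v \<omega> l \<psi> + irreducible_rep "GL2 (trunc_ring v l)" scale W \<rho>
  for v :: "'a::field \<Rightarrow> int" and \<omega> :: 'a and l :: nat and \<psi> :: "'a set \<Rightarrow> complex"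
    and scale :: "complex \<Rightarrow> 'v::ab_group_add \<Rightarrow> 'v" and W :: "'v set"
    and \<rho> :: "'a set mat2 \<Rightarrow> 'v \<Rightarrow> 'v"
begin

lemma act_mult:
  assumes "gl a b c d" "gl a' b' c' d'" "w \<in> W"
  shows "\<rho> (M a b c d) (\<rho> (M a' b' c' d') w)
    = \<rho> (M (a * a' + b * c') (a * b' + b * d') (c * a' + d * c') (c * b' + d * d')) w"
  using rep_mult[OF M_in_GL[OF assms(1)] M_in_GL[OF assms(2)] assms(3)] GL_mult[OF assms(1,2)] by simp

lemma finite_dim: "\<exists>B. finite B \<and> W \<subseteq> span B"
  by (rule finite_dimensional[OF finite_GL])

lemma common_eigenvector_rep:
  assumes S: "subspace S" "S \<subseteq> W" "S \<noteq> {0}"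
    and H: "H \<subseteq> carrier GL" and inv: "\<And>h w. h \<in> H \<Longrightarrow> w \<in> S \<Longrightarrow> \<rho> h w \<in> S"
    and comm: "\<And>h k w. h \<in> H \<Longrightarrow> k \<in> H \<Longrightarrow> w \<in> S \<Longrightarrow> \<rho> (h \<otimes>\<^bsub>GL\<^esub> k) w = \<rho> (k \<otimes>\<^bsub>GL\<^esub> h) w"
  obtains w where "w \<in> S" "w \<noteq> 0" "\<And>h. h \<in> H \<Longrightarrow> \<exists>c. \<rho> h w = scale c w"
proof -
  obtain B where B: "finite B" "W \<subseteq> span B" using finite_dim by auto
  have lin: "linear_op S T" if "T \<in> \<rho> ` H" for T
    using that inv rep_linear_op H S(2) unfolding linear_op_def by (auto simp: subset_iff)
  have "\<exists>w\<in>S. w \<noteq> 0 \<and> (\<forall>T\<in>\<rho> ` H. \<exists>c. T w = scale c w)"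
  proof (rule common_eigenvector[OF S(1) _ B(1) S(3) lin])
    show "S \<subseteq> span B" using S B by auto
    show "T (T' x) = T' (T x)" if "T \<in> \<rho> ` H" "T' \<in> \<rho> ` H" "x \<in> S" for T T' x
      using that comm H S(2) rep_mult by (auto simp: subset_iff)
  qed
  then show ?thesis using that by auto
qed

text \<open>Along a one-parameter family the eigenvalues form an additive character trivial on
  \<open>\<pp> l\<close>, so self-duality writes them as \<open>\<Psi> (a * b)\<close>; triviality
  on \<open>\<pp> n\<close> then puts a into \<open>\<pp> (l - n)\<close>. Used with n = l for U and
  n = 1 for the congruence subgroup.\<close>

lemma additive_eigenvalue:
  assumes m: "\<And>b. b \<in> \<pp> 0 \<Longrightarrow> m b \<in> carrier GL"
      "\<And>b b'. b \<in> \<pp> 0 \<Longrightarrow> b' \<in> \<pp> 0 \<Longrightarrow> m (b + b') = m b \<otimes>\<^bsub>GL\<^esub> m b'"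
    and w: "w \<in> W" "w \<noteq> 0" "\<And>b. b \<in> \<pp> 0 \<Longrightarrow> \<exists>c. \<rho> (m b) w = scale c w"
    and n: "n \<le> l" "\<And>b. b \<in> \<pp> n \<Longrightarrow> \<rho> (m b) w = w"
  shows "\<exists>a\<in>\<pp> (l - n). \<forall>b\<in>\<pp> 0. \<rho> (m b) w = scale (\<Psi> (a * b)) w"
proof -
  define \<phi> where "\<phi> b = (SOME c. \<rho> (m b) w = scale c w)" for b
  have \<phi>: "\<rho> (m b) w = scale (\<phi> b) w" if "b \<in> \<pp> 0" for b
    unfolding \<phi>_def by (rule someI_ex) (rule w(3)[OF that])
  have 1: "\<phi> b = c" if "b \<in> \<pp> 0" "\<rho> (m b) w = scale c w" for b c
    using \<phi>[OF that(1)] that(2) w(2) by simp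
  have "\<phi> (b + b') = \<phi> b * \<phi> b'" if "b \<in> \<pp> 0" "b' \<in> \<pp> 0" for b b'
    using that m w by (intro 1) (auto simp: pp_add rep_mult \<phi> rep_scale mult.commute)
  moreover have n1: "\<phi> b = 1" if "b \<in> \<pp> n" for b
    using n(2)[OF that] pp_int[OF that] by (intro 1) auto
  ultimately obtain a where a: "a \<in> \<pp> 0" "\<And>b. b \<in> \<pp> 0 \<Longrightarrow> \<phi> b = \<Psi> (a * b)"
    using additive_char[of \<phi>] pp_mono[OF _ n(1)] by blast
  have "a \<in> \<pp> (l - n)"
    using a n1 pp_int by (intro Psi_faithful n(1)) (metis)+
  then show ?thesis using a \<phi> by auto
qed

section \<open>The eigenspaces of U that compute the multiplicities\<close>

definition E :: "nat \<Rightarrow> 'v set" where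
  "E t = eigsp (unipotent R) (psi_unip v \<omega> \<psi> t l)"

abbreviation avgU :: "nat \<Rightarrow> 'v \<Rightarrow> 'v" where
  "avgU t \<equiv> avg (unipotent R) (psi_unip v \<omega> \<psi> t l)"

lemma E_iff: "w \<in> E t \<longleftrightarrow> w \<in> W \<and> (\<forall>b\<in>\<pp> 0. \<rho> (M 1 b 0 1) w = scale (\<Psi> (\<omega> ^ (l - t) * b)) w)"
  unfolding E_def eigsp_def unipotent_R by (auto simp: psi_unip_M)

lemma E_W: "w \<in> E t \<Longrightarrow> w \<in> W"
  by (simp add: E_iff)

lemma subspace_E: "subspace (E t)"
  unfolding E_def by (rule subspace_eigsp) (use char_on_simps(1)[OF char_on_unipotent] in auto)

lemma dim_Hom_V_eq: "dim_Hom_V v \<omega> \<psi> t l scale W \<rho> = dim (E t)"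
  unfolding dim_Hom_V_def Let_def E_def by (rule dim_Hom_Ind[OF finite_GL char_on_unipotent])

lemma unip_eigvec:
  assumes S: "subspace S" "S \<subseteq> W" "S \<noteq> {0}"
    and inv: "\<And>b w. b \<in> \<pp> 0 \<Longrightarrow> w \<in> S \<Longrightarrow> \<rho> (M 1 b 0 1) w \<in> S"
  obtains w a where "w \<in> S" "w \<noteq> 0" "a \<in> \<pp> 0" "\<And>b. b \<in> \<pp> 0 \<Longrightarrow> \<rho> (M 1 b 0 1) w = scale (\<Psi> (a * b)) w"
proof -
  have H: "unipotent R \<subseteq> carrier GL" using char_on_simps(1)[OF char_on_unipotent] by blast
  have c: "h \<otimes>\<^bsub>GL\<^esub> k = k \<otimes>\<^bsub>GL\<^esub> h" if "h \<in> unipotent R" "k \<in> unipotent R" for h k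
    using that by (auto simp: unipotent_R GL_mult gl_unip add.commute)
  obtain w where w: "w \<in> S" "w \<noteq> 0" "\<And>h. h \<in> unipotent R \<Longrightarrow> \<exists>c. \<rho> h w = scale c w"
    by (rule common_eigenvector_rep[OF S H]) (use inv c in \<open>auto simp: unipotent_R\<close>)
  have "\<exists>a\<in>\<pp> (l - l). \<forall>b\<in>\<pp> 0. \<rho> (M 1 b 0 1) w = scale (\<Psi> (a * b)) w"
  proof (rule additive_eigenvalue)
    show "M 1 (b + b') 0 1 = M 1 b 0 1 \<otimes>\<^bsub>GL\<^esub> M 1 b' 0 1" if "b \<in> \<pp> 0" "b' \<in> \<pp> 0" for b b'
      using that by (simp add: GL_mult gl_unip add.commute)
    show "\<rho> (M 1 b 0 1) w = w" if "b \<in> \<pp> l" for b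
    proof -
      have "M 1 b 0 1 = \<one>\<^bsub>GL\<^esub>" using that by (simp add: GL_one M_eq_iff pp_0)
      then show ?thesis using rep_one w S by auto
    qed
    show "\<exists>c. \<rho> (M 1 b 0 1) w = scale c w" if "b \<in> \<pp> 0" for b
      using w(3) that by (auto simp: unipotent_R)
  qed (use w S in \<open>auto intro: M_in_GL gl_unip\<close>)
  then show ?thesis using that w by auto
qed

section \<open>Eigenvectors of the Borel subgroup and the big Bruhat cell\<close>

definition borel_eig :: "'v \<Rightarrow> bool" where
  "borel_eig w \<longleftrightarrow> w \<in> W \<and> w \<noteq> 0 \<and> (\<forall>b\<in>\<pp> 0. \<rho> (M 1 b 0 1) w = w) \<and>
     (\<forall>a d. unit a \<longrightarrow> unit d \<longrightarrow> (\<exists>c. \<rho> (M a 0 0 d) w = scale c w))"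

lemma borel_eig_exists:
  assumes S: "subspace S" "S \<subseteq> W" "S \<noteq> {0}"
    and T: "\<And>a d w. unit a \<Longrightarrow> unit d \<Longrightarrow> w \<in> S \<Longrightarrow> \<rho> (M a 0 0 d) w \<in> S"
    and U: "\<And>b w. b \<in> \<pp> 0 \<Longrightarrow> w \<in> S \<Longrightarrow> \<rho> (M 1 b 0 1) w = w"
  obtains w where "w \<in> S" "borel_eig w"
proof -
  define H where "H = {M a 0 0 d | a d. unit a \<and> unit d}"
  have H: "H \<subseteq> carrier GL" unfolding H_def by (auto intro!: M_in_GL gl_upper pp_0)
  have c: "h \<otimes>\<^bsub>GL\<^esub> k = k \<otimes>\<^bsub>GL\<^esub> h" if "h \<in> H" "k \<in> H" for h k
    using that unfolding H_def by (auto simp: GL_mult gl_upper pp_0 mult.commute)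
  obtain w where w: "w \<in> S" "w \<noteq> 0" "\<And>h. h \<in> H \<Longrightarrow> \<exists>c. \<rho> h w = scale c w"
    by (rule common_eigenvector_rep[OF S H]) (use T c in \<open>auto simp: H_def\<close>)
  have "borel_eig w"
    unfolding borel_eig_def
  proof (intro conjI ballI allI impI)
    fix a d assume "unit a" "unit d"
    then have "M a 0 0 d \<in> H" unfolding H_def by blast
    then show "\<exists>c. \<rho> (M a 0 0 d) w = scale c w" by (rule w(3))
  qed (use w S(2) U in auto)
  then show ?thesis using that w by auto
qed

lemma borel_eigD:
  assumes w: "borel_eig w" and g: "unit a" "b \<in> \<pp> 0" "unit d"
  shows "\<exists>c. \<rho> (M a b 0 d) w = scale c w"
proof -
  have "b / a \<in> \<pp> 0" using g by (intro pp_divide_unit)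
  then have "\<rho> (M a 0 0 d) (\<rho> (M 1 (b / a) 0 1) w) = \<rho> (M a b 0 d) w"
    using w g unit_nonzero[OF g(1)] by (subst act_mult) (auto simp: gl_upper gl_unip pp_0 borel_eig_def)
  moreover have "\<rho> (M 1 (b / a) 0 1) w = w" using w \<open>b / a \<in> \<pp> 0\<close> by (simp add: borel_eig_def)
  moreover obtain c where "\<rho> (M a 0 0 d) w = scale c w" using w g unfolding borel_eig_def by blast
  ultimately show ?thesis by (intro exI[of _ c]) simp
qed

lemma avgU_in: "w \<in> W \<Longrightarrow> avgU t w \<in> E t"
  unfolding E_def by (rule avg_in_eigsp[OF char_on_unipotent])

lemma avgU_unip: "b \<in> \<pp> 0 \<Longrightarrow> w \<in> W \<Longrightarrow> avgU t (\<rho> (M 1 b 0 1) w) = scale (\<Psi> (\<omega> ^ (l - t) * b)) (avgU t w)"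
  using avg_right[OF char_on_unipotent, of "M 1 b 0 1" w t] by (auto simp: unipotent_R psi_unip_M)

lemma avgU_scale: "w \<in> W \<Longrightarrow> avgU t (scale c w) = scale c (avgU t w)"
  using avg_linear_op[OF char_on_unipotent] by (simp add: linear_op_def)

text \<open>For a unit c the matrix factors as the upper unipotent element with entry a / c, the
  Weyl element, and the upper triangular matrix with rows (c, d) and (0, e), where e is minus the
  determinant over c. The last factor acts on w by a scalar.\<close>

lemma big_cell:
  assumes w: "borel_eig w" and g: "gl a b c d" "unit c"
  shows "\<exists>k x. x \<in> \<pp> 0 \<and> \<rho> (M a b c d) w = scale k (\<rho> (M 1 x 0 1) (\<rho> (M 0 1 1 0) w))"
proof -
  note i = gl_int[OF g(1)]
  have c0: "c \<noteq> 0" using unit_nonzero g by blast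
  define e where "e = - ((a * d - b * c) / c)"
  have e: "unit e" unfolding e_def using g by (simp add: unit_uminus unit_divide gl_def)
  have x: "a / c \<in> \<pp> 0" using i g by (intro pp_divide_unit) auto
  have be: "b = e + a / c * d" using c0 by (simp add: e_def field_simps)
  have wW: "w \<in> W" using w by (simp add: borel_eig_def)
  obtain k where k: "\<rho> (M c d 0 e) w = scale k w" using borel_eigD[OF w g(2) _ e] i by blast
  have gs: "gl 0 1 1 0" using gl_anti pp_0 by blast
  have gb: "gl c d 0 e" using gl_upper g e i by blast
  have gm: "gl 0 e c d" using gl_mult[OF gs gb] by simp
  have "\<rho> (M a b c d) w = \<rho> (M 1 (a / c) 0 1) (\<rho> (M 0 e c d) w)"
    using act_mult[OF gl_unip[OF x] gm wW] c0 be by simp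
  also have "\<rho> (M 0 e c d) w = \<rho> (M 0 1 1 0) (\<rho> (M c d 0 e) w)"
    using act_mult[OF gs gb wW] by simp
  also have "\<rho> (M 1 (a / c) 0 1) (\<rho> (M 0 1 1 0) (\<rho> (M c d 0 e) w))
      = scale k (\<rho> (M 1 (a / c) 0 1) (\<rho> (M 0 1 1 0) w))"
    unfolding k using wW gs x by (simp add: rep_scale M_in_GL gl_unip rep_closed)
  finally show ?thesis using x by blast
qed

text \<open>The unipotent factor on the left is absorbed by the average as a scalar, so the whole
  big cell contributes one line to \<open>E t\<close>.\<close>

lemma avgU_big_cell:
  assumes w: "borel_eig w" and g: "gl a b c d" "unit c"
  shows "avgU t (\<rho> (M a b c d) w) \<in> span {avgU t (\<rho> (M 0 1 1 0) w)}"
proof -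
  obtain k x where k: "x \<in> \<pp> 0" "\<rho> (M a b c d) w = scale k (\<rho> (M 1 x 0 1) (\<rho> (M 0 1 1 0) w))"
    using big_cell[OF assms] by blast
  have sw: "\<rho> (M 0 1 1 0) w \<in> W" using w by (auto intro!: rep_closed M_in_GL gl_anti pp_0 simp:
      borel_eig_def)
  have "\<rho> (M 1 x 0 1) (\<rho> (M 0 1 1 0) w) \<in> W" by (rule rep_closed[OF M_in_GL[OF gl_unip[OF k(1)]] sw])
  then have "avgU t (\<rho> (M a b c d) w) = scale k (scale (\<Psi> (\<omega> ^ (l - t) * x)) (avgU t (\<rho> (M 0 1 1 0) w)))"
    using k(1) sw unfolding k(2) by (simp only: avgU_scale avgU_unip)
  then show ?thesis by (simp add: span_scale span_base)
qed

lemma E_top_line: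
  assumes w: "w \<in> E l" "w \<noteq> 0"
  shows "E l \<subseteq> span {w}"
  unfolding E_def
proof (rule gelfand_trick[OF finite_GL char_on_unipotent gl2_flip_closed gl2_flip_flip gl2_flip_anti _ _
    _ w[unfolded E_def]])
  show "gl2_flip h \<in> unipotent R" "psi_unip v \<omega> \<psi> l l (gl2_flip h) = psi_unip v \<omega> \<psi> l l h"
    if "h \<in> unipotent R" for h
    using that by (auto simp: unipotent_R gl2_flip_M)
  fix g assume "g \<in> carrier GL"
  then obtain a b c d where g: "gl a b c d" "g = M a b c d" by (auto simp: carrier_GL)
  have U: "M 1 x 0 1 \<in> unipotent R" "psi_unip v \<omega> \<psi> l l (M 1 x 0 1) = \<Psi> x" if "x \<in> \<pp> 0" for x
    using that by (auto simp: unipotent_R psi_unip_M)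
  have 1: "\<Psi> x * \<Psi> (- x) = 1" if "x \<in> \<pp> 0" for x
    using Psi_add[of x "- x"] that by (simp add: pp_uminus Psi_0)
  show "(\<exists>h\<in>unipotent R. \<exists>h'\<in>unipotent R. gl2_flip g = h \<otimes>\<^bsub>GL\<^esub> g \<otimes>\<^bsub>GL\<^esub> h' \<and>
      psi_unip v \<omega> \<psi> l l h * psi_unip v \<omega> \<psi> l l h' = 1) \<or>
    (\<exists>h\<in>unipotent R. \<exists>h'\<in>unipotent R. h \<otimes>\<^bsub>GL\<^esub> g = g \<otimes>\<^bsub>GL\<^esub> h' \<and>
      psi_unip v \<omega> \<psi> l l h \<noteq> psi_unip v \<omega> \<psi> l l h')"
    using gelfand_criterion_unipotent[OF g(1)]
  proof (elim disjE bexE conjE)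
    fix x assume x: "x \<in> \<pp> 0" "gl2_flip (M a b c d) = M 1 x 0 1 \<otimes>\<^bsub>GL\<^esub> M a b c d \<otimes>\<^bsub>GL\<^esub> M 1 (- x) 0 1"
    then show ?thesis unfolding g(2)
      using U[of x] U[of "- x"] 1[of x] pp_uminus by (intro disjI1 bexI[of _ "M 1 x 0 1"] bexI[of _ "M 1
          (- x) 0 1"]) auto
  next
    fix x y assume "x \<in> \<pp> 0" "y \<in> \<pp> 0" "M 1 x 0 1 \<otimes>\<^bsub>GL\<^esub> M a b c d = M a b c d \<otimes>\<^bsub>GL\<^esub> M 1 y 0 1" "\<Psi> x \<noteq> \<Psi> y"
    then show ?thesis unfolding g(2)
      using U[of x] U[of y] by (intro disjI2 bexI[of _ "M 1 x 0 1"] bexI[of _ "M 1 y 0 1"]) auto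
  qed
qed

context
  assumes l2: "l \<ge> 2"
begin

section \<open>Eigenvectors of the last congruence subgroup\<close>

lemmas K_simps = Kel_in[OF l2] Kel_mult[OF l2] Kel_cong[OF l2] Kel_0[OF l2]

lemma Kel_eigenvalue:
  assumes w: "w \<in> W" "w \<noteq> 0"
    and i: "i11 \<in> \<pp> 0" "i12 \<in> \<pp> 0" "i21 \<in> \<pp> 0" "i22 \<in> \<pp> 0"
    and e: "\<And>b. b \<in> \<pp> 0 \<Longrightarrow> \<exists>c. \<rho> (Kel (i11 * b) (i12 * b) (i21 * b) (i22 * b)) w = scale c w"
  shows "\<exists>x\<in>\<pp> 0. \<forall>b\<in>\<pp> 0. \<rho> (Kel (i11 * b) (i12 * b) (i21 * b) (i22 * b)) w = scale (\<Psi> (P * (x * b))) w"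
proof -
  have "\<exists>a\<in>\<pp> (l - 1). \<forall>b\<in>\<pp> 0. \<rho> (Kel (i11 * b) (i12 * b) (i21 * b) (i22 * b)) w = scale (\<Psi> (a * b)) w"
  proof (rule additive_eigenvalue[OF _ _ w e l_pos])
    show "Kel (i11 * b) (i12 * b) (i21 * b) (i22 * b) \<in> carrier GL" if "b \<in> \<pp> 0" for b
      using that i by (intro K_simps(1) pp_mult_left)
    show "Kel (i11 * (b + b')) (i12 * (b + b')) (i21 * (b + b')) (i22 * (b + b')) =
        Kel (i11 * b) (i12 * b) (i21 * b) (i22 * b) \<otimes>\<^bsub>GL\<^esub> Kel (i11 * b') (i12 * b') (i21 * b') (i22 * b')"
      if "b \<in> \<pp> 0" "b' \<in> \<pp> 0" for b b'
      using that i by (subst K_simps(2)) (simp_all add: pp_mult_left distrib_left)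
    show "\<rho> (Kel (i11 * b) (i12 * b) (i21 * b) (i22 * b)) w = w" if "b \<in> \<pp> 1" for b
    proof -
      have "Kel (i11 * b) (i12 * b) (i21 * b) (i22 * b) = \<one>\<^bsub>GL\<^esub>"
        unfolding K_simps(4)[symmetric] using that i by (intro K_simps(3)) (simp_all add: pp_mult_left)
      then show ?thesis using rep_one w by simp
    qed
  qed
  then obtain a where a: "a \<in> \<pp> (l - 1)"
    "\<And>b. b \<in> \<pp> 0 \<Longrightarrow> \<rho> (Kel (i11 * b) (i12 * b) (i21 * b) (i22 * b)) w = scale (\<Psi> (a * b)) w" by blast
  have "a / P \<in> \<pp> 0" using pp_divide[of a 0 "l - 1"] a(1) by simp
  moreover have "P * (a / P * b) = a * b" for b using val_uniformiser(1) by simp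
  ultimately show ?thesis using a(2) by (intro bexI[of _ "a / P"]) auto
qed

text \<open>\<open>w\<close> is an eigenvector of \<open>K\<^sup>l\<^sup>-\<^sup>1\<close> for \<open>\<psi>\<^sub>x\<close>: the argument of \<open>\<Psi>\<close> is the trace of \<open>x y\<close>, where \<open>y\<close> has
  rows \<open>(a, b)\<close> and \<open>(c, d)\<close>.\<close>

definition Kchar :: "'a \<Rightarrow> 'a \<Rightarrow> 'a \<Rightarrow> 'a \<Rightarrow> 'v \<Rightarrow> bool" where
  "Kchar x11 x12 x21 x22 w \<longleftrightarrow> (\<forall>a\<in>\<pp> 0. \<forall>b\<in>\<pp> 0. \<forall>c\<in>\<pp> 0. \<forall>d\<in>\<pp> 0.
     \<rho> (Kel a b c d) w = scale (\<Psi> (P * (x11 * a + x12 * c + x21 * b + x22 * d))) w)"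

text \<open>The last congruence subgroup is abelian, so it has a common eigenvector in S; the
  eigenvalues along the four coordinate directions give the entries of x. The trace pairs x12 with
  the lower left coordinate and x21 with the upper right one.\<close>

lemma Kchar_exists:
  assumes S: "subspace S" "S \<subseteq> W" "S \<noteq> {0}"
    and inv: "\<And>a b c d w. a \<in> \<pp> 0 \<Longrightarrow> b \<in> \<pp> 0 \<Longrightarrow> c \<in> \<pp> 0 \<Longrightarrow> d \<in> \<pp> 0 \<Longrightarrow> w \<in> S \<Longrightarrow> \<rho> (Kel a b c d) w \<in> S"
  obtains w x11 x12 x21 x22 where "w \<in> S" "w \<noteq> 0" "x11 \<in> \<pp> 0" "x12 \<in> \<pp> 0" "x21 \<in> \<pp> 0" "x22 \<in> \<pp> 0"
    "Kchar x11 x12 x21 x22 w"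
proof -
  define H where "H = {Kel a b c d | a b c d. a \<in> \<pp> 0 \<and> b \<in> \<pp> 0 \<and> c \<in> \<pp> 0 \<and> d \<in> \<pp> 0}"
  have H: "H \<subseteq> carrier GL" unfolding H_def by (auto intro: K_simps(1))
  have c: "h \<otimes>\<^bsub>GL\<^esub> k = k \<otimes>\<^bsub>GL\<^esub> h" if "h \<in> H" "k \<in> H" for h k
    using that unfolding H_def by (auto simp: K_simps(2) add.commute)
  obtain w where w: "w \<in> S" "w \<noteq> 0" "\<And>h. h \<in> H \<Longrightarrow> \<exists>c. \<rho> h w = scale c w"
    by (rule common_eigenvector_rep[OF S H]) (use inv c in \<open>auto simp: H_def\<close>)
  have wW: "w \<in> W" using w S by auto
  have e: "\<exists>c. \<rho> (Kel a b c' d) w = scale c w" if "a \<in> \<pp> 0" "b \<in> \<pp> 0" "c' \<in> \<pp> 0" "d \<in> \<pp> 0" for a b c' d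
    using w(3) that unfolding H_def by blast
  note ev = Kel_eigenvalue[OF wW w(2)]
  obtain x11 where 1: "x11 \<in> \<pp> 0" "\<And>b. b \<in> \<pp> 0 \<Longrightarrow> \<rho> (Kel b 0 0 0) w = scale (\<Psi> (P * (x11 * b))) w"
    using ev[of 1 0 0 0] e pp_0 pp_1 by auto
  obtain x21 where 2: "x21 \<in> \<pp> 0" "\<And>b. b \<in> \<pp> 0 \<Longrightarrow> \<rho> (Kel 0 b 0 0) w = scale (\<Psi> (P * (x21 * b))) w"
    using ev[of 0 1 0 0] e pp_0 pp_1 by auto
  obtain x12 where 3: "x12 \<in> \<pp> 0" "\<And>b. b \<in> \<pp> 0 \<Longrightarrow> \<rho> (Kel 0 0 b 0) w = scale (\<Psi> (P * (x12 * b))) w"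
    using ev[of 0 0 1 0] e pp_0 pp_1 by auto
  obtain x22 where 4: "x22 \<in> \<pp> 0" "\<And>b. b \<in> \<pp> 0 \<Longrightarrow> \<rho> (Kel 0 0 0 b) w = scale (\<Psi> (P * (x22 * b))) w"
    using ev[of 0 0 0 1] e pp_0 pp_1 by auto
  have "Kchar x11 x12 x21 x22 w"
    unfolding Kchar_def
  proof (intro ballI)
    fix a b c d assume i: "a \<in> \<pp> 0" "b \<in> \<pp> 0" "c \<in> \<pp> 0" "d \<in> \<pp> 0"
    have "Kel a b c d = Kel a 0 0 0 \<otimes>\<^bsub>GL\<^esub> (Kel 0 b 0 0 \<otimes>\<^bsub>GL\<^esub> (Kel 0 0 c 0 \<otimes>\<^bsub>GL\<^esub> Kel 0 0 0 d))"
      using i by (simp add: K_simps pp_0)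
    then have "\<rho> (Kel a b c d) w = \<rho> (Kel a 0 0 0) (\<rho> (Kel 0 b 0 0) (\<rho> (Kel 0 0 c 0) (\<rho> (Kel 0 0 0 d) w)))"
      using i wW by (simp only: rep_mult K_simps(1) pp_0 rep_closed m_closed)
    also have "\<dots> = scale (\<Psi> (P * (x22 * d)) * \<Psi> (P * (x12 * c)) * \<Psi> (P * (x21 * b)) * \<Psi> (P * (x11 * a))) w"
      using i wW by (simp add: 1 2 3 4 rep_scale K_simps(1) pp_0 rep_sub mult_ac)
    also have "\<Psi> (P * (x22 * d)) * \<Psi> (P * (x12 * c)) * \<Psi> (P * (x21 * b)) * \<Psi> (P * (x11 * a))
        = \<Psi> (P * (x22 * d) + P * (x12 * c) + P * (x21 * b) + P * (x11 * a))"
      using i 1 2 3 4 by (simp add: Psi_add pp_closed P_pp)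
    finally show "\<rho> (Kel a b c d) w = scale (\<Psi> (P * (x11 * a + x12 * c + x21 * b + x22 * d))) w"
      by (simp add: algebra_simps)
  qed
  then show ?thesis using that[of w x11 x12 x21 x22] w 1 2 3 4 by blast
qed

section \<open>The spaces \<open>Wt r s\<close>\<close>

definition Wt :: "'a \<Rightarrow> 'a \<Rightarrow> 'v set" where
  "Wt r s = {w\<in>W. \<forall>\<alpha>\<in>\<pp> 0. \<forall>\<beta>\<in>\<pp> 0. \<forall>\<delta>\<in>\<pp> 0. \<rho> (Kel \<alpha> \<beta> 0 \<delta>) w = scale (\<Psi> (P * (r * \<alpha> + s * \<delta>))) w}"

lemma Wt_W: "w \<in> Wt r s \<Longrightarrow> w \<in> W"
  by (simp add: Wt_def)

lemma WtD: "w \<in> Wt r s \<Longrightarrow> \<alpha> \<in> \<pp> 0 \<Longrightarrow> \<beta> \<in> \<pp> 0 \<Longrightarrow> \<delta> \<in> \<pp> 0 \<Longrightarrow>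
    \<rho> (Kel \<alpha> \<beta> 0 \<delta>) w = scale (\<Psi> (P * (r * \<alpha> + s * \<delta>))) w"
  by (simp add: Wt_def)

lemma subspace_Wt: "subspace (Wt r s)"
  unfolding Wt_def
  by (intro subspaceI)
    (auto simp: rep_sub rep_zero rep_add rep_scale K_simps(1) pp_0 scale_right_distrib mult.commute)

text \<open>\<open>Wt r s\<close> leaves the upper right entry of x open, and this is what makes it
  stable. Modulo the maximal ideal the matrix is upper triangular, so conjugation by it keeps
  \<alpha> and \<delta> and changes only \<beta>, on which the character does not depend.
  \<open>\<beta>'\<close> solves the equation of the upper right entries.\<close>

lemma Wt_iwahori:
  assumes w: "w \<in> Wt r s" and g: "gl a b c d" "c \<in> \<pp> 1"
  shows "\<rho> (M a b c d) w \<in> Wt r s"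
  unfolding Wt_def
proof (intro CollectI conjI ballI)
  note i = gl_int[OF g(1)]
  have u: "unit a" using gl_unit_cases[OF g] by simp
  show "\<rho> (M a b c d) w \<in> W" using w g by (intro rep_closed M_in_GL) (simp_all add: Wt_W)
  fix \<alpha> \<beta> \<delta> assume a: "\<alpha> \<in> \<pp> 0" "\<beta> \<in> \<pp> 0" "\<delta> \<in> \<pp> 0"
  define \<beta>' where "\<beta>' = (\<alpha> * b + \<beta> * d - b * \<delta>) / a"
  have b': "\<beta>' \<in> \<pp> 0" unfolding \<beta>'_def using a i u by (intro pp_divide_unit) (auto simp: pp_closed)
  have "a * \<beta>' = \<alpha> * b + \<beta> * d - b * \<delta>" using unit_nonzero[OF u] by (simp add: \<beta>'_def)
  then have "Kel \<alpha> \<beta> 0 \<delta> \<otimes>\<^bsub>GL\<^esub> M a b c d = M a b c d \<otimes>\<^bsub>GL\<^esub> Kel \<alpha> \<beta>' 0 \<delta>"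
    using a b' i g by (intro Kel_conj[OF l2 g(1)]) (auto simp: pp_closed mult.commute)
  then have "\<rho> (Kel \<alpha> \<beta> 0 \<delta>) (\<rho> (M a b c d) w) = \<rho> (M a b c d) (\<rho> (Kel \<alpha> \<beta>' 0 \<delta>) w)"
    using a b' g w by (simp add: rep_mult[symmetric] K_simps(1) M_in_GL pp_0 Wt_W)
  also have "\<dots> = scale (\<Psi> (P * (r * \<alpha> + s * \<delta>))) (\<rho> (M a b c d) w)"
    using a b' g w by (simp add: WtD rep_scale M_in_GL Wt_W)
  finally show "\<rho> (Kel \<alpha> \<beta> 0 \<delta>) (\<rho> (M a b c d) w) = scale (\<Psi> (P * (r * \<alpha> + s * \<delta>))) (\<rho> (M a b c d) w)" .
qed

lemma Wt_cong:
  assumes "r - r' \<in> \<pp> 1" "s - s' \<in> \<pp> 1"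
  shows "Wt r s = Wt r' s'"
proof -
  have "\<Psi> (P * (r * \<alpha> + s * \<delta>)) = \<Psi> (P * (r' * \<alpha> + s' * \<delta>))" if "\<alpha> \<in> \<pp> 0" "\<delta> \<in> \<pp> 0" for \<alpha> \<delta>
  proof (rule Psi_P_cong)
    have "(r - r') * \<alpha> + (s - s') * \<delta> \<in> \<pp> 1" using assms that by (simp add: pp_closed)
    then show "r * \<alpha> + s * \<delta> - (r' * \<alpha> + s' * \<delta>) \<in> \<pp> 1" by (simp add: algebra_simps)
  qed
  then show ?thesis unfolding Wt_def by auto
qed

lemma Psi_P_faithful:
  assumes "x \<in> \<pp> 0" "\<And>z. z \<in> \<pp> 0 \<Longrightarrow> \<Psi> (P * (x * z)) = 1"
  shows "x \<in> \<pp> 1"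
proof -
  have "P * x \<in> \<pp> (l - 0)"
    using assms by (intro Psi_faithful) (auto simp: pp_closed P_pp mult.assoc)
  then show ?thesis by (simp add: P_mult)
qed

lemma Psi_P_faithful2:
  assumes "x \<in> \<pp> 0" "y \<in> \<pp> 0" "\<And>z. z \<in> \<pp> 0 \<Longrightarrow> \<Psi> (P * (x * z)) = \<Psi> (P * (y * z))"
  shows "x - y \<in> \<pp> 1"
proof (rule Psi_P_faithful)
  show "\<Psi> (P * ((x - y) * z)) = 1" if "z \<in> \<pp> 0" for z
    using assms that Psi_nonzero[of "P * (y * z)"]
    by (simp add: left_diff_distrib right_diff_distrib Psi_diff pp_closed P_pp)
qed (use assms in \<open>simp add: pp_closed\<close>)

lemma Kchar_Wt:
  assumes "Kchar x11 x12 x21 x22 w" "w \<in> W" "x21 \<in> \<pp> 1" "x11 \<in> \<pp> 0" "x22 \<in> \<pp> 0"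
  shows "w \<in> Wt x11 x22"
  unfolding Wt_def
proof (intro CollectI conjI ballI)
  fix \<alpha> \<beta> \<delta> assume a: "\<alpha> \<in> \<pp> 0" "\<beta> \<in> \<pp> 0" "\<delta> \<in> \<pp> 0"
  have "\<Psi> (P * (x11 * \<alpha> + x12 * 0 + x21 * \<beta> + x22 * \<delta>)) = \<Psi> (P * (x11 * \<alpha> + x22 * \<delta>))"
    by (rule Psi_P_cong) (use a assms in \<open>simp add: pp_closed\<close>)
  then show "\<rho> (Kel \<alpha> \<beta> 0 \<delta>) w = scale (\<Psi> (P * (x11 * \<alpha> + x22 * \<delta>))) w"
    using assms(1) a pp_0[of 0] unfolding Kchar_def by (metis)
qed (use assms in simp)

lemma Wt_Kchar:
  assumes "Kchar x11 x12 x21 x22 w" "w \<in> Wt r s" "w \<noteq> 0" "x11 \<in> \<pp> 0" "x12 \<in> \<pp> 0" "x21 \<in> \<pp> 0" "x22 \<in> \<pp> 0"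
      "r \<in> \<pp> 0" "s \<in> \<pp> 0"
  shows "x21 \<in> \<pp> 1" "x11 - r \<in> \<pp> 1" "x22 - s \<in> \<pp> 1"
proof -
  have e: "\<Psi> (P * (x11 * \<alpha> + x21 * \<beta> + x22 * \<delta>)) = \<Psi> (P * (r * \<alpha> + s * \<delta>))"
    if "\<alpha> \<in> \<pp> 0" "\<beta> \<in> \<pp> 0" "\<delta> \<in> \<pp> 0" for \<alpha> \<beta> \<delta>
  proof -
    have "scale (\<Psi> (P * (x11 * \<alpha> + x12 * 0 + x21 * \<beta> + x22 * \<delta>))) w = scale (\<Psi> (P * (r * \<alpha> + s * \<delta>))) w"
      using assms(1) WtD[OF assms(2) that] that pp_0[of 0] unfolding Kchar_def by metis
    then show ?thesis using assms(3) by simp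
  qed
  show "x21 \<in> \<pp> 1" using e[of 0 _ 0] assms by (intro Psi_P_faithful) (auto simp: pp_0 Psi_0)
  show "x11 - r \<in> \<pp> 1" using e[of _ 0 0] assms by (intro Psi_P_faithful2) (auto simp: pp_0)
  show "x22 - s \<in> \<pp> 1" using e[of 0 0] assms by (intro Psi_P_faithful2) (auto simp: pp_0)
qed

lemma Wt_unique:
  assumes "w \<in> Wt r s" "w \<in> Wt r' s'" "w \<noteq> 0" "r \<in> \<pp> 0" "s \<in> \<pp> 0" "r' \<in> \<pp> 0" "s' \<in> \<pp> 0"
  shows "r - r' \<in> \<pp> 1" "s - s' \<in> \<pp> 1"
proof -
  have e: "\<Psi> (P * (r * \<alpha> + s * \<delta>)) = \<Psi> (P * (r' * \<alpha> + s' * \<delta>))" if "\<alpha> \<in> \<pp> 0" "\<delta> \<in> \<pp> 0" for \<alpha> \<delta>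
    using WtD[OF assms(1) that(1) pp_0 that(2)] WtD[OF assms(2) that(1) pp_0 that(2)] assms(3) by simp
  show "r - r' \<in> \<pp> 1" using e[of _ 0] assms by (intro Psi_P_faithful2) (auto simp: pp_0)
  show "s - s' \<in> \<pp> 1" using e[of 0] assms by (intro Psi_P_faithful2) (auto simp: pp_0)
qed

text \<open>Conjugating \<open>x\<close> by the matrix with rows \<open>(0, 1)\<close> and \<open>(1, y)\<close> makes it upper triangular.\<close>

lemma Kchar_swap:
  assumes k: "Kchar x11 x12 x21 x22 w" "w \<in> W"
    and x: "x11 \<in> \<pp> 0" "x12 \<in> \<pp> 0" "x21 \<in> \<pp> 0" "x22 \<in> \<pp> 0" "y \<in> \<pp> 0"
    and e: "x12 - x11 * y - x21 * y * y + x22 * y \<in> \<pp> 1"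
  shows "\<rho> (M 0 1 1 y) w \<in> Wt (x22 - x21 * y) (x11 + x21 * y)"
  unfolding Wt_def
proof (intro CollectI conjI ballI)
  note g = gl_anti[OF x(5)]
  show "\<rho> (M 0 1 1 y) w \<in> W" using k g by (intro rep_closed M_in_GL)
  fix \<alpha> \<beta> \<delta> assume a: "\<alpha> \<in> \<pp> 0" "\<beta> \<in> \<pp> 0" "\<delta> \<in> \<pp> 0"
  let ?k = "Kel (\<delta> - y * \<beta>) (\<delta> * y - y * \<alpha> - \<beta> * y * y) \<beta> (\<alpha> + \<beta> * y)"
  have i: "\<delta> - y * \<beta> \<in> \<pp> 0" "\<delta> * y - y * \<alpha> - \<beta> * y * y \<in> \<pp> 0" "\<alpha> + \<beta> * y \<in> \<pp> 0"
    using a x by (simp_all add: pp_closed)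
  have "Kel \<alpha> \<beta> 0 \<delta> \<otimes>\<^bsub>GL\<^esub> M 0 1 1 y = M 0 1 1 y \<otimes>\<^bsub>GL\<^esub> ?k"
    using a i x by (intro Kel_conj[OF l2 g]) (auto simp: pp_0 algebra_simps)
  then have "\<rho> (Kel \<alpha> \<beta> 0 \<delta>) (\<rho> (M 0 1 1 y) w) = \<rho> (M 0 1 1 y) (\<rho> ?k w)"
    using a i g k by (simp add: rep_mult[symmetric] K_simps(1) M_in_GL pp_0)
  also have "\<rho> ?k w = scale (\<Psi> (P * (x11 * (\<delta> - y * \<beta>) + x12 * \<beta> + x21 * (\<delta> * y - y * \<alpha> - \<beta> * y * y) +
      x22 * (\<alpha> + \<beta> * y)))) w"
    using k(1) a i unfolding Kchar_def by blast
  also have "\<Psi> (P * (x11 * (\<delta> - y * \<beta>) + x12 * \<beta> + x21 * (\<delta> * y - y * \<alpha> - \<beta> * y * y) + x22 * (\<alpha> + \<beta> * y)))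
      = \<Psi> (P * ((x22 - x21 * y) * \<alpha> + (x11 + x21 * y) * \<delta>))"
  proof (rule Psi_P_cong)
    \<comment> \<open>\<open>e\<close> concerns the coefficient of \<beta>, which is the lower left
      entry of the conjugated x and has to vanish.\<close>
    have "(x12 - x11 * y - x21 * y * y + x22 * y) * \<beta> \<in> \<pp> 1" using e a by (simp add: pp_closed)
    then show "x11 * (\<delta> - y * \<beta>) + x12 * \<beta> + x21 * (\<delta> * y - y * \<alpha> - \<beta> * y * y) + x22 * (\<alpha> + \<beta> * y)
        - ((x22 - x21 * y) * \<alpha> + (x11 + x21 * y) * \<delta>) \<in> \<pp> 1" by (simp add: algebra_simps)
  qed
  finally show "\<rho> (Kel \<alpha> \<beta> 0 \<delta>) (\<rho> (M 0 1 1 y) w) =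
      scale (\<Psi> (P * ((x22 - x21 * y) * \<alpha> + (x11 + x21 * y) * \<delta>))) (\<rho> (M 0 1 1 y) w)"
    using k g by (simp add: rep_scale M_in_GL)
qed

text \<open>An eigenvector of the whole congruence subgroup in \<open>Wt r s\<close> belongs to an x
  that is upper triangular modulo the maximal ideal with diagonal (r, s). As r and s differ there, x
  has a second eigenline; bringing it to the first place exchanges the diagonal entries.\<close>

lemma Wt_swap:
  assumes rs: "r \<in> \<pp> 0" "s \<in> \<pp> 0" "unit (r - s)" and nz: "Wt r s \<noteq> {0}"
  shows "Wt s r \<noteq> {0}"
proof -
  have inv: "\<rho> (Kel a b c d) w \<in> Wt r s"
    if "a \<in> \<pp> 0" "b \<in> \<pp> 0" "c \<in> \<pp> 0" "d \<in> \<pp> 0" "w \<in> Wt r s" for a b c d w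
    unfolding Kel_def using that by (intro Wt_iwahori gl_K l2 P_x_1)
  obtain w x11 x12 x21 x22 where w: "w \<in> Wt r s" "w \<noteq> 0"
    and x: "x11 \<in> \<pp> 0" "x12 \<in> \<pp> 0" "x21 \<in> \<pp> 0" "x22 \<in> \<pp> 0" "Kchar x11 x12 x21 x22 w"
    by (rule Kchar_exists[OF subspace_Wt _ nz inv]) (use Wt_W in auto)
  note c = Wt_Kchar[OF x(5) w x(1-4) rs(1,2)]
  have u: "unit (x11 - x22)"
    using unit_add[OF rs(3) pp_diff[OF c(2,3)]] by simp
  \<comment> \<open>With x21 in the maximal ideal the condition of \<open>Kchar_swap\<close> becomes
    linear, namely x12 = (x11 - x22) y.\<close>
  define y where "y = x12 / (x11 - x22)"
  have y: "y \<in> \<pp> 0" unfolding y_def by (rule pp_divide_unit[OF x(2) u])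
  have "x12 = (x11 - x22) * y" using unit_nonzero[OF u] by (simp add: y_def)
  then have "x12 - x11 * y - x21 * y * y + x22 * y = - (x21 * y * y)" by (simp add: algebra_simps)
  moreover have "- (x21 * y * y) \<in> \<pp> 1" using c y by (simp add: pp_closed)
  ultimately have "x12 - x11 * y - x21 * y * y + x22 * y \<in> \<pp> 1" by (simp only:)
  then have "\<rho> (M 0 1 1 y) w \<in> Wt (x22 - x21 * y) (x11 + x21 * y)"
    by (rule Kchar_swap[OF x(5) Wt_W[OF w(1)] x(1-4) y])
  also have "Wt (x22 - x21 * y) (x11 + x21 * y) = Wt s r"
  proof (rule Wt_cong)
    have "(x22 - s) - x21 * y \<in> \<pp> 1" "(x11 - r) + x21 * y \<in> \<pp> 1" using c y by (simp_all add: pp_closed)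
    then show "x22 - x21 * y - s \<in> \<pp> 1" "x11 + x21 * y - r \<in> \<pp> 1" by (simp_all add: algebra_simps)
  qed
  finally show ?thesis
    using rep_nonzero[OF M_in_GL[OF gl_anti[OF y]] Wt_W[OF w(1)] w(2)] by auto
qed

text \<open>By induction on \<open>n\<close> the character of \<open>U\<close> is corrected on the larger and larger ideals \<open>\<pp> (l - 1 - n)\<close>:
  translating by the lower unipotent element with entry \<open>c = (a - a') / (r - s)\<close> multiplies it by
  \<open>\<psi>((r - s) b c)\<close>.\<close>

lemma Wt_unip_eigvec:
  assumes rs: "r \<in> \<pp> 0" "s \<in> \<pp> 0" "unit (r - s)" and nz: "Wt r s \<noteq> {0}" and a: "a \<in> \<pp> 1"
  shows "\<exists>w\<in>Wt r s. w \<noteq> 0 \<and> (\<forall>b\<in>\<pp> 0. \<rho> (M 1 b 0 1) w = scale (\<Psi> (a * b)) w)"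
proof -
  have aI: "a \<in> \<pp> 0" using a pp_int by blast
  have "\<exists>w\<in>Wt r s. w \<noteq> 0 \<and> (\<forall>b\<in>\<pp> (l - 1 - n). \<rho> (M 1 b 0 1) w = scale (\<Psi> (a * b)) w)"
    if "n \<le> l - 1" for n
    using that
  proof (induction n)
    \<comment> \<open>For b in \<open>\<pp> (l - 1)\<close> the unipotent element is a
      \<open>Kel\<close> with only \<beta> nonzero, hence acts trivially on \<open>Wt r s\<close>;
      and \<open>\<Psi> (a * b)\<close> is 1 there because a lies in \<open>\<pp> 1\<close>.\<close>
    case 0
    obtain w where w: "w \<in> Wt r s" "w \<noteq> 0" using nz subspace_0[OF subspace_Wt] by auto
    have "\<rho> (M 1 b 0 1) w = scale (\<Psi> (a * b)) w" if b: "b \<in> \<pp> (l - 1)" for b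
    proof -
      have "b / P \<in> \<pp> 0" using b pp_divide[of b 0 "l - 1"] by simp
      moreover have "Kel 0 (b / P) 0 0 = M 1 b 0 1" using uniformiser_power(2)[of "l - 1"] by (simp add:
          Kel_def)
      ultimately have "\<rho> (M 1 b 0 1) w = scale (\<Psi> 0) w" using WtD[OF w(1) pp_0 _ pp_0, of "b / P"] by simp
      moreover have "a * b \<in> \<pp> l" using pp_mult_le[OF a b, of l] l2 by simp
      ultimately show ?thesis by (simp add: Psi_0 Psi_eq_1)
    qed
    then show ?case using w by auto
  next
    case (Suc n)
    define S where "S = {w\<in>Wt r s. \<forall>b\<in>\<pp> (l - 1 - n). \<rho> (M 1 b 0 1) w = scale (\<Psi> (a * b)) w}"
    have uin: "M 1 b 0 1 \<in> carrier GL" if "b \<in> \<pp> n" for b n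
      using that pp_int by (intro M_in_GL gl_unip) blast
    have S: "subspace S"
      unfolding S_def using subspace_Wt[of r s] Wt_W[of _ r s]
      by (intro subspaceI) (auto simp: subspace_0 subspace_add subspace_scale rep_zero rep_add rep_scale
          uin scale_right_distrib mult.commute)
    have SW: "S \<subseteq> W" unfolding S_def using Wt_W by auto
    have S0: "S \<noteq> {0}" using Suc unfolding S_def by auto
    have inv: "\<rho> (M 1 b 0 1) w \<in> S" if b: "b \<in> \<pp> 0" and w: "w \<in> S" for b w
    proof -
      have "\<rho> (M 1 b 0 1) w \<in> Wt r s"
        using b w unfolding S_def by (intro Wt_iwahori gl_unip) (auto simp: pp_0)
      moreover have "\<rho> (M 1 b' 0 1) (\<rho> (M 1 b 0 1) w) = scale (\<Psi> (a * b')) (\<rho> (M 1 b 0 1) w)"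
        if b': "b' \<in> \<pp> (l - 1 - n)" for b'
      proof -
        have "\<rho> (M 1 b' 0 1) (\<rho> (M 1 b 0 1) w) = \<rho> (M 1 b 0 1) (\<rho> (M 1 b' 0 1) w)"
          using b b' w SW pp_int[OF b'] by (subst (1 2) act_mult) (auto simp: gl_unip add.commute)
        also have "\<rho> (M 1 b' 0 1) w = scale (\<Psi> (a * b')) w" using w b' unfolding S_def by blast
        finally show ?thesis using w SW b by (auto simp: rep_scale uin)
      qed
      ultimately show ?thesis unfolding S_def by blast
    qed
    obtain w a' where w: "w \<in> S" "w \<noteq> 0" and a': "a' \<in> \<pp> 0"
      and ev: "\<And>b. b \<in> \<pp> 0 \<Longrightarrow> \<rho> (M 1 b 0 1) w = scale (\<Psi> (a' * b)) w"
      using unip_eigvec[OF S SW S0 inv] by blast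
    have wt: "w \<in> Wt r s" using w by (simp add: S_def)
    \<comment> \<open>The characters given by a and a' agree on \<open>\<pp> (l - 1 - n)\<close>, so
      their difference lies in \<open>\<pp> (n + 1)\<close>; this is what lets c be small enough
      below.\<close>
    have "a - a' \<in> \<pp> (l - (l - 1 - n))"
    proof (rule Psi_faithful)
      show "a - a' \<in> \<pp> 0" using aI a' by (rule pp_diff)
      fix b assume b: "b \<in> \<pp> (l - 1 - n)"
      then have bI: "b \<in> \<pp> 0" using pp_int by blast
      have "scale (\<Psi> (a * b)) w = scale (\<Psi> (a' * b)) w"
        using ev[OF bI] w(1) b unfolding S_def by auto
      then show "\<Psi> ((a - a') * b) = 1"
        using w(2) bI aI a' Psi_nonzero[of "a' * b"] by (simp add: left_diff_distrib Psi_diff pp_closed)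
    qed simp
    moreover have "l - (l - 1 - n) = n + 1" using Suc.prems by simp
    ultimately have aa: "a - a' \<in> \<pp> (n + 1)" by metis
    define c where "c = (a - a') / (r - s)"
    have c: "c \<in> \<pp> (n + 1)" unfolding c_def by (rule pp_divide_unit[OF aa rs(3)])
    have c1: "c \<in> \<pp> 1" "c \<in> \<pp> 0" using c pp_mono pp_int by fastforce+
    have cr: "(r - s) * c = a - a'" using unit_nonzero[OF rs(3)] by (simp add: c_def)
    let ?w = "\<rho> (M 1 0 c 1) w"
    have w': "?w \<in> Wt r s" using wt c1 by (intro Wt_iwahori gl_low)
    have "\<rho> (M 1 b 0 1) ?w = scale (\<Psi> (a * b)) ?w" if b: "b \<in> \<pp> (l - 1 - Suc n)" for b
    proof -
      have bI: "b \<in> \<pp> 0" using b pp_int by blast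
      \<comment> \<open>As b c lies in \<open>\<pp> (l - 1)\<close>, exchanging the two unipotent
        elements costs only a factor in the congruence subgroup. The terms containing b c c vanish,
        so this factor is the upper triangular \<open>?k\<close>, whose action on
        \<open>Wt r s\<close> is known.\<close>
      have bc: "b * c \<in> \<pp> (l - 1)" using pp_mult_le[OF b c, of "l - 1"] Suc.prems by simp
      have bcc: "b * c * c \<in> \<pp> l" using pp_mult_le[OF bc c1(1), of l] l_pos by simp
      define \<alpha> where "\<alpha> = b * c / P"
      have \<alpha>: "\<alpha> \<in> \<pp> 0" using bc pp_divide[of "b * c" 0 "l - 1"] by (simp add: \<alpha>_def)
      have P\<alpha>: "P * \<alpha> = b * c" using uniformiser_power(2)[of "l - 1"] by (simp add: \<alpha>_def)
      let ?k = "Kel \<alpha> (- b * \<alpha>) 0 (- \<alpha>)"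
      have kM: "?k = M (1 + b * c) (- b * (b * c)) 0 (1 - b * c)"
        unfolding Kel_def by (simp add: P\<alpha> mult.left_commute[of P])
      have ki: "gl (1 + b * c) (- b * (b * c)) 0 (1 - b * c)"
        using gl_K[OF l2 \<alpha> _ pp_0, of "- b * \<alpha>" "- \<alpha>"] \<alpha> bI by (simp add: P\<alpha> mult.left_commute[of P]
            pp_closed)
      have gb: "gl 1 b 0 1" "gl 1 0 c 1" using bI c1 by (simp_all add: gl_unip gl_low)
      have gbc: "gl 1 b c (c * b + 1)" using gl_mult[OF gb(2,1)] by simp
      have m: "b * c * c * x \<in> \<pp> l" if "x \<in> \<pp> 0" for x using bcc that by (simp add: pp_mult_right)
      have r: "M 1 b 0 1 \<otimes>\<^bsub>GL\<^esub> M 1 0 c 1 = M (1 + b * c) b c 1"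
        "M 1 0 c 1 \<otimes>\<^bsub>GL\<^esub> M 1 b 0 1 = M 1 b c (c * b + 1)"
        using GL_mult[OF gb] GL_mult[OF gb(2,1)] by simp_all
      have "(1 + b * c) - ((1 + b * c) * 1 + - b * (b * c) * c) = b * c * c * b"
        "b - ((1 + b * c) * b + - b * (b * c) * (c * b + 1)) = b * c * c * (b * b)"
        "c - (0 * 1 + (1 - b * c) * c) = b * c * c * 1"
        "1 - (0 * b + (1 - b * c) * (c * b + 1)) = b * c * c * b"
        by (simp_all add: algebra_simps)
      then have "M 1 b 0 1 \<otimes>\<^bsub>GL\<^esub> M 1 0 c 1 = ?k \<otimes>\<^bsub>GL\<^esub> (M 1 0 c 1 \<otimes>\<^bsub>GL\<^esub> M 1 b 0 1)"
        unfolding kM r GL_mult[OF ki gbc] M_eq_iff using m[OF bI] m[of 1] m[of "b * b"] bI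
        by (simp only: pp_1 pp_mult_left simp_thms)
      then have "\<rho> (M 1 b 0 1) ?w = \<rho> ?k (\<rho> (M 1 0 c 1) (\<rho> (M 1 b 0 1) w))"
        using gb ki wt kM by (simp add: rep_mult[symmetric] M_in_GL Wt_W)
      also have "\<dots> = scale (\<Psi> (a' * b)) (\<rho> ?k ?w)"
        using ev[OF bI] gb ki wt kM by (simp add: rep_scale M_in_GL Wt_W rep_closed)
      also have "\<rho> ?k ?w = scale (\<Psi> (P * (r * \<alpha> + s * - \<alpha>))) ?w"
        using w' \<alpha> bI by (intro WtD) (simp_all add: pp_closed)
      also have "P * (r * \<alpha> + s * - \<alpha>) = (a - a') * b"
      proof -
        have "P * (r * \<alpha> + s * - \<alpha>) = (r - s) * (P * \<alpha>)" by (simp add: algebra_simps)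
        also have "\<dots> = ((r - s) * c) * b" unfolding P\<alpha> by (simp only: mult_ac)
        finally show ?thesis unfolding cr .
      qed
      also have "scale (\<Psi> (a' * b)) (scale (\<Psi> ((a - a') * b)) ?w) = scale (\<Psi> (a' * b + (a - a') * b)) ?w"
        using a' aI bI by (simp add: Psi_add pp_closed)
      finally show ?thesis by (simp add: algebra_simps)
    qed
    moreover have "?w \<noteq> 0" using rep_nonzero[OF M_in_GL[OF gl_low[OF c1(2)]] Wt_W[OF wt] w(2)] .
    ultimately show ?case using w' by auto
  qed
  from this[of "l - 1"] show ?thesis by simp
qed

text \<open>The case a = 0 of \<open>Wt_unip_eigvec\<close> supplies nonzero U-fixed vectors in
  \<open>Wt r s\<close>. The diagonal torus normalises U and preserves \<open>Wt r s\<close>, and it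
  is commutative, so it has a common eigenvector among them.\<close>

lemma Wt_borel_eig:
  assumes rs: "r \<in> \<pp> 0" "s \<in> \<pp> 0" "unit (r - s)" and nz: "Wt r s \<noteq> {0}"
  obtains w where "w \<in> Wt r s" "borel_eig w"
proof -
  define S where "S = {w\<in>Wt r s. \<forall>b\<in>\<pp> 0. \<rho> (M 1 b 0 1) w = w}"
  have S: "subspace S"
    unfolding S_def using subspace_Wt[of r s] Wt_W[of _ r s]
    by (intro subspaceI) (auto simp: subspace_0 subspace_add subspace_scale rep_zero rep_add rep_scale
        M_in_GL gl_unip)
  have SW: "S \<subseteq> W" unfolding S_def using Wt_W by auto
  have S0: "S \<noteq> {0}" using Wt_unip_eigvec[OF assms pp_0] by (auto simp: S_def Psi_0)
  have T: "\<rho> (M a 0 0 d) w \<in> S" if t: "unit a" "unit d" "w \<in> S" for a d w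
  proof -
    have g: "gl a 0 0 d" using t by (simp add: gl_upper pp_0)
    have "\<rho> (M a 0 0 d) w \<in> Wt r s"
      using t g unfolding S_def by (intro Wt_iwahori) (auto simp: pp_0)
    moreover have "\<rho> (M 1 b 0 1) (\<rho> (M a 0 0 d) w) = \<rho> (M a 0 0 d) w" if b: "b \<in> \<pp> 0" for b
    proof -
      define b' where "b' = b * d / a"
      have b': "b' \<in> \<pp> 0" "a * b' = b * d"
        using b t unit_int[OF t(2)] unit_nonzero[OF t(1)] by (auto simp: b'_def intro!: pp_divide_unit
            pp_mult_left)
      have "\<rho> (M 1 b 0 1) (\<rho> (M a 0 0 d) w) = \<rho> (M a 0 0 d) (\<rho> (M 1 b' 0 1) w)"
        using g b b' t SW by (subst (1 2) act_mult) (auto simp: gl_unip)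
      then show ?thesis using t b' by (simp add: S_def)
    qed
    ultimately show ?thesis by (simp add: S_def)
  qed
  obtain w where "w \<in> S" "borel_eig w"
    by (rule borel_eig_exists[OF S SW S0 T]) (auto simp: S_def)
  then show ?thesis by (intro that) (simp_all add: S_def)
qed

section \<open>The decomposition of \<open>E t\<close> for \<open>t < l\<close>\<close>

lemma avgU_Wt:
  assumes "w \<in> Wt r s"
  shows "avgU t w \<in> Wt r s"
  unfolding avg_def
proof (intro subspace_scale[OF subspace_Wt] subspace_sum[OF subspace_Wt])
  fix h assume "h \<in> unipotent R"
  then obtain b where "b \<in> \<pp> 0" "h = M 1 b 0 1" by (auto simp: unipotent_R)
  then show "\<rho> h w \<in> Wt r s" using assms by (auto intro!: Wt_iwahori gl_unip pp_0)
qed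

text \<open>For \<open>t < l\<close> the character of U carries at least one factor of the
  uniformiser, which together with \<open>P\<close> gives an element of
  \<open>\<pp> l\<close>.\<close>

lemma E_Kel_upper:
  assumes x: "x \<in> E t" and t: "t < l" and i: "\<beta> \<in> \<pp> 0"
  shows "\<rho> (Kel 0 \<beta> 0 0) x = x"
proof -
  have "\<rho> (Kel 0 \<beta> 0 0) x = \<rho> (M 1 (P * \<beta>) 0 1) x" by (simp add: Kel_def)
  also have "\<dots> = scale (\<Psi> (\<omega> ^ (l - t) * (P * \<beta>))) x"
    using x i unfolding E_iff by (simp add: pp_closed P_pp)
  also have "\<Psi> (\<omega> ^ (l - t) * (P * \<beta>)) = 1"
    using t pp_mult_right[OF P_pp(1) i]
    by (intro Psi_eq_1 pp_mult_le[OF uniformiser_power(1), of "P * \<beta>" "l - 1"]) auto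
  finally show ?thesis by simp
qed

text \<open>The diagonal part of the congruence subgroup normalises U and changes an entry c by an
  element of \<open>\<pp> (l - 1)\<close>. The factor \<open>\<omega> ^ (l - t)\<close> moves the
  change into \<open>\<pp> l\<close>, so the character of U is preserved.\<close>

lemma avgU_T1:
  assumes t: "t < l" and y: "y \<in> W" and i: "\<alpha> \<in> \<pp> 0" "\<delta> \<in> \<pp> 0"
  shows "\<rho> (Kel \<alpha> 0 0 \<delta>) (avgU t y) = avgU t (\<rho> (Kel \<alpha> 0 0 \<delta>) y)"
proof (rule avg_commute[OF char_on_unipotent _ y])
  show "Kel \<alpha> 0 0 \<delta> \<in> carrier GL" using i by (intro K_simps(1) pp_0)
  fix h assume "h \<in> unipotent R"
  then obtain c where c: "c \<in> \<pp> 0" "h = M 1 c 0 1" by (auto simp: unipotent_R)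
  define c' where "c' = (1 + P * \<alpha>) * c / (1 + P * \<delta>)"
  have u: "unit (1 + P * \<delta>)" using i by (intro unit_add unit_1 P_x_1 l2)
  have c': "c' \<in> \<pp> 0" "c' * (1 + P * \<delta>) = (1 + P * \<alpha>) * c"
    using i c unit_nonzero[OF u] pp_divide_unit[OF _ u, of "(1 + P * \<alpha>) * c" 0]
    by (simp_all add: c'_def P_pp pp_closed)
  have k: "gl (1 + P * \<alpha>) 0 0 (1 + P * \<delta>)" using gl_K[OF l2 i(1) pp_0 pp_0 i(2)] by simp
  have "c' - c = P * (\<alpha> * c - c' * \<delta>)" using c'(2) by (simp add: algebra_simps)
  then have cc: "c' - c \<in> \<pp> (l - 1)" using i c c' P_pp by (simp add: pp_closed)
  have "\<omega> ^ (l - t) * (c' - c) \<in> \<pp> l"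
    by (rule pp_mult_le[OF uniformiser_power(1) cc]) (use t in auto)
  then have "psi_unip v \<omega> \<psi> t l (M 1 c' 0 1) = psi_unip v \<omega> \<psi> t l (M 1 c 0 1)"
    using c c' by (simp add: psi_unip_M right_diff_distrib Psi_cong)
  moreover have "Kel \<alpha> 0 0 \<delta> \<otimes>\<^bsub>GL\<^esub> M 1 c 0 1 = M 1 c' 0 1 \<otimes>\<^bsub>GL\<^esub> Kel \<alpha> 0 0 \<delta>"
    using k c c' by (simp add: Kel_def GL_mult gl_unip)
  ultimately show "\<exists>h'\<in>unipotent R. Kel \<alpha> 0 0 \<delta> \<otimes>\<^bsub>GL\<^esub> h = h' \<otimes>\<^bsub>GL\<^esub> Kel \<alpha> 0 0 \<delta> \<and>
      psi_unip v \<omega> \<psi> t l h' = psi_unip v \<omega> \<psi> t l h"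
    unfolding c(2) unipotent_R using c'(1) by blast
qed

text \<open>\<open>x\<close> is the average of s w, for a Borel eigenvector w in
  \<open>Wt r s\<close> and the Weyl element s. As s exchanges the diagonal weights and averaging
  respects the diagonal part of the congruence subgroup, x lies in \<open>Wt s r\<close>.\<close>

lemma E_decomp:
  assumes rs: "r \<in> \<pp> 0" "s \<in> \<pp> 0" "unit (r - s)" and nz: "Wt r s \<noteq> {0}" and t: "t < l"
  obtains x where "x \<in> E t \<inter> Wt s r" "E t \<subseteq> {v + y | v y. v \<in> E t \<inter> Wt r s \<and> y \<in> span {x}}"
proof -
  obtain w where w: "w \<in> Wt r s" "borel_eig w" by (rule Wt_borel_eig[OF rs nz])
  have wW: "w \<in> W" "w \<noteq> 0" using w by (auto simp: borel_eig_def)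
  have gs: "gl 0 1 1 0" using gl_anti pp_0 by blast
  define x where "x = avgU t (\<rho> (M 0 1 1 0) w)"
  have sw: "\<rho> (M 0 1 1 0) w \<in> W" using wW gs by (intro rep_closed M_in_GL)
  have xE: "x \<in> E t" unfolding x_def by (rule avgU_in[OF sw])
  have xW: "x \<in> Wt s r"
    unfolding Wt_def
  proof (intro CollectI conjI ballI)
    show "x \<in> W" using xE E_W by blast
    fix \<alpha> \<beta> \<delta> assume i: "\<alpha> \<in> \<pp> 0" "\<beta> \<in> \<pp> 0" "\<delta> \<in> \<pp> 0"
    have b: "\<rho> (Kel 0 \<beta> 0 0) x = x" by (rule E_Kel_upper[OF xE t i(2)])
    have "\<rho> (Kel \<alpha> 0 0 \<delta>) x = avgU t (\<rho> (Kel \<alpha> 0 0 \<delta>) (\<rho> (M 0 1 1 0) w))"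
      unfolding x_def by (rule avgU_T1[OF t sw i(1,3)])
    also have "\<rho> (Kel \<alpha> 0 0 \<delta>) (\<rho> (M 0 1 1 0) w) = \<rho> (M 0 1 1 0) (\<rho> (Kel \<delta> 0 0 \<alpha>) w)"
      using Kel_conj[OF l2 gs i(1) pp_0 pp_0 i(3) i(3) pp_0 pp_0 i(1)] gs wW i
      by (simp add: rep_mult[symmetric] K_simps(1) M_in_GL pp_0)
    also have "\<dots> = scale (\<Psi> (P * (s * \<alpha> + r * \<delta>))) (\<rho> (M 0 1 1 0) w)"
      using WtD[OF w(1) i(3) pp_0 i(1)] gs wW by (simp add: rep_scale M_in_GL add.commute)
    finally have a: "\<rho> (Kel \<alpha> 0 0 \<delta>) x = scale (\<Psi> (P * (s * \<alpha> + r * \<delta>))) x"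
      using sw by (simp add: avgU_scale x_def)
    have "\<rho> (Kel \<alpha> \<beta> 0 \<delta>) x = \<rho> (Kel \<alpha> 0 0 \<delta>) (\<rho> (Kel 0 \<beta> 0 0) x)"
      using i \<open>x \<in> W\<close> by (simp add: rep_mult[symmetric] K_simps pp_0)
    then show "\<rho> (Kel \<alpha> \<beta> 0 \<delta>) x = scale (\<Psi> (P * (s * \<alpha> + r * \<delta>))) x" using a b by simp
  qed
  let ?S = "{v + y | v y. v \<in> E t \<inter> Wt r s \<and> y \<in> span {x}}"
  have "E t \<subseteq> ?S"
    unfolding E_def
  proof (rule eigsp_span_subset[OF char_on_unipotent wW], fold E_def)
    have i: "subspace (E t \<inter> Wt r s)" by (rule subspace_inter[OF subspace_E subspace_Wt])
    then show "subspace ?S" using subspace_sums[OF i subspace_span, of "{x}"] by simp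
    fix g assume "g \<in> carrier GL"
    then obtain a b c d where g: "gl a b c d" "g = M a b c d" by (auto simp: carrier_GL)
    show "avgU t (\<rho> g w) \<in> ?S"
    proof (cases "c \<in> \<pp> 1")
      case True
      then have "\<rho> g w \<in> Wt r s" unfolding g(2) using w(1) g(1) by (intro Wt_iwahori)
      then have "avgU t (\<rho> g w) \<in> E t \<inter> Wt r s" using avgU_Wt avgU_in Wt_W by blast
      then have "avgU t (\<rho> g w) + 0 \<in> ?S" using span_zero by blast
      then show ?thesis by simp
    next
      case False
      then have "unit c" using gl_int[OF g(1)] by (simp add: unit_iff)
      then have "avgU t (\<rho> g w) \<in> span {x}"
        unfolding g(2) x_def by (rule avgU_big_cell[OF w(2) g(1)])
      then have "0 + avgU t (\<rho> g w) \<in> ?S" using subspace_0[OF i] by blast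
      then show ?thesis by simp
    qed
  qed
  then show ?thesis using that[of x] xE xW by blast
qed

lemma dim_E_split:
  assumes rs: "r \<in> \<pp> 0" "s \<in> \<pp> 0" "unit (r - s)" and nz: "Wt r s \<noteq> {0}" and t: "t < l"
  shows "dim (E t) = 2"
proof -
  have sr: "unit (s - r)" using rs(3) unit_uminus[of "r - s"] by simp
  note nz' = Wt_swap[OF rs nz]
  obtain x where x: "x \<in> E t \<inter> Wt s r" "E t \<subseteq> {v + y | v y. v \<in> E t \<inter> Wt r s \<and> y \<in> span {x}}"
    by (rule E_decomp[OF rs nz t])
  obtain y where y: "y \<in> E t \<inter> Wt r s" "E t \<subseteq> {v + z | v z. v \<in> E t \<inter> Wt s r \<and> z \<in> span {y}}"
    by (rule E_decomp[OF rs(2,1) sr nz' t])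
  have un: "w = 0" if "w \<in> Wt r s" "w \<in> Wt s r" for w
    using Wt_unique(1)[OF that _ rs(1,2) rs(2,1)] rs(3) by (auto simp: unit_iff)
  \<comment> \<open>Decompose v along the other splitting, \<open>Wt s r\<close> plus the line of y.
    Both v and z lie in \<open>Wt r s\<close>, so the part in \<open>Wt s r\<close> is zero.\<close>
  have line: "v \<in> span {y}" if v: "v \<in> E t" "v \<in> Wt r s" for v
  proof -
    obtain v' z where vz: "v = v' + z" "v' \<in> Wt s r" "z \<in> span {y}" using y(2) v(1) by blast
    have "z \<in> Wt r s" using vz(3) span_minimal[of "{y}" "Wt r s"] y(1) subspace_Wt by auto
    then have "v - z \<in> Wt r s" using v subspace_diff[OF subspace_Wt] by blast
    then have "v' = 0" using un[of v'] vz by simp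
    then show ?thesis using vz by simp
  qed
  have sub: "E t \<subseteq> span {x, y}"
  proof
    fix v assume "v \<in> E t"
    then obtain v' z where vz: "v = v' + z" "v' \<in> E t" "v' \<in> Wt r s" "z \<in> span {x}" using x(2) by blast
    then have "v' \<in> span {x, y}" "z \<in> span {x, y}"
      using line span_mono[of "{y}" "{x, y}"] span_mono[of "{x}" "{x, y}"] by auto
    then show "v \<in> span {x, y}" using vz(1) span_add by blast
  qed
  \<comment> \<open>By \<open>t < l\<close> the parameter \<open>\<omega> ^ (l - t)\<close> is
    admissible in \<open>Wt_unip_eigvec\<close>. The vectors p and p' found this way in
    \<open>E t\<close> show that neither of the two lines degenerates.\<close>
  have k: "\<omega> ^ (l - t) \<in> \<pp> 1" using uniformiser_power(1)[of "l - t"] pp_mono t by fastforce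
  obtain p where p: "p \<in> Wt r s" "p \<noteq> 0" "p \<in> E t"
    using Wt_unip_eigvec[OF rs nz k] Wt_W by (auto simp: E_iff)
  obtain p' where p': "p' \<in> Wt s r" "p' \<noteq> 0" "p' \<in> E t"
    using Wt_unip_eigvec[OF rs(2,1) sr nz' k] Wt_W by (auto simp: E_iff)
  have y0: "y \<noteq> 0" using line[OF p(3,1)] p(2) by auto
  have x0: "x \<noteq> 0"
  proof
    assume "x = 0"
    then have "p' \<in> Wt r s" using x(2) p'(3) by auto
    then show False using un p' by auto
  qed
  have "y \<notin> span {x}"
  proof
    assume "y \<in> span {x}"
    then have "y \<in> Wt s r" using span_minimal[of "{x}" "Wt s r"] x(1) subspace_Wt by auto
    then show False using un y(1) y0 by auto
  qed
  then show ?thesis using x y sub x0 by (intro dim_plane[of x _ y]) auto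
qed

section \<open>Types occurring in \<open>E t\<close>, and the bound for
  \<open>t = l - 1\<close>\<close>

lemma E_T1:
  assumes "w \<in> E t" "t < l" "\<alpha> \<in> \<pp> 0" "\<delta> \<in> \<pp> 0"
  shows "\<rho> (Kel \<alpha> 0 0 \<delta>) w \<in> E t"
proof -
  have w: "w \<in> W" "avgU t w = w"
    using assms(1) E_W avg_eq[OF char_on_unipotent] unfolding E_def by auto
  have "\<rho> (Kel \<alpha> 0 0 \<delta>) w = avgU t (\<rho> (Kel \<alpha> 0 0 \<delta>) w)"
    using avgU_T1[OF assms(2) w(1) assms(3,4)] w(2) by simp
  moreover have "\<rho> (Kel \<alpha> 0 0 \<delta>) w \<in> W" using assms w by (intro rep_closed K_simps(1) pp_0)
  ultimately show ?thesis using avgU_in by metis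
qed

text \<open>Since \<open>t < l\<close>, the upper unipotent part of \<open>K\<^sup>l\<^sup>-\<^sup>1\<close> acts trivially on \<open>E t\<close>, so only the diagonal
  part has to be diagonalised.\<close>

lemma E_Wt_exists:
  assumes S: "subspace S" "S \<subseteq> E t" "S \<noteq> {0}" and t: "t < l"
    and inv: "\<And>\<alpha> \<delta> w. \<alpha> \<in> \<pp> 0 \<Longrightarrow> \<delta> \<in> \<pp> 0 \<Longrightarrow> w \<in> S \<Longrightarrow> \<rho> (Kel \<alpha> 0 0 \<delta>) w \<in> S"
  obtains w r s where "w \<in> S" "w \<noteq> 0" "r \<in> \<pp> 0" "s \<in> \<pp> 0" "w \<in> Wt r s"
proof -
  define H where "H = {Kel a 0 0 d | a d. a \<in> \<pp> 0 \<and> d \<in> \<pp> 0}"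
  have H: "H \<subseteq> carrier GL" unfolding H_def by (auto intro: K_simps(1) pp_0)
  have c: "h \<otimes>\<^bsub>GL\<^esub> k = k \<otimes>\<^bsub>GL\<^esub> h" if "h \<in> H" "k \<in> H" for h k
    using that unfolding H_def by (auto simp: K_simps(2) pp_0 add.commute)
  have SW: "S \<subseteq> W" using S(2) E_W by blast
  obtain w where w: "w \<in> S" "w \<noteq> 0" "\<And>h. h \<in> H \<Longrightarrow> \<exists>c. \<rho> h w = scale c w"
    by (rule common_eigenvector_rep[OF S(1) SW S(3) H]) (use inv c in \<open>auto simp: H_def\<close>)
  have wW: "w \<in> W" using w SW by auto
  have e: "\<exists>c. \<rho> (Kel a 0 0 d) w = scale c w" if "a \<in> \<pp> 0" "d \<in> \<pp> 0" for a d
    using w(3) that unfolding H_def by blast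
  note ev = Kel_eigenvalue[OF wW w(2)]
  obtain r where r: "r \<in> \<pp> 0" "\<And>b. b \<in> \<pp> 0 \<Longrightarrow> \<rho> (Kel b 0 0 0) w = scale (\<Psi> (P * (r * b))) w"
    using ev[of 1 0 0 0] e pp_0 pp_1 by auto
  obtain s where s: "s \<in> \<pp> 0" "\<And>b. b \<in> \<pp> 0 \<Longrightarrow> \<rho> (Kel 0 0 0 b) w = scale (\<Psi> (P * (s * b))) w"
    using ev[of 0 0 0 1] e pp_0 pp_1 by auto
  have "w \<in> Wt r s"
    unfolding Wt_def
  proof (intro CollectI conjI ballI wW)
    fix \<alpha> \<beta> \<delta> assume i: "\<alpha> \<in> \<pp> 0" "\<beta> \<in> \<pp> 0" "\<delta> \<in> \<pp> 0"
    have "Kel \<alpha> \<beta> 0 \<delta> = Kel \<alpha> 0 0 0 \<otimes>\<^bsub>GL\<^esub> (Kel 0 0 0 \<delta> \<otimes>\<^bsub>GL\<^esub> Kel 0 \<beta> 0 0)"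
      using i by (simp add: K_simps pp_0)
    then have "\<rho> (Kel \<alpha> \<beta> 0 \<delta>) w = \<rho> (Kel \<alpha> 0 0 0) (\<rho> (Kel 0 0 0 \<delta>) (\<rho> (Kel 0 \<beta> 0 0) w))"
      using i wW by (simp only: rep_mult K_simps(1) pp_0 rep_closed m_closed)
    also have "\<rho> (Kel 0 \<beta> 0 0) w = w" using E_Kel_upper[OF _ t i(2)] w S(2) by blast
    also have "\<rho> (Kel \<alpha> 0 0 0) (\<rho> (Kel 0 0 0 \<delta>) w) = scale (\<Psi> (P * (s * \<delta>)) * \<Psi> (P * (r * \<alpha>))) w"
      using i wW by (simp add: r s rep_scale K_simps(1) pp_0)
    also have "\<Psi> (P * (s * \<delta>)) * \<Psi> (P * (r * \<alpha>)) = \<Psi> (P * (r * \<alpha> + s * \<delta>))"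
      using i r s by (simp add: Psi_add distrib_left pp_closed P_pp mult.commute)
    finally show "\<rho> (Kel \<alpha> \<beta> 0 \<delta>) w = scale (\<Psi> (P * (r * \<alpha> + s * \<delta>))) w" .
  qed
  then show ?thesis using that w r s by blast
qed

text \<open>An element of \<open>H2\<close> is the unipotent element with entry b / d times the
  diagonal matrix (a, d), so the condition splits into one for U and one for the diagonal part.
  Replacing b / d by b alters the argument of \<open>\<Psi>\<close> only within
  \<open>\<pp> l\<close>.\<close>

lemma eigsp_H2:
  assumes rs: "r \<in> \<pp> 0" "s \<in> \<pp> 0"
  shows "eigsp H2 (H2_char r s) = E (l - 1) \<inter> Wt r s"
proof (intro equalityI subsetI IntI)
  fix w assume w: "w \<in> eigsp H2 (H2_char r s)"
  have wW: "w \<in> W" and wh: "\<And>h. h \<in> H2 \<Longrightarrow> \<rho> h w = scale (H2_char r s h) w" using w by (auto simp: eigsp_def)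
  have om: "\<omega> ^ (l - (l - 1)) = \<omega>" using l_pos by simp
  show "w \<in> E (l - 1)"
    unfolding E_iff om
  proof (intro conjI ballI wW)
    fix b assume b: "b \<in> \<pp> 0"
    show "\<rho> (M 1 b 0 1) w = scale (\<Psi> (\<omega> * b)) w"
      using wh[OF unip_in_H2[OF l2 b]] b rs by (simp add: H2_char_M pp_1)
  qed
  show "w \<in> Wt r s"
    unfolding Wt_def
  proof (intro CollectI conjI ballI wW)
    fix \<alpha> \<beta> \<delta> assume i: "\<alpha> \<in> \<pp> 0" "\<beta> \<in> \<pp> 0" "\<delta> \<in> \<pp> 0"
    have p: "P * x \<in> \<pp> (l - 1)" if "x \<in> \<pp> 0" for x by (rule pp_mult_right[OF P_pp(1) that])
    have "Kel \<alpha> \<beta> 0 \<delta> \<in> H2"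
      unfolding H2_def Kel_def using i p[OF i(1)] p[OF i(3)] P_pp(2) by (force simp: pp_mult_left)
    then have "\<rho> (Kel \<alpha> \<beta> 0 \<delta>) w = scale (H2_char r s (Kel \<alpha> \<beta> 0 \<delta>)) w" by (rule wh)
    also have "H2_char r s (Kel \<alpha> \<beta> 0 \<delta>) = \<Psi> (\<omega> * (P * \<beta>) + (r * (P * \<alpha>) + s * (P * \<delta>)))"
      unfolding Kel_def using i rs by (simp add: H2_char_M pp_closed P_pp)
    also have "\<dots> = \<Psi> (P * (r * \<alpha> + s * \<delta>))"
    proof (rule Psi_cong)
      have "\<omega> * (P * \<beta>) \<in> \<pp> l"
        by (rule pp_mult_le[OF omega_pp(1) p[OF i(2)]]) (use l_pos in simp)
      then show "\<omega> * (P * \<beta>) + (r * (P * \<alpha>) + s * (P * \<delta>)) - P * (r * \<alpha> + s * \<delta>) \<in> \<pp> l"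
        by (simp add: algebra_simps)
    qed
    finally show "\<rho> (Kel \<alpha> \<beta> 0 \<delta>) w = scale (\<Psi> (P * (r * \<alpha> + s * \<delta>))) w" .
  qed
next
  fix w assume w: "w \<in> E (l - 1) \<inter> Wt r s"
  then have wW: "w \<in> W" using E_W by blast
  have om: "\<omega> ^ (l - (l - 1)) = \<omega>" using l_pos by simp
  show "w \<in> eigsp H2 (H2_char r s)"
    unfolding eigsp_def
  proof (intro CollectI conjI ballI wW)
    fix h assume "h \<in> H2"
    then obtain a b d where h: "h = M a b 0 d" "b \<in> \<pp> 0" "a - 1 \<in> \<pp> (l - 1)" "d - 1 \<in> \<pp> (l - 1)"
      by (auto simp: H2_def)
    have u: "unit a" "unit d" using unit_near_1[OF l2] h by blast+
    have bd: "b / d \<in> \<pp> 0" using h u by (intro pp_divide_unit)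
    define \<alpha> \<delta> where ad: "\<alpha> = (a - 1) / P" "\<delta> = (d - 1) / P"
    have i: "\<alpha> \<in> \<pp> 0" "\<delta> \<in> \<pp> 0"
      using h pp_divide[of _ 0 "l - 1"] unfolding ad by simp_all
    have Pa: "P * \<alpha> = a - 1" "P * \<delta> = d - 1" using uniformiser_power(2)[of "l - 1"] unfolding ad by simp_all
    have K: "Kel \<alpha> 0 0 \<delta> = M a 0 0 d" by (simp add: Kel_def Pa)
    have g: "gl a 0 0 d" using u by (simp add: gl_upper pp_0)
    have "\<rho> h w = \<rho> (M 1 (b / d) 0 1) (\<rho> (Kel \<alpha> 0 0 \<delta>) w)"
      unfolding K h(1) using act_mult[OF gl_unip[OF bd] g wW] unit_nonzero[OF u(2)] by simp
    also have "\<rho> (Kel \<alpha> 0 0 \<delta>) w = scale (\<Psi> (P * (r * \<alpha> + s * \<delta>))) w"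
      using w i by (intro WtD pp_0) auto
    also have "\<rho> (M 1 (b / d) 0 1) (scale (\<Psi> (P * (r * \<alpha> + s * \<delta>))) w) =
        scale (\<Psi> (P * (r * \<alpha> + s * \<delta>))) (scale (\<Psi> (\<omega> * (b / d))) w)"
    proof -
      have "\<rho> (M 1 (b / d) 0 1) w = scale (\<Psi> (\<omega> * (b / d))) w"
        using w bd unfolding Int_iff E_iff om by blast
      then show ?thesis using rep_scale[OF M_in_GL[OF gl_unip[OF bd]] wW] by simp
    qed
    also have "P * (r * \<alpha> + s * \<delta>) = r * (a - 1) + s * (d - 1)"
      unfolding Pa[symmetric] by (simp add: algebra_simps)
    also have "\<Psi> (\<omega> * (b / d)) = \<Psi> (\<omega> * b)"
    proof (rule Psi_cong)
      have "\<omega> * (b / d) - \<omega> * b = - (\<omega> * ((d - 1) * (b / d)))"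
        using unit_nonzero[OF u(2)] by (simp add: field_simps)
      moreover have "\<omega> * ((d - 1) * (b / d)) \<in> \<pp> l"
        by (rule pp_mult_le[OF omega_pp(1) pp_mult_right[OF h(4) bd]]) (use l_pos in simp)
      ultimately show "\<omega> * (b / d) - \<omega> * b \<in> \<pp> l" by (simp only: pp_uminus)
    qed
    also have "scale (\<Psi> (r * (a - 1) + s * (d - 1))) (scale (\<Psi> (\<omega> * b)) w) = scale (H2_char r s h) w"
      using u[THEN unit_int] h(2) rs unfolding h(1)
      by (simp add: H2_char_M Psi_add pp_closed omega_pp mult.commute)
    finally show "\<rho> h w = scale (H2_char r s h) w" .
  qed
qed

lemma eigsp_H2_line:
  assumes r: "r \<in> \<pp> 0" and w: "w \<in> eigsp H2 (H2_char r r)" "w \<noteq> 0"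
  shows "eigsp H2 (H2_char r r) \<subseteq> span {w}"
proof (rule gelfand_trick[OF finite_GL char_on_H2[OF l2 r r] gl2_flip_closed gl2_flip_flip gl2_flip_anti
      H2_flip(1)[OF l2 _ r] H2_flip(2)[OF l2 _ r] _ w])
  fix g assume "g \<in> carrier GL"
  then obtain a b c d where g: "gl a b c d" "g = M a b c d" by (auto simp: carrier_GL)
  show "(\<exists>h\<in>H2. \<exists>h'\<in>H2. gl2_flip g = h \<otimes>\<^bsub>GL\<^esub> g \<otimes>\<^bsub>GL\<^esub> h' \<and> H2_char r r h * H2_char r r h' = 1) \<or>
    (\<exists>h\<in>H2. \<exists>h'\<in>H2. h \<otimes>\<^bsub>GL\<^esub> g = g \<otimes>\<^bsub>GL\<^esub> h' \<and> H2_char r r h \<noteq> H2_char r r h')"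
    unfolding g(2) by (rule gelfand_criterion_H2[OF l2 g(1) r])
qed

text \<open>If no \<open>Wt r s\<close> with \<open>r - s\<close> a unit occurs, the central character determines \<open>2 r\<close> modulo \<open>\<pp> 1\<close>, hence
  \<open>r\<close>, so that \<open>E (l - 1)\<close> is a single eigenspace of \<open>H2\<close>. This needs 2 to be a unit.\<close>

lemma dim_E_le_2: "dim (E (l - 1)) \<le> 2"
proof (cases "\<exists>r\<in>\<pp> 0. \<exists>s\<in>\<pp> 0. unit (r - s) \<and> Wt r s \<noteq> {0}")
  case True
  then show ?thesis using dim_E_split l_pos by fastforce
next
  case no: False
  have t: "l - 1 < l" using l_pos by simp
  have nonsplit: "w \<in> Wt r r" if "w \<in> Wt r s" "w \<noteq> 0" "r \<in> \<pp> 0" "s \<in> \<pp> 0" for w r s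
  proof -
    have "\<not> unit (r - s)" using no that by auto
    then have "r - s \<in> \<pp> 1" using that by (simp add: unit_iff pp_diff)
    then have "Wt r s = Wt r r" using pp_uminus[of "r - s" 1] by (intro Wt_cong) (simp_all add: pp_0)
    then show ?thesis using that by simp
  qed
  show ?thesis
  proof (cases "E (l - 1) = {0}")
    case True
    then show ?thesis using dim_le_card[of "E (l - 1)" "{}"] by simp
  next
    case False
    obtain w r s where w: "w \<in> E (l - 1)" "w \<noteq> 0" "r \<in> \<pp> 0" "s \<in> \<pp> 0" "w \<in> Wt r s"
      by (rule E_Wt_exists[OF subspace_E _ False t]) (use E_T1[OF _ t] in auto)
    have wr: "w \<in> Wt r r" using nonsplit w by blast
    note r = w(3)
    note ch = char_on_H2[OF l2 r r]
    \<comment> \<open>The complement of the eigenspace of \<open>H2\<close> in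
      \<open>E (l - 1)\<close>. A nonzero S would contain a vector of some type (r', r'); the
      central character forces r' to agree with r, and then the average of this vector is the vector
      itself instead of 0.\<close>
    define S where "S = {x\<in>E (l - 1). avg H2 (H2_char r r) x = 0}"
    have avgE: "avg H2 (H2_char r r) x \<in> eigsp H2 (H2_char r r)" if "x \<in> E (l - 1)" for x
      using avg_in_eigsp[OF ch] that E_W by blast
    have S: "subspace S"
    proof (rule subspaceI)
      show "0 \<in> S" using subspace_0[OF subspace_E] linear_op_sum[OF avg_linear_op[OF ch] rep_subspace,
          of "{}"]
        by (simp add: S_def)
      show "x + y \<in> S" if "x \<in> S" "y \<in> S" for x y
        using that avg_linear_op[OF ch] subspace_add[OF subspace_E] E_W by (auto simp: S_def linear_op_def)
      show "scale c x \<in> S" if "x \<in> S" for c x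
        using that avg_linear_op[OF ch] subspace_scale[OF subspace_E] E_W by (auto simp: S_def
            linear_op_def)
    qed
    have inv: "\<rho> (Kel \<alpha> 0 0 \<delta>) x \<in> S" if i: "\<alpha> \<in> \<pp> 0" "\<delta> \<in> \<pp> 0" and x: "x \<in> S" for \<alpha> \<delta> x
    proof -
      have "P * \<alpha> \<in> \<pp> (l - 1)" "P * \<delta> \<in> \<pp> (l - 1)" using P_pp(1) i by (auto intro: pp_mult_right)
      then have "Kel \<alpha> 0 0 \<delta> \<in> H2" unfolding H2_def Kel_def using pp_0[of 0] by force
      then have "avg H2 (H2_char r r) (\<rho> (Kel \<alpha> 0 0 \<delta>) x) = 0"
        using avg_right[OF ch, of _ x] x E_W[of x "l - 1"] by (simp add: S_def)
      then show ?thesis using x E_T1[OF _ t i] by (simp add: S_def)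
    qed
    have "S = {0}"
    proof (rule ccontr)
      assume nz: "S \<noteq> {0}"
      obtain w' r' s' where w': "w' \<in> S" "w' \<noteq> 0" "r' \<in> \<pp> 0" "s' \<in> \<pp> 0" "w' \<in> Wt r' s'"
        by (rule E_Wt_exists[OF S _ nz t inv]) (auto simp: S_def)
      have wr': "w' \<in> Wt r' r'" using nonsplit w' by blast
      \<comment> \<open>\<open>Kel z 0 0 z\<close> is the scalar matrix 1 + P z, so it acts by one
        scalar on the whole representation; w yields this scalar with 2 r, and w' with 2 r'.\<close>
      have "2 * r - 2 * r' \<in> \<pp> 1"
      proof (rule Psi_P_faithful2)
        have two: "2 \<in> \<pp> 0" using unit_two[OF odd_residue_char] unit_int by blast
        then show "2 * r \<in> \<pp> 0" "2 * r' \<in> \<pp> 0" using r w'(3) by (simp_all add: pp_closed)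
        fix z assume z: "z \<in> \<pp> 0"
        have cen: "Kel z 0 0 z \<otimes>\<^bsub>GL\<^esub> g = g \<otimes>\<^bsub>GL\<^esub> Kel z 0 0 z" if "g \<in> carrier GL" for g
        proof -
          obtain a b c d where g: "gl a b c d" "g = M a b c d" using \<open>g \<in> carrier GL\<close> by (auto simp:
              carrier_GL)
          show ?thesis unfolding g(2) using z by (intro Kel_conj[OF l2 g(1)]) (simp_all add: pp_0
              mult.commute)
        qed
        have "\<rho> (Kel z 0 0 z) w' = scale (\<Psi> (P * (r * z + r * z))) w'"
          by (rule central_scalar[OF K_simps(1)[OF z pp_0 pp_0 z] cen Wt_W[OF wr] w(2) WtD[OF wr z pp_0
              z] Wt_W[OF wr']])
        moreover have "\<rho> (Kel z 0 0 z) w' = scale (\<Psi> (P * (r' * z + r' * z))) w'" by (rule WtD[OF wr' z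
            pp_0 z])
        ultimately have "\<Psi> (P * (r * z + r * z)) = \<Psi> (P * (r' * z + r' * z))" using w'(2) by simp
        then show "\<Psi> (P * (2 * r * z)) = \<Psi> (P * (2 * r' * z))" by (simp only: mult_2 distrib_right)
      qed
      then have "(r' - r) * 2 \<in> \<pp> 1" using pp_uminus[of "2 * r - 2 * r'" 1] by (simp add: algebra_simps)
      then have "r' - r \<in> \<pp> 1" using pp_mult_unit_iff[OF unit_two[OF odd_residue_char]] by blast
      then have "w' \<in> Wt r r" using wr' Wt_cong[of r' r r' r] by simp
      then have "w' \<in> eigsp H2 (H2_char r r)" using w' r by (simp add: eigsp_H2 S_def)
      then show False using avg_eq[OF ch] w' by (simp add: S_def)
    qed
    have we: "w \<in> eigsp H2 (H2_char r r)" using w wr by (simp add: eigsp_H2)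
    have "E (l - 1) \<subseteq> span {w}"
    proof
      fix x assume x: "x \<in> E (l - 1)"
      have ax: "avg H2 (H2_char r r) x \<in> eigsp H2 (H2_char r r)" by (rule avgE[OF x])
      then have axE: "avg H2 (H2_char r r) x \<in> E (l - 1)" using r by (simp add: eigsp_H2)
      have "avg H2 (H2_char r r) (x - avg H2 (H2_char r r) x) = avg H2 (H2_char r r) x - avg H2 (H2_char
          r r) (avg H2 (H2_char r r) x)"
      proof -
        have "avg H2 (H2_char r r) (x + scale (-1) (avg H2 (H2_char r r) x)) =
            avg H2 (H2_char r r) x + scale (-1) (avg H2 (H2_char r r) (avg H2 (H2_char r r) x))"
          using avg_linear_op[OF ch] x axE E_W rep_sub(1) unfolding linear_op_def by metis
        then show ?thesis by simp
      qed
      also have "\<dots> = 0" using avg_eq[OF ch ax] by simp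
      finally have "x - avg H2 (H2_char r r) x \<in> S" using x axE subspace_diff[OF subspace_E] by (simp
          add: S_def)
      then have "x = avg H2 (H2_char r r) x" using \<open>S = {0}\<close> by simp
      then show "x \<in> span {w}" using ax eigsp_H2_line[OF r we w(2)] by auto
    qed
    then show ?thesis using dim_line[OF w(1,2)] by simp
  qed
qed

section \<open>Cuspidal and split semisimple representations\<close>

definition residue_mat :: "'a \<Rightarrow> 'a \<Rightarrow> 'a \<Rightarrow> 'a \<Rightarrow> 'a set mat2" where
  "residue_mat a b c d = Mat2 (trunc v 1 a) (trunc v 1 b) (trunc v 1 c) (trunc v 1 d)"

lemma Kchar_char_occurs:
  assumes k: "Kchar x11 x12 x21 x22 w" "w \<in> W" "w \<noteq> 0"
    and x: "x11 \<in> \<pp> 0" "x12 \<in> \<pp> 0" "x21 \<in> \<pp> 0" "x22 \<in> \<pp> 0"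
  shows "residue_mat x11 x12 x21 x22 \<in> carrier (gl2 (residue_field v))"
    "char_occurs scale W \<rho> (last_congruence v l) (psi_mat v \<omega> \<psi> l (residue_mat x11 x12 x21 x22))"
proof -
  show "residue_mat x11 x12 x21 x22 \<in> carrier (gl2 (residue_field v))"
    using x trunc_simps(7)[where n = 1] by (simp add: gl2_def residue_field_eq residue_mat_def)
  show "char_occurs scale W \<rho> (last_congruence v l) (psi_mat v \<omega> \<psi> l (residue_mat x11 x12 x21 x22))"
    unfolding char_occurs_def
  proof (intro bexI[OF _ k(2)] conjI ballI k(3))
    fix g assume "g \<in> last_congruence v l"
    then obtain a b c d where i: "a \<in> \<pp> 0" "b \<in> \<pp> 0" "c \<in> \<pp> 0" "d \<in> \<pp> 0"
      and g: "g = M (1 + P * a) (P * b) (P * c) (1 + P * d)"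
      using last_congruence_sub[OF l2] by blast
    show "\<rho> g w = scale (psi_mat v \<omega> \<psi> l (residue_mat x11 x12 x21 x22) g) w"
      using k(1) i unfolding g residue_mat_def psi_mat_M[OF x i] Kchar_def Kel_def by blast
  qed
qed

lemma ex_Kchar:
  obtains w x11 x12 x21 x22 where "w \<in> W" "w \<noteq> 0" "x11 \<in> \<pp> 0" "x12 \<in> \<pp> 0" "x21 \<in> \<pp> 0" "x22 \<in> \<pp> 0"
    "Kchar x11 x12 x21 x22 w"
  by (rule Kchar_exists[OF rep_subspace order_refl nonzero]) (auto intro: rep_closed K_simps(1))

text \<open>If x21 vanished in the residue field, then x11 would be a root of the characteristic
  polynomial.\<close>

lemma cuspidal_lower_left_unit:
  assumes cusp: "cuspidal_rep v \<omega> \<psi> l scale W \<rho>"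
    and k: "Kchar x11 x12 x21 x22 w" "w \<in> W" "w \<noteq> 0"
    and x: "x11 \<in> \<pp> 0" "x12 \<in> \<pp> 0" "x21 \<in> \<pp> 0" "x22 \<in> \<pp> 0"
  shows "unit x21"
proof (rule ccontr)
  assume "\<not> unit x21"
  then have x21: "x21 \<in> \<pp> 1" using x by (simp add: unit_iff)
  have "cuspidal_mat (residue_field v) (residue_mat x11 x12 x21 x22)"
    using cusp Kchar_char_occurs[OF k x] unfolding cuspidal_rep_def by blast
  then have "x11 * x11 - (x11 + x22) * x11 + (x11 * x22 - x12 * x21) \<notin> \<pp> 1"
    using is_root_charpoly2[OF x x(1)] unfolding cuspidal_mat_def residue_mat_def by blast
  moreover have "x11 * x11 - (x11 + x22) * x11 + (x11 * x22 - x12 * x21) = - (x12 * x21)"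
    by (simp add: algebra_simps)
  ultimately show False using x x21 by (simp add: pp_closed)
qed

text \<open>The congruence subgroup need not preserve \<open>E t\<close>. It is abelian, however,
  and so preserves the larger space S of vectors fixed by its upper unipotent part. An eigenvector
  in S has x21 zero in the residue field, which contradicts cuspidality.\<close>

lemma cuspidal_dim_lower:
  assumes cusp: "cuspidal_rep v \<omega> \<psi> l scale W \<rho>" and t: "t < l"
  shows "dim (E t) = 0"
proof -
  have "E t = {0}"
  proof (rule ccontr)
    assume nz: "E t \<noteq> {0}"
    define S where "S = {w\<in>W. \<forall>b\<in>\<pp> 0. \<rho> (Kel 0 b 0 0) w = w}"
    have S: "subspace S"
      unfolding S_def by (intro subspaceI) (auto simp: rep_sub rep_zero rep_add rep_scale K_simps(1) pp_0)
    have ES: "E t \<subseteq> S" unfolding S_def using E_Kel_upper[OF _ t] E_W by auto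
    have S0: "S \<noteq> {0}" using ES nz subspace_0[OF subspace_E, of t] by auto
    have inv: "\<rho> (Kel a b c d) w \<in> S" if i: "a \<in> \<pp> 0" "b \<in> \<pp> 0" "c \<in> \<pp> 0" "d \<in> \<pp> 0" and w: "w \<in> S" for a
        b c d w
    proof -
      have wW: "w \<in> W" using w by (simp add: S_def)
      have "\<rho> (Kel 0 b' 0 0) (\<rho> (Kel a b c d) w) = \<rho> (Kel a b c d) w" if b': "b' \<in> \<pp> 0" for b'
      proof -
        have "\<rho> (Kel 0 b' 0 0) (\<rho> (Kel a b c d) w) = \<rho> (Kel a b c d) (\<rho> (Kel 0 b' 0 0) w)"
          using i b' wW by (simp add: rep_mult[symmetric] K_simps(1,2) pp_0 add.commute)
        then show ?thesis using w b' by (simp add: S_def)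
      qed
      then show ?thesis using i wW by (simp add: S_def rep_closed K_simps(1))
    qed
    obtain w x11 x12 x21 x22 where w: "w \<in> S" "w \<noteq> 0"
      and x: "x11 \<in> \<pp> 0" "x12 \<in> \<pp> 0" "x21 \<in> \<pp> 0" "x22 \<in> \<pp> 0" and k: "Kchar x11 x12 x21 x22 w"
      by (rule Kchar_exists[OF S _ S0 inv]) (auto simp: S_def)
    have "x21 \<in> \<pp> 1"
    proof (rule Psi_P_faithful[OF x(3)])
      fix z assume z: "z \<in> \<pp> 0"
      have "\<rho> (Kel 0 z 0 0) w = scale (\<Psi> (P * (x11 * 0 + x12 * 0 + x21 * z + x22 * 0))) w"
        using k z pp_0[of 0] unfolding Kchar_def by blast
      then have "scale (\<Psi> (P * (x21 * z))) w = scale 1 w" using w(1) z by (simp add: S_def)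
      then show "\<Psi> (P * (x21 * z)) = 1" using w(2) scale_cancel_right by blast
    qed
    moreover have "unit x21" using cuspidal_lower_left_unit[OF cusp k _ w(2) x] w(1) by (simp add: S_def)
    ultimately show False by (simp add: unit_iff)
  qed
  then show ?thesis using dim_le_card[of "E t" "{}"] by simp
qed

text \<open>The upper bound is \<open>E_top_line\<close>; existence remains. On S the upper
  unipotent part of the congruence subgroup acts through x21, and U preserves S. A U-eigenvector in
  S has a character \<open>\<Psi> (a * b)\<close> with a congruent to x21, hence a is a unit, and a
  diagonal matrix rescales a to 1.\<close>

lemma cuspidal_dim_top:
  assumes cusp: "cuspidal_rep v \<omega> \<psi> l scale W \<rho>"
  shows "dim (E l) = 1"
proof -
  obtain w x11 x12 x21 x22 where w: "w \<in> W" "w \<noteq> 0"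
    and x: "x11 \<in> \<pp> 0" "x12 \<in> \<pp> 0" "x21 \<in> \<pp> 0" "x22 \<in> \<pp> 0" and k: "Kchar x11 x12 x21 x22 w"
    by (rule ex_Kchar)
  have ux: "unit x21" by (rule cuspidal_lower_left_unit[OF cusp k w x])
  define S where "S = {w\<in>W. \<forall>b\<in>\<pp> 0. \<rho> (Kel 0 b 0 0) w = scale (\<Psi> (P * (x21 * b))) w}"
  have S: "subspace S"
    unfolding S_def by (intro subspaceI)
      (auto simp: rep_sub rep_zero rep_add rep_scale K_simps(1) pp_0 scale_right_distrib mult.commute)
  have "w \<in> S"
    unfolding S_def
  proof (intro CollectI conjI ballI w(1))
    fix b assume b: "b \<in> \<pp> 0"
    have "\<rho> (Kel 0 b 0 0) w = scale (\<Psi> (P * (x11 * 0 + x12 * 0 + x21 * b + x22 * 0))) w"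
      using k b pp_0[of 0] unfolding Kchar_def by blast
    then show "\<rho> (Kel 0 b 0 0) w = scale (\<Psi> (P * (x21 * b))) w" by simp
  qed
  then have S0: "S \<noteq> {0}" using w(2) by auto
  have SW: "S \<subseteq> W" by (auto simp: S_def)
  have inv: "\<rho> (M 1 b 0 1) w \<in> S" if b: "b \<in> \<pp> 0" and w: "w \<in> S" for b w
  proof -
    have wW: "w \<in> W" using w by (simp add: S_def)
    have ug: "M 1 b 0 1 \<in> carrier GL" by (rule M_in_GL[OF gl_unip[OF b]])
    have "\<rho> (Kel 0 b' 0 0) (\<rho> (M 1 b 0 1) w) = scale (\<Psi> (P * (x21 * b'))) (\<rho> (M 1 b 0 1) w)" if b': "b'
        \<in> \<pp> 0" for b'
    proof -
      have "Kel 0 b' 0 0 \<otimes>\<^bsub>GL\<^esub> M 1 b 0 1 = M 1 b 0 1 \<otimes>\<^bsub>GL\<^esub> Kel 0 b' 0 0"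
        using b b' by (intro Kel_conj[OF l2 gl_unip[OF b]]) (simp_all add: pp_0)
      then have "\<rho> (Kel 0 b' 0 0) (\<rho> (M 1 b 0 1) w) = \<rho> (M 1 b 0 1) (\<rho> (Kel 0 b' 0 0) w)"
        using ug b' wW by (simp add: rep_mult[symmetric] K_simps(1) pp_0)
      then show ?thesis using w b' wW ug by (simp add: S_def rep_scale)
    qed
    then show ?thesis using wW ug by (simp add: S_def rep_closed)
  qed
  obtain y a where y: "y \<in> S" "y \<noteq> 0" and a: "a \<in> \<pp> 0"
    and ev: "\<And>b. b \<in> \<pp> 0 \<Longrightarrow> \<rho> (M 1 b 0 1) y = scale (\<Psi> (a * b)) y"
    using unip_eigvec[OF S SW S0 inv] by blast
  have yW: "y \<in> W" using y by (simp add: S_def)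
  have "a - x21 \<in> \<pp> 1"
  proof (rule Psi_P_faithful2[OF a x(3)])
    fix z assume z: "z \<in> \<pp> 0"
    have Pz: "P * z \<in> \<pp> 0" using z P_pp(2) by (rule pp_mult_left[rotated])
    have "\<rho> (M 1 (P * z) 0 1) y = scale (\<Psi> (P * (x21 * z))) y"
      using y(1) z unfolding S_def Kel_def by simp
    then have "scale (\<Psi> (a * (P * z))) y = scale (\<Psi> (P * (x21 * z))) y" using ev[OF Pz] by metis
    then show "\<Psi> (P * (a * z)) = \<Psi> (P * (x21 * z))" using y(2) by (simp add: mult.left_commute)
  qed
  then have ua: "unit a" using unit_add[OF ux, of "a - x21"] by simp
  have g: "gl a 0 0 1" using ua by (simp add: gl_upper unit_1 pp_0)
  have "\<rho> (M a 0 0 1) y \<in> E l"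
    unfolding E_iff
  proof (intro conjI ballI)
    show "\<rho> (M a 0 0 1) y \<in> W" using g yW by (intro rep_closed M_in_GL)
    fix b assume b: "b \<in> \<pp> 0"
    have ba: "b / a \<in> \<pp> 0" "a * (b / a) = b" using b ua unit_nonzero[OF ua] by (auto intro: pp_divide_unit)
    have "\<rho> (M 1 b 0 1) (\<rho> (M a 0 0 1) y) = \<rho> (M a 0 0 1) (\<rho> (M 1 (b / a) 0 1) y)"
      using act_mult[OF gl_unip[OF b] g yW] act_mult[OF g gl_unip[OF ba(1)] yW] ba(2) by simp
    also have "\<dots> = scale (\<Psi> b) (\<rho> (M a 0 0 1) y)"
      unfolding ev[OF ba(1)] ba(2) by (rule rep_scale[OF M_in_GL[OF g] yW])
    finally show "\<rho> (M 1 b 0 1) (\<rho> (M a 0 0 1) y) = scale (\<Psi> (\<omega> ^ (l - l) * b)) (\<rho> (M a 0 0 1) y)" by simp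
  qed
  moreover have "\<rho> (M a 0 0 1) y \<noteq> 0" by (rule rep_nonzero[OF M_in_GL[OF g] yW y(2)])
  ultimately show ?thesis using dim_line E_top_line by blast
qed

text \<open>It suffices to find a nonzero \<open>Wt\<close> space whose two weights differ by a
  unit. If x21 vanishes in the residue field, the diagonal entries of x are such weights; otherwise
  conjugation makes x upper triangular with the two roots on the diagonal.\<close>

lemma split_dim:
  assumes split: "split_semisimple_rep v \<omega> \<psi> l scale W \<rho>" and t: "t < l"
  shows "dim (E t) = 2"
proof -
  obtain w x11 x12 x21 x22 where w: "w \<in> W" "w \<noteq> 0"
    and x: "x11 \<in> \<pp> 0" "x12 \<in> \<pp> 0" "x21 \<in> \<pp> 0" "x22 \<in> \<pp> 0" and k: "Kchar x11 x12 x21 x22 w"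
    by (rule ex_Kchar)
  have "split_semisimple_mat (residue_field v) (residue_mat x11 x12 x21 x22)"
    using split Kchar_char_occurs[OF k w x] unfolding split_semisimple_rep_def by blast
  then obtain r' s' where rs': "r' \<noteq> s'"
    "ring.is_root (residue_field v) (charpoly2 (residue_field v) (residue_mat x11 x12 x21 x22)) r'"
    "ring.is_root (residue_field v) (charpoly2 (residue_field v) (residue_mat x11 x12 x21 x22)) s'"
    unfolding split_semisimple_mat_def by blast
  have "ring (residue_field v)" using cring_trunc_ring[of 1] by (simp add: residue_field_eq cring.axioms(1))
  then have "r' \<in> trunc v 1 ` \<pp> 0" "s' \<in> trunc v 1 ` \<pp> 0"
    using rs' carrier_trunc_ring[of 1] by (auto simp: ring.is_root_def residue_field_eq)
  then obtain r s where r: "r \<in> \<pp> 0" "r' = trunc v 1 r" and s: "s \<in> \<pp> 0" "s' = trunc v 1 s" by blast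
  have rr: "r * r - (x11 + x22) * r + (x11 * x22 - x12 * x21) \<in> \<pp> 1"
    using rs'(2) is_root_charpoly2[OF x r(1)] unfolding r residue_mat_def by blast
  have ss: "s * s - (x11 + x22) * s + (x11 * x22 - x12 * x21) \<in> \<pp> 1"
    using rs'(3) is_root_charpoly2[OF x s(1)] unfolding s residue_mat_def by blast
  have "r - s \<notin> \<pp> 1" using rs'(1) unfolding r s by (simp add: trunc_eq_iff)
  then have urs: "unit (r - s)" using r s by (simp add: unit_iff pp_diff)
  \<comment> \<open>The difference of the two root equations is divisible by the unit r - s; the
    quotient says that the roots add up to the trace.\<close>
  have "(r + s - (x11 + x22)) * (r - s) \<in> \<pp> 1"
    using pp_diff[OF rr ss] by (simp add: algebra_simps)
  then have tr: "r + s - (x11 + x22) \<in> \<pp> 1" using pp_mult_unit_iff[OF urs] by blast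
  show ?thesis
  proof (cases "x21 \<in> \<pp> 1")
    case True
    have p: "(y - x11) * (y - x22) \<in> \<pp> 1" if "y * y - (x11 + x22) * y + (x11 * x22 - x12 * x21) \<in> \<pp> 1" for y
    proof -
      have "x12 * x21 \<in> \<pp> 1" using True x by (simp add: pp_closed)
      from pp_add[OF that this] show ?thesis by (simp add: algebra_simps)
    qed
    \<comment> \<open>If the diagonal entries agreed, both roots would agree with x11 in the residue
      field, and so with each other.\<close>
    have "unit (x11 - x22)"
    proof (rule ccontr)
      assume "\<not> unit (x11 - x22)"
      then have d: "x11 - x22 \<in> \<pp> 1" using x by (simp add: unit_iff pp_diff)
      have q: "y - x11 \<in> \<pp> 1" if y: "y \<in> \<pp> 0" "(y - x11) * (y - x22) \<in> \<pp> 1" for y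
      proof (rule ccontr)
        assume n: "y - x11 \<notin> \<pp> 1"
        then have "unit (y - x11)" using y x by (simp add: unit_iff pp_diff)
        moreover have "unit (y - x22)" using unit_add[OF calculation d] by simp
        ultimately have "unit ((y - x11) * (y - x22))" by (rule unit_mult)
        then show False using y(2) by (simp add: unit_iff)
      qed
      have "r - s \<in> \<pp> 1" using pp_diff[OF q[OF r(1) p[OF rr]] q[OF s(1) p[OF ss]]] by simp
      then show False using urs by (simp add: unit_iff)
    qed
    moreover have "w \<in> Wt x11 x22" by (rule Kchar_Wt[OF k w(1) True x(1,4)])
    ultimately show ?thesis using dim_E_split[OF x(1,4) _ _ t] w(2) by blast
  next
    case False
    then have u: "unit x21" using x by (simp add: unit_iff)
    note u0 = unit_nonzero[OF u]
    \<comment> \<open>The lower left entry of the conjugate, multiplied by x21, is minus the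
      characteristic polynomial at x11 + x21 y. The choice of y makes this argument the root
      r.\<close>
    define y where "y = (r - x11) / x21"
    have y: "y \<in> \<pp> 0" unfolding y_def using r x u by (intro pp_divide_unit pp_diff)
    have yx: "x21 * y = r - x11" using u0 by (simp add: y_def)
    have "(x12 - x11 * y - x21 * y * y + x22 * y) * x21 = x12 * x21 - x11 * (x21 * y) - (x21 * y) * (x21
        * y) + x22 * (x21 * y)"
      by (simp add: algebra_simps)
    also have "\<dots> = - (r * r - (x11 + x22) * r + (x11 * x22 - x12 * x21))"
      unfolding yx by (simp add: algebra_simps)
    also have "\<dots> \<in> \<pp> 1" using rr by (simp only: pp_uminus)
    finally have e: "x12 - x11 * y - x21 * y * y + x22 * y \<in> \<pp> 1" using pp_mult_unit_iff[OF u] by blast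
    have "\<rho> (M 0 1 1 y) w \<in> Wt (x22 - x21 * y) (x11 + x21 * y)"
      by (rule Kchar_swap[OF k w(1) x y e])
    also have "Wt (x22 - x21 * y) (x11 + x21 * y) = Wt s r"
    proof (rule Wt_cong)
      show "x22 - x21 * y - s \<in> \<pp> 1" using tr pp_uminus[of "r + s - (x11 + x22)" 1] unfolding yx by
          (simp add: algebra_simps)
      show "x11 + x21 * y - r \<in> \<pp> 1" unfolding yx by (simp add: pp_0)
    qed
    finally have "Wt s r \<noteq> {0}"
      using rep_nonzero[OF M_in_GL[OF gl_anti[OF y]] w] by auto
    moreover have "unit (s - r)" using urs unit_uminus[of "r - s"] by simp
    ultimately show ?thesis using dim_E_split[OF s(1) r(1) _ _ t] by blast
  qed
qed

end

section \<open>The residue field case, \<open>l = 1\<close>\<close>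

lemma E_0_span:
  assumes l1: "l = 1" and w: "w \<in> E 0" "borel_eig w"
  shows "E 0 \<subseteq> span {w, avgU 0 (\<rho> (M 0 1 1 0) w)}"
proof -
  have wW: "w \<in> W" "w \<noteq> 0" using w by (auto simp: borel_eig_def)
  let ?x = "avgU 0 (\<rho> (M 0 1 1 0) w)"
  show ?thesis
    unfolding E_def
  proof (rule eigsp_span_subset[OF char_on_unipotent wW subspace_span])
    fix g assume "g \<in> carrier GL"
    then obtain a b c d where g: "gl a b c d" "g = M a b c d" by (auto simp: carrier_GL)
    show "avgU 0 (\<rho> g w) \<in> span {w, ?x}"
    proof (cases "unit c")
      case True
      then show ?thesis unfolding g(2) using avgU_big_cell[OF w(2) g(1) True] span_mono[of "{?x}" "{w,
          ?x}"] by blast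
    next
      case False
      \<comment> \<open>For \<open>l = 1\<close> a lower left entry that is not a unit vanishes. So
        there are only two Bruhat cells, and in the small one the matrix acts on w by a
        scalar.\<close>
      then have c: "c \<in> \<pp> 1" using gl_int[OF g(1)] by (simp add: unit_iff)
      have "M a b c d = M a b 0 d" unfolding M_eq_iff using c l1 by (simp add: pp_0)
      moreover obtain k where "\<rho> (M a b 0 d) w = scale k w"
        using borel_eigD[OF w(2)] gl_unit_cases[OF g(1) c] gl_int[OF g(1)] by blast
      moreover have "avgU 0 w = w" using avg_eq[OF char_on_unipotent] w(1) unfolding E_def by blast
      ultimately have "avgU 0 (\<rho> g w) = scale k w" using wW by (simp add: g(2) avgU_scale)
      then show ?thesis by (simp add: span_scale span_base)
    qed
  qed
qed

lemma dim_E_le_2_residue: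
  assumes l1: "l = 1"
  shows "dim (E 0) \<le> 2"
proof (cases "E 0 = {0}")
  case True
  then show ?thesis using dim_le_card[of "E 0" "{}"] by simp
next
  case False
  \<comment> \<open>For t = 0 the factor \<open>\<omega> ^ l\<close> makes the character trivial, so
    \<open>E 0\<close> consists of the U-fixed vectors, which the diagonal torus preserves.\<close>
  have U: "\<rho> (M 1 b 0 1) w = w" if "b \<in> \<pp> 0" "w \<in> E 0" for b w
  proof -
    have "\<omega> ^ (l - 0) * b \<in> \<pp> l" using pp_mult_right[OF uniformiser_power(1) that(1)] by simp
    then show ?thesis using that Psi_eq_1 by (simp add: E_iff)
  qed
  have T: "\<rho> (M a 0 0 d) w \<in> E 0" if t: "unit a" "unit d" "w \<in> E 0" for a d w
    unfolding E_iff
  proof (intro conjI ballI)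
    have g: "gl a 0 0 d" using t by (simp add: gl_upper pp_0)
    have wW: "w \<in> W" using t E_W by blast
    show "\<rho> (M a 0 0 d) w \<in> W" using g wW by (intro rep_closed M_in_GL)
    fix b assume b: "b \<in> \<pp> 0"
    have "b * d \<in> \<pp> 0" using b t unit_int by (simp add: pp_mult_left)
    then have b': "b * d / a \<in> \<pp> 0" "a * (b * d / a) = b * d"
      using t unit_nonzero[OF t(1)] by (auto intro: pp_divide_unit)
    have "\<rho> (M 1 b 0 1) (\<rho> (M a 0 0 d) w) = \<rho> (M a 0 0 d) (\<rho> (M 1 (b * d / a) 0 1) w)"
      using act_mult[OF gl_unip[OF b] g wW] act_mult[OF g gl_unip[OF b'(1)] wW] b'(2) by simp
    also have "\<rho> (M 1 (b * d / a) 0 1) w = w" by (rule U[OF b'(1) t(3)])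
    also have "\<Psi> (\<omega> ^ (l - 0) * b) = 1" using pp_mult_right[OF uniformiser_power(1) b, of l] by (simp
        add: Psi_eq_1)
    then have "\<rho> (M a 0 0 d) w = scale (\<Psi> (\<omega> ^ (l - 0) * b)) (\<rho> (M a 0 0 d) w)" by simp
    finally show "\<rho> (M 1 b 0 1) (\<rho> (M a 0 0 d) w) = scale (\<Psi> (\<omega> ^ (l - 0) * b)) (\<rho> (M a 0 0 d) w)" .
  qed
  obtain w where w: "w \<in> E 0" "borel_eig w"
    by (rule borel_eig_exists[OF subspace_E _ False T U]) (use E_W in auto)
  let ?x = "avgU 0 (\<rho> (M 0 1 1 0) w)"
  have "E 0 \<subseteq> span {w, ?x}" by (rule E_0_span[OF l1 w])
  then have "dim (E 0) \<le> card {w, ?x}" by (rule dim_le_card) simp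
  also have "\<dots> \<le> 2" by (simp add: card_insert_if)
  finally show ?thesis .
qed

text \<open>For \<open>n(b)\<close> lower unipotent with \<open>b\<close> a unit, \<open>n(b) w\<close> lies in the big cell; if the average of
  \<open>s w\<close> vanished, averaging \<open>s (\<Sum> u s w) = 0\<close> would leave only the term \<open>w\<close> of \<open>b = 0\<close>.\<close>

lemma avgU_swap_nonzero:
  assumes l1: "l = 1" and w: "w \<in> E 0" "borel_eig w"
  shows "avgU 0 (\<rho> (M 0 1 1 0) w) \<noteq> 0"
proof
  let ?s = "M 0 1 1 0" and ?U = "unipotent R"
  assume 0: "avgU 0 (\<rho> ?s w) = 0"
  have wW: "w \<in> W" "w \<noteq> 0" using w by (auto simp: borel_eig_def)
  have gs: "gl 0 1 1 0" using gl_anti pp_0 by blast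
  note U = char_on_simps[OF char_on_unipotent[of 0]]
  have sw: "\<rho> ?s w \<in> W" using gs wW by (intro rep_closed M_in_GL)
  have uW: "\<rho> h (\<rho> ?s w) \<in> W" if "h \<in> ?U" for h using rep_closed[OF U(1)[OF that] sw] .
  have psi1: "psi_unip v \<omega> \<psi> 0 l h = 1" if h: "h \<in> ?U" for h
  proof -
    obtain b where b: "b \<in> \<pp> 0" "h = M 1 b 0 1" using h by (auto simp: unipotent_R)
    then show ?thesis using pp_mult_right[OF uniformiser_power(1) b(1), of l] by (simp add: psi_unip_M
        Psi_eq_1)
  qed
  have "(\<Sum>h\<in>?U. \<rho> h (\<rho> ?s w)) = 0"
  proof -
    have "scale (1 / of_nat (card ?U)) (\<Sum>h\<in>?U. \<rho> h (\<rho> ?s w)) = 0"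
      using 0 psi1 by (simp add: avg_def cong: sum.cong)
    then show ?thesis using char_on_card[OF char_on_unipotent[of 0]] by simp
  qed
  then have "0 = avgU 0 (\<rho> ?s (\<Sum>h\<in>?U. \<rho> h (\<rho> ?s w)))"
    using rep_zero[OF M_in_GL[OF gs]] linear_op_sum[OF avg_linear_op[OF char_on_unipotent[of 0]]
        rep_subspace, of "{}"] by simp
  also have "\<dots> = (\<Sum>h\<in>?U. avgU 0 (\<rho> ?s (\<rho> h (\<rho> ?s w))))"
    using uW rep_closed[OF M_in_GL[OF gs]]
    by (simp add: rep_sum[OF M_in_GL[OF gs]] linear_op_sum[OF avg_linear_op[OF char_on_unipotent]
        rep_subspace])
  also have "\<dots> = (\<Sum>h\<in>{\<one>\<^bsub>GL\<^esub>}. avgU 0 (\<rho> ?s (\<rho> h (\<rho> ?s w))))"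
  proof (rule sum.mono_neutral_right)
    show "finite ?U" "{\<one>\<^bsub>GL\<^esub>} \<subseteq> ?U" using U(3,4) by auto
    show "\<forall>h\<in>?U - {\<one>\<^bsub>GL\<^esub>}. avgU 0 (\<rho> ?s (\<rho> h (\<rho> ?s w))) = 0"
    proof
      fix h assume "h \<in> ?U - {\<one>\<^bsub>GL\<^esub>}"
      then obtain b where b: "b \<in> \<pp> 0" "h = M 1 b 0 1" "h \<noteq> M 1 0 0 1" by (auto simp: unipotent_R GL_one)
      have "b \<notin> \<pp> l" using b(2,3) unfolding b(2) M_eq_iff by (simp add: pp_0)
      then have ub: "unit b" using b l1 by (simp add: unit_iff)
      have gu: "gl 1 b 0 1" by (rule gl_unip[OF b(1)])
      have "\<rho> ?s (\<rho> h (\<rho> ?s w)) = \<rho> (M 1 0 b 1) w"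
        using act_mult[OF gu gs wW(1)] act_mult[OF gs gl_mult[OF gu gs] wW(1)] by (simp add: b(2))
      moreover have "avgU 0 (\<rho> (M 1 0 b 1) w) \<in> span {avgU 0 (\<rho> ?s w)}"
        by (rule avgU_big_cell[OF w(2) gl_low[OF b(1)] ub])
      ultimately show "avgU 0 (\<rho> ?s (\<rho> h (\<rho> ?s w))) = 0" using 0 by simp
    qed
  qed
  also have "\<dots> = avgU 0 (\<rho> (M 1 0 0 1) w)"
    using act_mult[OF gs gs wW(1)] rep_one[OF sw] by simp
  also have "\<dots> = w"
    using rep_one[OF wW(1)] avg_eq[OF char_on_unipotent] w(1) unfolding E_def GL_one by simp
  finally show False using wW by simp
qed

end

section \<open>The largest multiplicity\<close>

context trunc_data
begin

lemma gl2_repI: "irreducible_rep GL scale W \<rho> \<Longrightarrow> gl2_rep v \<omega> l \<psi> scale W \<rho>"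
  by (intro gl2_rep.intro trunc_data_axioms)

lemma unit_trunc_iff:
  assumes "a \<in> \<pp> 0"
  shows "tr a \<in> Units R \<longleftrightarrow> unit a"
proof
  assume u: "unit a"
  then have i: "inverse a \<in> \<pp> 0" using unit_inverse unit_int by blast
  have "tr (inverse a) \<otimes>\<^bsub>R\<^esub> tr a = \<one>\<^bsub>R\<^esub>" "tr a \<otimes>\<^bsub>R\<^esub> tr (inverse a) = \<one>\<^bsub>R\<^esub>"
    using assms i unit_nonzero[OF u] by (simp_all add: trunc_simps)
  then show "tr a \<in> Units R" using assms i trunc_simps(7) unfolding Units_def by blast
next
  assume "tr a \<in> Units R"
  then obtain B where "B \<in> carrier R" "tr a \<otimes>\<^bsub>R\<^esub> B = \<one>\<^bsub>R\<^esub>" unfolding Units_def by blast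
  then obtain b where b: "b \<in> \<pp> 0" "tr a \<otimes>\<^bsub>R\<^esub> tr b = \<one>\<^bsub>R\<^esub>" by (auto simp: carrier_R)
  then have "a * b - 1 \<in> \<pp> l" using assms by (simp add: trunc_simps trunc_eq_iff)
  then have "unit (1 + (a * b - 1))" using l_pos pp_mono by (intro unit_add unit_1) blast
  then show "unit a" using assms b by (simp add: unit_mult_iff)
qed

text \<open>The character of the Borel subgroup is a nontrivial \<open>\<eta>\<close> of the upper
  left entry. The diagonal matrix (t, 1) acts on w by \<open>\<eta>\<close> of t, which is not 1,
  and trivially on the average of s w, since the Weyl element s moves t to the lower right. Hence
  the two spanning vectors of \<open>E 0\<close> are independent.\<close>

lemma ex_rep_dim_2_residue:
  assumes l1: "l = 1"
  shows "\<exists>W \<rho>. (W, \<rho>) \<in> Irr GL \<and> dim_Hom_V v \<omega> \<psi> 0 l (fun_scale (*)) W \<rho> = 2"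
proof -
  interpret A: comm_group "units_of R" by (rule R.units_comm_group)
  have fin: "finite (carrier (units_of R))"
    using finite_R by (rule rev_finite_subset) (auto simp: units_of_def Units_def)
  \<comment> \<open>Since 2 is a unit, -1 is an element of the unit group other than 1; this
    guarantees a nontrivial character of that group.\<close>
  have "(-1::'a) - 1 \<notin> \<pp> 1"
    using unit_two[OF odd_residue_char] pp_uminus[of 2 1] by (simp add: unit_iff)
  then have ne: "tr (-1) \<noteq> tr 1" using l1 by (simp add: trunc_eq_iff)
  have "unit (-1)" by (simp add: unit_uminus unit_1)
  then have "tr (-1) \<in> carrier (units_of R)"
    using unit_trunc_iff[of "-1"] by (simp add: units_of_def pp_uminus pp_1)
  moreover have "tr (-1) \<noteq> \<one>\<^bsub>units_of R\<^esub>" using ne by (simp add: units_of_def trunc_simps)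
  ultimately obtain \<eta> :: "'a set \<Rightarrow> complex"
    where \<eta>: "\<And>g h. g \<in> Units R \<Longrightarrow> h \<in> Units R \<Longrightarrow> \<eta> (g \<otimes>\<^bsub>R\<^esub> h) = \<eta> g * \<eta> h"
      "\<eta> (tr 1) = 1" and ex: "\<exists>g\<in>Units R. \<eta> g \<noteq> 1"
    using A.nontrivial_character[OF fin, of "tr (-1)"] by (auto simp: units_of_def trunc_simps(5))
  obtain g where g: "g \<in> Units R" "\<eta> g \<noteq> 1" using ex by blast
  have "g \<in> tr ` \<pp> 0" using g by (simp add: carrier_R[symmetric] Units_def)
  then obtain t where t: "t \<in> \<pp> 0" "g = tr t" by blast
  have ut: "unit t" using g t unit_trunc_iff by blast
  define B where "B = {M a b 0 d | a b d. unit a \<and> b \<in> \<pp> 0 \<and> unit d}"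
  define \<theta> where "\<theta> h = (case h of Mat2 a b c d \<Rightarrow> \<eta> a)" for h
  have \<theta>: "\<theta> (M a b c d) = \<eta> (tr a)" for a b c d by (simp add: \<theta>_def M_def)
  interpret G: group GL by (rule group_GL)
  have ch: "char_on GL B \<theta>"
  proof (rule G.char_onI)
    show sub: "B \<subseteq> carrier GL" unfolding B_def by (auto intro: M_in_GL gl_upper)
    show "finite B" using sub finite_GL finite_subset by blast
    show "\<one>\<^bsub>GL\<^esub> \<in> B" unfolding GL_one B_def using unit_1 pp_0 by blast
    show "\<theta> \<one>\<^bsub>GL\<^esub> \<noteq> 0" by (simp add: GL_one \<theta> \<eta>(2))
    fix h h' assume "h \<in> B" "h' \<in> B"
    then obtain a b d a' b' d' where h: "h = M a b 0 d" "unit a" "b \<in> \<pp> 0" "unit d"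
      and h': "h' = M a' b' 0 d'" "unit a'" "b' \<in> \<pp> 0" "unit d'"
      unfolding B_def by blast
    have m: "h \<otimes>\<^bsub>GL\<^esub> h' = M (a * a') (a * b' + b * d') 0 (d * d')"
      using GL_mult[OF gl_upper[OF h(2-4)] gl_upper[OF h'(2-4)]] by (simp add: h h')
    have "a * b' + b * d' \<in> \<pp> 0" using h h' unit_int by (simp add: pp_closed)
    then show "h \<otimes>\<^bsub>GL\<^esub> h' \<in> B" unfolding m B_def using h h' unit_mult by blast
    show "\<theta> (h \<otimes>\<^bsub>GL\<^esub> h') = \<theta> h * \<theta> h'"
      unfolding m using \<eta>(1)[of "tr a" "tr a'"] h h' unit_int by (simp add: \<theta> unit_trunc_iff trunc_simps)
  qed
  obtain W \<rho> where W: "(W, \<rho>) \<in> Irr GL" "complex_rep.eigsp (fun_scale (*)) W \<rho> B \<theta> \<noteq> {0}"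
    using Irr_with_eigenvector[OF group_GL finite_GL ch] by blast
  interpret W: gl2_rep v \<omega> l \<psi> "fun_scale (*)" W \<rho>
    using W(1) by (intro gl2_repI) (simp add: Irr_def)
  have "W.subspace (W.eigsp B \<theta>)" using G.char_on_simps(1)[OF ch] by (intro W.subspace_eigsp) blast
  then obtain w where w: "w \<in> W.eigsp B \<theta>" "w \<noteq> 0" using W(2) W.subspace_0 by blast
  have wW: "w \<in> W" using w by (simp add: W.eigsp_def)
  have ev: "\<rho> (M a b 0 d) w = fun_scale (*) (\<eta> (tr a)) w" if "unit a" "b \<in> \<pp> 0" "unit d" for a b d
  proof -
    have "M a b 0 d \<in> B" unfolding B_def using that by blast
    then show ?thesis using w(1) \<theta>[of a b 0 d] unfolding W.eigsp_def by simp
  qed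
  have psi1: "\<Psi> (\<omega> ^ (l - 0) * b) = 1" if "b \<in> \<pp> 0" for b
    using pp_mult_right[OF uniformiser_power(1) that, of l] by (simp add: Psi_eq_1)
  have u: "\<rho> (M 1 b 0 1) w = w" if "b \<in> \<pp> 0" for b
    using ev[OF unit_1 that unit_1] by (simp add: \<eta>)
  have wE: "w \<in> W.E 0" using wW u psi1 by (simp add: W.E_iff)
  have wb: "W.borel_eig w" unfolding W.borel_eig_def using wW w(2) u ev pp_0 by blast
  let ?s = "M 0 1 1 0"
  let ?x = "W.avgU 0 (\<rho> ?s w)"
  have gs: "gl 0 1 1 0" using gl_anti pp_0 by blast
  have sw: "\<rho> ?s w \<in> W" using gs wW by (intro W.rep_closed M_in_GL)
  have x0: "?x \<noteq> 0" by (rule W.avgU_swap_nonzero[OF l1 wE wb])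
  have gt: "gl t 0 0 1" "gl 1 0 0 t" using ut unit_1 pp_0 by (auto intro: gl_upper)
  have "\<rho> (M t 0 0 1) ?x = W.avgU 0 (\<rho> (M t 0 0 1) (\<rho> ?s w))"
  proof (rule W.avg_commute[OF char_on_unipotent M_in_GL[OF gt(1)] sw])
    fix h assume "h \<in> unipotent R"
    then obtain b where b: "b \<in> \<pp> 0" "h = M 1 b 0 1" by (auto simp: unipotent_R)
    have tb: "t * b \<in> \<pp> 0" using t(1) b(1) by (rule pp_mult_left)
    have "M t 0 0 1 \<otimes>\<^bsub>GL\<^esub> h = M 1 (t * b) 0 1 \<otimes>\<^bsub>GL\<^esub> M t 0 0 1"
      using GL_mult[OF gt(1) gl_unip[OF b(1)]] GL_mult[OF gl_unip[OF tb] gt(1)] b(2) by simp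
    moreover have "psi_unip v \<omega> \<psi> 0 l (M 1 (t * b) 0 1) = psi_unip v \<omega> \<psi> 0 l h"
      using psi1[OF tb] psi1[OF b(1)] by (simp only: psi_unip_M[OF tb] b(2) psi_unip_M[OF b(1)])
    ultimately show "\<exists>h'\<in>unipotent R. M t 0 0 1 \<otimes>\<^bsub>GL\<^esub> h = h' \<otimes>\<^bsub>GL\<^esub> M t 0 0 1 \<and>
        psi_unip v \<omega> \<psi> 0 l h' = psi_unip v \<omega> \<psi> 0 l h"
      unfolding unipotent_R using tb by blast
  qed
  also have "\<rho> (M t 0 0 1) (\<rho> ?s w) = \<rho> ?s (\<rho> (M 1 0 0 t) w)"
    using W.act_mult[OF gt(1) gs wW] W.act_mult[OF gs gt(2) wW] by simp
  also have "\<rho> (M 1 0 0 t) w = w" using ev[OF unit_1 pp_0 ut] by (simp add: \<eta>)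
  finally have tx: "\<rho> (M t 0 0 1) ?x = ?x" .
  have "?x \<notin> W.span {w}"
  proof
    assume "?x \<in> W.span {w}"
    then obtain k where k: "?x = fun_scale (*) k w" by (auto simp: W.span_singleton)
    have "?x = fun_scale (*) k (fun_scale (*) (\<eta> (tr t)) w)"
      using tx ev[OF ut pp_0 unit_1] W.rep_scale[OF M_in_GL[OF gt(1)] wW, of k] unfolding k by simp
    then have "fun_scale (*) (k * \<eta> (tr t)) w = fun_scale (*) k w" using k by simp
    then have "k * \<eta> (tr t) = k" using w(2) W.scale_cancel_right by blast
    then have "k = 0" using g(2) t(2) by auto
    then show False using k x0 by simp
  qed
  then have "W.dim (W.E 0) = 2"
    using W.dim_plane[OF wE W.avgU_in[OF sw] W.E_0_span[OF l1 wE wb] w(2)] by blast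
  then show ?thesis using W(1) W.dim_Hom_V_eq by metis
qed

text \<open>The weights 1 and 0 are a pair whose difference is a unit. An irreducible representation
  with an eigenvector of \<open>H2\<close> for them has \<open>Wt 1 0\<close> nonzero, and
  \<open>dim_E_split\<close> applies.\<close>

lemma ex_rep_dim_2:
  assumes l2: "l \<ge> 2"
  shows "\<exists>W \<rho>. (W, \<rho>) \<in> Irr GL \<and> dim_Hom_V v \<omega> \<psi> (l - 1) l (fun_scale (*)) W \<rho> = 2"
proof -
  obtain W \<rho> where W: "(W, \<rho>) \<in> Irr GL" "complex_rep.eigsp (fun_scale (*)) W \<rho> H2 (H2_char 1 0) \<noteq> {0}"
    using Irr_with_eigenvector[OF group_GL finite_GL char_on_H2[OF l2 pp_1 pp_0]] by blast
  interpret W: gl2_rep v \<omega> l \<psi> "fun_scale (*)" W \<rho>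
    using W(1) by (intro gl2_repI) (simp add: Irr_def)
  have "W.Wt 1 0 \<noteq> {0}"
    using W(2) W.eigsp_H2[OF l2 pp_1 pp_0] W.subspace_0[OF W.subspace_E] W.subspace_0[OF
        W.subspace_Wt[OF l2]] by auto
  then have "W.dim (W.E (l - 1)) = 2"
    using l2 unit_1 by (intro W.dim_E_split[OF l2 pp_1 pp_0]) auto
  then show ?thesis using W(1) W.dim_Hom_V_eq by metis
qed

lemma max_mult_eq: "max_mult v \<omega> \<psi> (l - 1) l = 2"
proof (rule antisym)
  have "dim_Hom_V v \<omega> \<psi> (l - 1) l (fun_scale (*)) W \<rho> \<le> 2" if "(W, \<rho>) \<in> Irr GL" for W \<rho>
  proof -
    interpret W: gl2_rep v \<omega> l \<psi> "fun_scale (*)" W \<rho>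
      using that by (intro gl2_repI) (simp add: Irr_def)
    show ?thesis
    proof (cases "l = 1")
      case True
      then show ?thesis using W.dim_E_le_2_residue W.dim_Hom_V_eq[of 0] by simp
    next
      case False
      then show ?thesis using W.dim_E_le_2 W.dim_Hom_V_eq l_pos by simp
    qed
  qed
  then show "max_mult v \<omega> \<psi> (l - 1) l \<le> 2"
    unfolding max_mult_def numeral_eq_enat by (intro SUP_least) auto
  obtain W \<rho> where W: "(W, \<rho>) \<in> Irr GL" "dim_Hom_V v \<omega> \<psi> (l - 1) l (fun_scale (*)) W \<rho> = 2"
  proof (cases "l = 1")
    case True
    then show ?thesis using ex_rep_dim_2_residue that by auto
  next
    case False
    then show ?thesis using ex_rep_dim_2 l_pos that by force
  qed
  show "2 \<le> max_mult v \<omega> \<psi> (l - 1) l"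
    unfolding max_mult_def numeral_eq_enat
    by (rule SUP_upper2[OF W(1)]) (simp add: W(2))
qed

end

theorem theorem1p4:
  fixes v :: "'a::field \<Rightarrow> int" and \<omega> :: 'a and l :: nat and \<psi> :: "'a set \<Rightarrow> complex"
  assumes "nonarch_local_field v"
    and "odd (residue_char v)"
    and "\<omega> \<in> carrier (val_ring v)" and "max_ideal v = PIdl\<^bsub>val_ring v\<^esub> \<omega>"
    and "l \<ge> 1"
    and "primitive_char v \<omega> l \<psi>"
  shows "max_mult v \<omega> \<psi> (l - 1) l = 2 \<and>
    (l \<ge> 2 \<longrightarrow>
      (\<forall>(scale :: complex \<Rightarrow> 'v::ab_group_add \<Rightarrow> 'v) W \<rho>.
        cuspidal_rep v \<omega> \<psi> l scale W \<rho> \<longrightarrow>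
          dim_Hom_V v \<omega> \<psi> l l scale W \<rho> = 1 \<and>
          (\<forall>t<l. dim_Hom_V v \<omega> \<psi> t l scale W \<rho> = 0))) \<and>
    (l \<ge> 2 \<longrightarrow>
      (\<forall>t<l. \<forall>(scale :: complex \<Rightarrow> 'v \<Rightarrow> 'v) W \<rho>.
        split_semisimple_rep v \<omega> \<psi> l scale W \<rho> \<longrightarrow>
          dim_Hom_V v \<omega> \<psi> t l scale W \<rho> = 2))"
proof -
  interpret trunc_data v \<omega> l \<psi>
    using assms by (intro trunc_data.intro trunc_data_axioms.intro)
  show ?thesis
  proof (intro conjI impI allI)
    show "max_mult v \<omega> \<psi> (l - 1) l = 2" by (rule max_mult_eq)
  next
    fix scale :: "complex \<Rightarrow> 'v \<Rightarrow> 'v" and W \<rho>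
    assume l2: "l \<ge> 2" and c: "cuspidal_rep v \<omega> \<psi> l scale W \<rho>"
    interpret W: gl2_rep v \<omega> l \<psi> scale W \<rho>
      using c by (intro gl2_repI) (simp add: cuspidal_rep_def)
    show "dim_Hom_V v \<omega> \<psi> l l scale W \<rho> = 1"
      using W.dim_Hom_V_eq W.cuspidal_dim_top[OF l2 c] by simp
    show "dim_Hom_V v \<omega> \<psi> t l scale W \<rho> = 0" if "t < l" for t
      using W.dim_Hom_V_eq W.cuspidal_dim_lower[OF l2 c that] by simp
  next
    fix t and scale :: "complex \<Rightarrow> 'v \<Rightarrow> 'v" and W \<rho>
    assume l2: "l \<ge> 2" and t: "t < l" and c: "split_semisimple_rep v \<omega> \<psi> l scale W \<rho>"
    interpret W: gl2_rep v \<omega> l \<psi> scale W \<rho>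
      using c by (intro gl2_repI) (simp add: split_semisimple_rep_def)
    show "dim_Hom_V v \<omega> \<psi> t l scale W \<rho> = 2"
      using W.dim_Hom_V_eq W.split_dim[OF l2 c t] by simp
  qed
qed

end
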